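(* Let $n\geq 3$ and $m\geq 1$ be integers, and let $\sigma_{(m)}=\sigma_{(m)}(R)$ be the $m$th second-order Steklov eigenvalue (without counting multiplicity) of the closed geodesic ball of radius $R$. Then the function $\sigma_{(m)}\sin R$ is strictly increasing in $R\in(0,\pi)$ for geodesic balls in the sphere $\mathbb{S}^n$, and the function $\sigma_{(m)}\sinh R$ is strictly decreasing in $R\in(0,+\infty)$ for geodesic balls in the hyperbolic space $\mathbb{H}^n$.
   Context: $\mathbb{S}^n$ has constant curvature $+1$ and $\mathbb{H}^n$ has constant curvature $-1$; the geodesic ball of radius $R$ carries the metric $dr^2+h^2(r)g_{\mathbb{S}^{n-1}}$, $0\le r\le R$, with $h(r)=\sin r$ in $\mathbb{S}^n$ and $h(r)=\sinh r$ in $\mathbb{H}^n$. Second-order Steklov problem: on a smooth compact Riemannian manifold $M$ with boundary $\partial M$ and outward unit normal $\nu$, a real number $\sigma$ is an eigenvalue if there is a nontrivial $u$ with $\Delta u=0$ in $M$ and $\frac{\partial u}{\partial\nu}=\sigma u$ on $\partial M$. The spectrum is discrete, nonnegative and unbounded; the distinct eigenvalues (without counting multiplicity) are listed in increasing order as $0=\sigma_{(0)}<\sigma_{(1)}<\sigma_{(2)}<\cdots$. *)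

theory Defs
  imports "HOL-Analysis.Analysis"
begin

definition partial_deriv :: "'n \<Rightarrow> (real^'n \<Rightarrow> real) \<Rightarrow> real^'n \<Rightarrow> real"
  where "partial_deriv i f x = frechet_derivative f (at x) (axis i 1)"

primrec C_k_on :: "nat \<Rightarrow> (real^'n) set \<Rightarrow> (real^'n \<Rightarrow> real) \<Rightarrow> bool"
  where
    "C_k_on 0 U f \<longleftrightarrow> continuous_on U f"
  | "C_k_on (Suc k) U f \<longleftrightarrow> f differentiable_on U \<and> (\<forall>i. C_k_on k U (partial_deriv i f))"

text \<open>Smoothness up to the boundary, as usual for manifolds with boundary: there is a smooth
  extension to an open neighbourhood. Since \<^term>\<open>u\<close> is a total function, its values near
  \<^term>\<open>M\<close> are taken to be those of such an extension.\<close>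

definition smooth_up_to_boundary :: "(real^'n) set \<Rightarrow> (real^'n \<Rightarrow> real) \<Rightarrow> bool"
  where "smooth_up_to_boundary M u \<longleftrightarrow> (\<exists>U. open U \<and> M \<subseteq> U \<and> (\<forall>k. C_k_on k U u))"

text \<open>A Riemannian manifold with boundary covered by a single chart is given by a domain
  \<^term>\<open>M\<close> in coordinate space and the matrix field \<^term>\<open>G\<close> of its metric.\<close>

definition metric_inner :: "(real^'n \<Rightarrow> real^'n^'n) \<Rightarrow> real^'n \<Rightarrow> real^'n \<Rightarrow> real^'n \<Rightarrow> real"
  where "metric_inner G x v w = v \<bullet> (G x *v w)"

definition laplace_beltrami ::
    "(real^'n \<Rightarrow> real^'n^'n) \<Rightarrow> (real^'n \<Rightarrow> real) \<Rightarrow> real^'n \<Rightarrow> real"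
  where "laplace_beltrami G u x =
    (\<Sum>i\<in>UNIV. partial_deriv i
      (\<lambda>y. sqrt (det (G y)) * (\<Sum>j\<in>UNIV. matrix_inv (G y) $ i $ j * partial_deriv j u y)) x)
    / sqrt (det (G x))"

text \<open>Tangent vectors to the boundary are velocities of curves in it.\<close>

definition outward_unit_normal ::
    "(real^'n \<Rightarrow> real^'n^'n) \<Rightarrow> (real^'n) set \<Rightarrow> real^'n \<Rightarrow> real^'n \<Rightarrow> bool"
  where "outward_unit_normal G M x \<nu> \<longleftrightarrow>
    metric_inner G x \<nu> \<nu> = 1 \<and>
    (\<forall>\<gamma> v. \<gamma> 0 = x \<and> (\<forall>t. \<gamma> t \<in> frontier M) \<and> (\<gamma> has_vector_derivative v) (at (0::real))
        \<longrightarrow> metric_inner G x \<nu> v = 0) \<and>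
    (\<forall>\<^sub>F t in at_right 0. x + t *\<^sub>R \<nu> \<notin> M)"

definition steklov_eigenvalue ::
    "(real^'n \<Rightarrow> real^'n^'n) \<Rightarrow> (real^'n) set \<Rightarrow> real \<Rightarrow> bool"
  where "steklov_eigenvalue G M \<sigma> \<longleftrightarrow>
    (\<exists>u. smooth_up_to_boundary M u \<and> (\<exists>x\<in>M. u x \<noteq> 0) \<and>
      (\<forall>x\<in>interior M. laplace_beltrami G u x = 0) \<and>
      (\<forall>x\<in>frontier M. \<forall>\<nu>. outward_unit_normal G M x \<nu> \<longrightarrow>
          frechet_derivative u (at x) \<nu> = \<sigma> * u x))"

text \<open>The distinct eigenvalues in increasing order, numbered from \<open>0\<close>: the one with
  index \<^term>\<open>m\<close> has exactly \<^term>\<open>m\<close> eigenvalues below it.\<close>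

definition steklov_nth_eigenvalue ::
    "(real^'n \<Rightarrow> real^'n^'n) \<Rightarrow> (real^'n) set \<Rightarrow> nat \<Rightarrow> real"
  where "steklov_nth_eigenvalue G M m =
    (THE \<sigma>. steklov_eigenvalue G M \<sigma> \<and>
      finite {\<tau>. steklov_eigenvalue G M \<tau> \<and> \<tau> < \<sigma>} \<and>
      card {\<tau>. steklov_eigenvalue G M \<tau> \<and> \<tau> < \<sigma>} = m)"

text \<open>The metric \<open>dr\<^sup>2 + h(r)\<^sup>2 g\<close>, with \<open>g\<close> the round metric of the unit sphere, in geodesic
  normal coordinates \<open>x = r \<omega>\<close> about the centre, where \<open>r = norm x\<close> and \<open>norm \<omega> = 1\<close>. For
  \<open>h(0) = 0\<close> and \<open>h'(0) = 1\<close> it extends to the origin by the Euclidean inner product. The closed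
  geodesic ball of radius \<open>R\<close> is \<^term>\<open>cball 0 R\<close> in these coordinates, provided that \<open>R\<close> is
  less than \<open>pi\<close> for the sphere.\<close>

definition warped_metric :: "(real \<Rightarrow> real) \<Rightarrow> real^'n \<Rightarrow> real^'n^'n"
  where "warped_metric h x =
    (if x = 0 then mat 1
     else \<chi> i j. x $ i * x $ j / (norm x)\<^sup>2 +
       (h (norm x) / norm x)\<^sup>2 * ((if i = j then 1 else 0) - x $ i * x $ j / (norm x)\<^sup>2))"

abbreviation sphere_metric :: "real^'n \<Rightarrow> real^'n^'n"
  where "sphere_metric \<equiv> warped_metric sin"

abbreviation hyperbolic_metric :: "real^'n \<Rightarrow> real^'n^'n"
  where "hyperbolic_metric \<equiv> warped_metric sinh"

lemma metric_inner_warped: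
  assumes "x \<noteq> 0"
  shows "metric_inner (warped_metric h) x v w =
    (x \<bullet> v) * (x \<bullet> w) / (norm x)\<^sup>2 +
    (h (norm x) / norm x)\<^sup>2 * (v \<bullet> w - (x \<bullet> v) * (x \<bullet> w) / (norm x)\<^sup>2)"
proof -
  define a where "a = (norm x)\<^sup>2"
  define b where "b = (h (norm x) / norm x)\<^sup>2"
  have e: "(warped_metric h x *v w) $ i = (x \<bullet> w) / a * x $ i + b * (w $ i - (x \<bullet> w) / a * x $ i)" for i
  proof -
    have "(warped_metric h x *v w) $ i =
      (\<Sum>j\<in>UNIV. (1 - b) * (x $ i / a) * (x $ j * w $ j) + b * (if i = j then w $ j else 0))"
      using assms unfolding matrix_vector_mult_def warped_metric_def a_def[symmetric] b_def[symmetric]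
      by (auto intro!: sum.cong simp: algebra_simps diff_divide_distrib add_divide_distrib)
    also have "\<dots> = (1 - b) * (x $ i / a) * (x \<bullet> w) + b * w $ i"
      by (simp add: sum.distrib sum_distrib_left inner_vec_def if_distrib[of "(*) b"] cong: if_cong)
    finally show ?thesis by (simp add: algebra_simps add_divide_distrib diff_divide_distrib)
  qed
  have m: "warped_metric h x *v w = ((x \<bullet> w) / a) *\<^sub>R x + b *\<^sub>R (w - ((x \<bullet> w) / a) *\<^sub>R x)"
    by (simp add: vec_eq_iff e)
  show ?thesis
    unfolding metric_inner_def m a_def[symmetric] b_def[symmetric]
    by (simp add: inner_simps inner_commute algebra_simps)
qed

text \<open>The defining property in polar coordinates: a curve \<open>r(t) \<omega>(t)\<close> has velocity
  \<open>a \<omega> + r \<xi>\<close> with \<open>a = r'\<close> and \<open>\<xi> = \<omega>'\<close> orthogonal to \<open>\<omega>\<close>.\<close>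

lemma warped_metric_polar:
  assumes "r > 0" "norm \<omega> = 1" "\<omega> \<bullet> \<xi> = 0" "\<omega> \<bullet> \<eta> = 0"
  shows "metric_inner (warped_metric h) (r *\<^sub>R \<omega>) (a *\<^sub>R \<omega> + r *\<^sub>R \<xi>) (b *\<^sub>R \<omega> + r *\<^sub>R \<eta>) =
    a * b + (h r)\<^sup>2 * (\<xi> \<bullet> \<eta>)"
proof -
  have "\<omega> \<noteq> 0" using assms by auto
  moreover have "\<omega> \<bullet> \<omega> = 1" using assms by (simp add: dot_square_norm)
  ultimately show ?thesis
    using assms by (subst metric_inner_warped)
      (auto simp: inner_simps inner_commute field_simps power2_eq_square)
qed

lemma outward_unit_normal_cball:
  assumes "norm x = R" "R > 0" "h R \<noteq> 0"
  shows "outward_unit_normal (warped_metric h) (cball 0 R) x \<nu> \<longleftrightarrow> \<nu> = x /\<^sub>R R"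
proof
  have x0: "x \<noteq> 0" using assms by auto
  have xx: "x \<bullet> x = R\<^sup>2" using assms by (simp add: dot_square_norm)
  {
    assume \<nu>: "\<nu> = x /\<^sub>R R"
    have x\<nu>: "x \<bullet> \<nu> = R" and \<nu>\<nu>: "\<nu> \<bullet> \<nu> = 1"
      using assms by (simp_all add: \<nu> xx power2_eq_square field_simps)
    have "metric_inner (warped_metric h) x \<nu> \<nu> = 1"
      using assms x0 by (simp add: metric_inner_warped x\<nu> \<nu>\<nu> power2_eq_square)
    moreover have "metric_inner (warped_metric h) x \<nu> v = 0"
      if g: "\<gamma> 0 = x" "\<forall>t. \<gamma> t \<in> frontier (cball 0 R)"
        "(\<gamma> has_vector_derivative v) (at (0::real))" for \<gamma> v
    proof -
      have "\<gamma> t \<bullet> \<gamma> t = R\<^sup>2" for t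
        using g(2) by (auto simp: frontier_cball dot_square_norm)
      then have "((\<lambda>t. \<gamma> t \<bullet> \<gamma> t) has_vector_derivative 0) (at 0)"
        by simp
      moreover have "((\<lambda>t. \<gamma> t \<bullet> \<gamma> t) has_vector_derivative (\<gamma> 0 \<bullet> v + v \<bullet> \<gamma> 0)) (at 0)"
        using g(3) by (auto simp: has_vector_derivative_def intro!: derivative_eq_intros
            simp: algebra_simps)
      ultimately have "\<gamma> 0 \<bullet> v + v \<bullet> \<gamma> 0 = 0"
        using vector_derivative_unique_at by blast
      then have "x \<bullet> v = 0" using g(1) by (simp add: inner_commute)
      then show ?thesis using x0 by (simp add: metric_inner_warped \<nu>)
    qed
    moreover have "\<forall>\<^sub>F t in at_right 0. x + t *\<^sub>R \<nu> \<notin> cball 0 R"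
    proof -
      have "x + t *\<^sub>R \<nu> \<notin> cball 0 R" if "t > 0" for t
      proof -
        have "x + t *\<^sub>R \<nu> = (1 + t / R) *\<^sub>R x"
          by (simp add: \<nu> algebra_simps divide_inverse)
        moreover have "norm ((1 + t / R) *\<^sub>R x) = R + t"
          using assms that by (simp add: field_simps)
        ultimately show ?thesis using that by simp
      qed
      then show ?thesis by (auto simp: eventually_at_filter)
    qed
    ultimately show "outward_unit_normal (warped_metric h) (cball 0 R) x \<nu>"
      unfolding outward_unit_normal_def by blast
  }
  assume N: "outward_unit_normal (warped_metric h) (cball 0 R) x \<nu>"
  define c where "c = (x \<bullet> \<nu>) / R\<^sup>2"
  define w where "w = \<nu> - c *\<^sub>R x"
  have xw: "x \<bullet> w = 0" using assms by (simp add: w_def c_def inner_simps xx)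
  have "w = 0"
  proof (rule ccontr)
    assume w0: "w \<noteq> 0"
    define v where "v = (R / norm w) *\<^sub>R w"
    have xv: "x \<bullet> v = 0" by (simp add: v_def xw)
    have vv: "v \<bullet> v = R\<^sup>2"
      using w0 by (simp add: v_def dot_square_norm power2_eq_square)
    define \<gamma> where "\<gamma> t = cos t *\<^sub>R x + sin t *\<^sub>R v" for t
    have "(norm (\<gamma> t))\<^sup>2 = R\<^sup>2" for t
    proof -
      have "(norm (\<gamma> t))\<^sup>2 = (cos t)\<^sup>2 * R\<^sup>2 + (sin t)\<^sup>2 * R\<^sup>2"
        unfolding dot_square_norm[symmetric]
        by (simp add: \<gamma>_def inner_simps xv xx vv inner_commute[of v x] power2_eq_square algebra_simps)
      then show ?thesis by (simp flip: distrib_right)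
    qed
    then have "norm (\<gamma> t) = R" for t
      using assms by (metis norm_ge_zero less_imp_le power2_eq_iff_nonneg)
    then have "\<forall>t. \<gamma> t \<in> frontier (cball 0 R)"
      by (simp add: frontier_cball)
    moreover have "\<gamma> 0 = x" by (simp add: \<gamma>_def)
    moreover have "(\<gamma> has_vector_derivative v) (at 0)"
      unfolding \<gamma>_def has_vector_derivative_def
      by (auto intro!: derivative_eq_intros)
    ultimately have "metric_inner (warped_metric h) x \<nu> v = 0"
      using N unfolding outward_unit_normal_def by blast
    then have "\<nu> \<bullet> v = 0"
      using x0 assms by (simp add: metric_inner_warped xv)
    moreover have "\<nu> = c *\<^sub>R x + w" by (simp add: w_def)
    ultimately have "w \<bullet> v = 0" by (simp add: inner_simps xv)
    then show False using w0 assms by (simp add: v_def)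
  qed
  then have \<nu>: "\<nu> = c *\<^sub>R x" by (simp add: w_def)
  have "metric_inner (warped_metric h) x \<nu> \<nu> = 1"
    using N unfolding outward_unit_normal_def by blast
  then have "(c * R)\<^sup>2 = 1"
    using assms x0 by (simp add: metric_inner_warped \<nu> xx power2_eq_square algebra_simps)
  then have "c * R = 1 \<or> c * R = -1" by (simp add: power2_eq_1_iff)
  moreover have "c * R \<noteq> -1"
  proof
    assume "c * R = -1"
    then have c: "c = - 1 / R" using assms by (simp add: field_simps)
    from N have "\<forall>\<^sub>F t in at_right 0. x + t *\<^sub>R \<nu> \<notin> cball 0 R"
      unfolding outward_unit_normal_def by blast
    then obtain d where d: "d > 0" "\<And>t. 0 < t \<Longrightarrow> t < d \<Longrightarrow> x + t *\<^sub>R \<nu> \<notin> cball 0 R"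
      unfolding eventually_at_right_field by auto
    define t where "t = min (d / 2) R"
    have t: "0 < t" "t < d" "t \<le> R" using d assms by (auto simp: t_def)
    have "x + t *\<^sub>R \<nu> = (1 - t / R) *\<^sub>R x"
      by (simp add: \<nu> c algebra_simps)
    moreover have "norm ((1 - t / R) *\<^sub>R x) = R - t"
      using assms t by (simp add: field_simps)
    ultimately show False using d(2)[OF t(1,2)] t by simp
  qed
  ultimately have "c = 1 / R" using assms by (simp add: field_simps)
  then show "\<nu> = x /\<^sub>R R" using \<nu> by (simp add: divide_inverse)
qed

end

theory Submission
  imports Defs
begin

text \<open>Separation of variables: \<open>a(r) Y(\<omega>)\<close>, with \<open>Y\<close> a spherical harmonic of degree \<open>k\<close>, is harmonic
  iff \<open>h\<^sup>2 a'' + (n - 1) h h' a' = k (k + n - 2) a\<close>, and then it is a Steklov eigenfunction with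
  eigenvalue \<open>a'(R) / a(R)\<close>. The solution regular at the centre is
  \<open>a = h\<^sup>k \<Phi>((1 - h') / 2)\<close> with \<open>\<Phi>\<close> a hypergeometric function. Euler's integral for \<open>\<Phi>\<close>
  converges on the whole range of \<open>r\<close> in both geometries and gives smoothness at the centre.

  There are no other eigenvalues: for a harmonic \<open>u\<close> the averages \<open>B(r)\<close> of \<open>u(r \<omega>) (\<omega> \<bullet> \<xi>)\<^sup>k\<close>
  over the sphere satisfy the same equation, up to an average with \<open>k - 2\<close> in place of \<open>k\<close> that
  vanishes by induction. The Wronskian of \<open>B\<close> and \<open>a\<close> vanishes at the centre, hence everywhere.
  If the eigenvalue of \<open>u\<close> is not \<open>a'(R) / a(R)\<close>, this forces \<open>B = 0\<close>. If it happens for all \<open>k\<close>,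
  then \<open>u(r \<omega>)\<close> is orthogonal to all \<open>exp (\<omega> \<bullet> \<xi>)\<close>, and \<open>u = 0\<close> by the Stone-Weierstrass theorem.

  The eigenvalues increase with \<open>k\<close> by comparison of Wronskians. For fixed \<open>k\<close> the scaled eigenvalue
  \<open>y = h a' / a\<close> solves the Riccati equation \<open>h y' = k (k + n - 2) - (n - 2) h' y - y\<^sup>2\<close>.
  Differentiating its right-hand side shows that \<open>y'\<close> has the sign of the curvature.\<close>

subsection \<open>Euler's hypergeometric integral\<close>

text \<open>At the centre the radial equation has the exponents k and 2 - n - k; splitting off h^k
  selects the regular one. In the variable z = (1 - h') / 2 one has h' = 1 - 2 z and \<kappa> h^2 =
  4 z (1 - z), so \<kappa> drops out and both geometries share one hypergeometric function, with
  parameters k + n - 1, k and k + n/2. On the sphere z = sin(r/2)^2 approaches 1; in hyperbolic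
  space z = - sinh(r/2)^2 is unbounded. The power series in z would fail for z <= -1, whereas the
  kernel 1 - z t stays positive on [0,1] for every z < 1. Powers of linear forms replace a basis of
  spherical harmonics: the spherical Laplacian sends (\<omega> . \<xi>)^k to - k (k + n - 2) times
  itself plus k (k - 1) |\<xi>|^2 (\<omega> . \<xi>)^(k-2), which is the source of the k - 2 term.
  It is a sum of squares of rotation fields, so its symmetry follows once rotation fields integrate
  to zero over the sphere. Wronskians carry the weight h^(n-1), which vanishes at the centre and is
  positive elsewhere, so no asymptotics at r = 0 are required.\<close>

text \<open>Up to a Beta factor, the hypergeometric function \<open>F(m, p + 1; p + q / 2 + 2; z)\<close>.\<close>

definition euler_integral :: "nat \<Rightarrow> nat \<Rightarrow> nat \<Rightarrow> real \<Rightarrow> real"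
  where "euler_integral p q m z = integral {0..1} (\<lambda>t. t ^ p * sqrt (1 - t) ^ q / (1 - z * t) ^ m)"

lemma euler_kernel_pos:
  assumes "z < 1" "0 \<le> t" "t \<le> 1"
  shows "1 - z * t > (0::real)"
proof (cases "z \<le> 0")
  case True
  then have "z * t \<le> 0" using assms by (simp add: mult_nonpos_nonneg)
  then show ?thesis by linarith
next
  case False
  then have "z * t \<le> z * 1" using assms by (intro mult_left_mono) auto
  then show ?thesis using assms by linarith
qed

lemma euler_integral_integrable:
  assumes "z < 1"
  shows "(\<lambda>t. t ^ p * sqrt (1 - t) ^ q / (1 - z * t) ^ m) integrable_on {0..1::real}"
  using euler_kernel_pos[OF assms]
  by (intro integrable_continuous_real continuous_intros) (metis atLeastAtMost_iff less_irrefl power_not_zero)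

text \<open>Differentiation under the integral sign raises \<open>p\<close> and \<open>m\<close> by
  one and keeps \<open>q\<close>, so all derivatives of the profile are again Euler
  integrals.\<close>

lemma euler_integral_deriv:
  assumes "z < 1"
  shows "(euler_integral p q m has_real_derivative real m * euler_integral (Suc p) q (Suc m) z) (at z)"
proof -
  let ?f = "\<lambda>z t. t ^ p * sqrt (1 - t) ^ q / (1 - z * t) ^ m :: real"
  let ?g = "\<lambda>z t. real m * (t ^ Suc p * sqrt (1 - t) ^ q / (1 - z * t) ^ Suc m) :: real"
  have nz: "1 - z * t \<noteq> 0" if "z < 1" "t \<in> cbox 0 1" for z t :: real
    using euler_kernel_pos[of z t] that by auto
  have "((\<lambda>z. integral (cbox 0 1) (?f z)) has_real_derivative integral (cbox 0 1) (?g z)) (at z within {..<1})"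
  proof (rule leibniz_rule_field_derivative)
    fix z t :: real assume zt: "z \<in> {..<1}" "t \<in> cbox 0 1"
    note n0 = nz[of z t] 
    have d: "((\<lambda>z. ?f z t) has_real_derivative
        - (t ^ p * sqrt (1 - t) ^ q * (real m * (1 - z * t) ^ (m - 1) * - t)) / ((1 - z * t) ^ m * (1 - z * t) ^ m)) (at z)"
      using n0 zt by (auto intro!: derivative_eq_intros)
    \<comment> \<open>The case \<open>m = 0\<close> is split off because the power rule produces the
      truncated exponent \<open>m - 1\<close>.\<close>
    have "- (A * (real m * w ^ (m - 1) * - t)) / (w ^ m * w ^ m) = real m * (t * A / w ^ Suc m)"
      if "w \<noteq> 0" for A w :: real
      using that by (cases m) (simp_all add: field_simps)
    from this[of "1 - z * t" "t ^ p * sqrt (1 - t) ^ q"]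
    have "- (t ^ p * sqrt (1 - t) ^ q * (real m * (1 - z * t) ^ (m - 1) * - t)) / ((1 - z * t) ^ m * (1 - z * t) ^ m) = ?g z t"
      using n0 zt by (simp add: mult_ac)
    with d show "((\<lambda>z. ?f z t) has_real_derivative ?g z t) (at z within {..<1})"
      by (metis has_field_derivative_at_within)
  next
    fix z :: real assume "z \<in> {..<1}"
    then show "?f z integrable_on cbox 0 1"
      using euler_integral_integrable[of z p q m] by simp
  next
    show "continuous_on ({..<1} \<times> cbox 0 1) (\<lambda>(z, t). ?g z t)"
      unfolding split_def using nz by (intro continuous_intros) (auto simp del: box_real)
  qed (use assms in auto)
  moreover have "at z within {..<1} = at z"
    using assms by (intro at_within_open) auto
  moreover have "integral (cbox 0 1) (?g z) = real m * euler_integral (Suc p) q (Suc m) z"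
    unfolding euler_integral_def box_real by (rule integral_mult_right)
  ultimately show ?thesis
    by (simp add: euler_integral_def[abs_def])
qed

lemma euler_integral_pos:
  assumes "z < 1"
  shows "euler_integral p q m z > 0"
proof -
  let ?f = "\<lambda>t. t ^ p * sqrt (1 - t) ^ q / (1 - z * t) ^ m :: real"
  have nn: "?f t \<ge> 0" if "t \<in> {0..1}" for t
    using euler_kernel_pos[OF assms, of t] that by auto
  have cont: "continuous_on {0..1} ?f"
    using euler_kernel_pos[OF assms]
    by (intro continuous_intros) (metis atLeastAtMost_iff less_irrefl power_not_zero)
  have "integral (cbox 0 1) ?f \<ge> 0"
    using nn by (intro integral_nonneg) (use euler_integral_integrable[OF assms] in auto)
  moreover have "integral (cbox 0 1) ?f \<noteq> 0"
  proof
    assume "integral (cbox 0 1) ?f = 0"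
    then have "\<forall>x\<in>cbox 0 1. ?f x = 0"
      using integral_cbox_eq_0_iff[of 0 1 ?f] cont nn by auto
    then have "?f (1/2) = 0" by (rule bspec) auto
    moreover have "?f (1/2) > 0"
      using euler_kernel_pos[OF assms, of "1/2"] by (intro divide_pos_pos mult_pos_pos zero_less_power) auto
    ultimately show False by (metis less_irrefl)
  qed
  ultimately show ?thesis by (simp add: euler_integral_def)
qed

text \<open>The combination of the three integrands is the exact derivative of a function vanishing at both
  end points.\<close>
lemma euler_integral_hypergeometric:
  fixes p q m :: nat and z :: real
  assumes "z < 1"
  defines "b \<equiv> real p + 1" and "d \<equiv> real q / 2 + 1" and "a \<equiv> real m"
  shows "z * (1 - z) * (a + 1) * euler_integral (p + 2) q (m + 2) z
      + (b + d - (a + b + 1) * z) * euler_integral (p + 1) q (m + 1) z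
      - b * euler_integral p q m z = 0"
proof -
  \<comment> \<open>The power \<open>q + 2\<close> of the root is (1 - t)^(q/2 + 1):
    \<open>?F\<close> is the Euler integrand times t (1 - t) / (1 - z t), hence zero at 0 and
    1.\<close>
  let ?F = "\<lambda>t. t ^ (p + 1) * sqrt (1 - t) ^ (q + 2) / (1 - z * t) ^ (m + 1) :: real"
  let ?f = "\<lambda>p m t. t ^ p * sqrt (1 - t) ^ q / (1 - z * t) ^ m :: real"
  let ?g = "\<lambda>t. z * (1 - z) * (a + 1) * ?f (p+2) (m+2) t + (b + d - (a + b + 1) * z) * ?f (p+1) (m+1) t - b * ?f p m t"
  have "((\<lambda>t. - ?g t) has_integral ?F 1 - ?F 0) {0..1}"
  \<comment> \<open>The square root is not differentiable at t = 1, so only continuity is claimed at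
    the end points.\<close>
  proof (rule fundamental_theorem_of_calculus_interior)
    show "continuous_on {0..1} ?F"
      using euler_kernel_pos[OF assms(1)]
      by (intro continuous_intros) (metis atLeastAtMost_iff less_irrefl power_not_zero)
  next
    fix t :: real assume t: "t \<in> {0<..<1}"
    define s where "s = sqrt (1 - t)"
    define w where "w = 1 - z * t"
    have s: "s > 0" "s * s = 1 - t" using t by (auto simp: s_def)
    have w: "w > 0" using euler_kernel_pos[OF assms(1), of t] t by (auto simp: w_def)
    have ds: "((\<lambda>t. sqrt (1 - t)) has_real_derivative - (inverse s / 2)) (at t)"
      using t by (auto intro!: derivative_eq_intros simp: s_def)
    have dw: "((\<lambda>t. 1 - z * t) has_real_derivative - z) (at t)"
      by (auto intro!: derivative_eq_intros)
    have dn: "((\<lambda>t. t ^ (p + 1) * sqrt (1 - t) ^ (q + 2)) has_real_derivative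
        (real p + 1) * t ^ p * s ^ (q + 2) + t ^ (p + 1) * (real (q + 2) * s ^ (q + 1) * (- (inverse s / 2)))) (at t)"
      by (rule DERIV_cong[OF DERIV_mult[OF DERIV_pow DERIV_power[OF ds]]]) (simp add: s_def mult_ac)
    have dd: "((\<lambda>t. (1 - z * t) ^ (m + 1)) has_real_derivative (real m + 1) * w ^ m * (- z)) (at t)"
      by (rule DERIV_cong[OF DERIV_power[OF dw]]) (simp add: w_def mult_ac)
    have "(?F has_real_derivative
        (((real p + 1) * t ^ p * s ^ (q + 2) + t ^ (p + 1) * (real (q + 2) * s ^ (q + 1) * (- (inverse s / 2)))) * w ^ (m + 1)
          - t ^ (p + 1) * s ^ (q + 2) * ((real m + 1) * w ^ m * (- z))) / (w ^ (m + 1) * w ^ (m + 1))) (at t)"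
      by (rule DERIV_cong[OF DERIV_divide[OF dn dd]]) (use w in \<open>auto simp: s_def w_def\<close>)
    also have "(((real p + 1) * t ^ p * s ^ (q + 2) + t ^ (p + 1) * (real (q + 2) * s ^ (q + 1) * (- (inverse s / 2)))) * w ^ (m + 1)
          - t ^ (p + 1) * s ^ (q + 2) * ((real m + 1) * w ^ m * (- z))) / (w ^ (m + 1) * w ^ (m + 1))
        = t ^ p * s ^ q / w ^ (m + 2) * ((b * (s * s) - d * t) * w + (a + 1) * z * t * (s * s))"
      using s(1) w by (simp add: divide_simps b_def d_def a_def) (simp add: algebra_simps)?
    also have "(b * (s * s) - d * t) * w + (a + 1) * z * t * (s * s) =
        - (z * (1 - z) * (a + 1) * t^2 + (b + d - (a + b + 1) * z) * t * w - b * w^2)"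
      unfolding s(2) w_def by (simp add: algebra_simps power2_eq_square)
    also have "t ^ p * s ^ q / w ^ (m + 2) * \<dots> = - ?g t"
      unfolding s_def[symmetric] w_def[symmetric] using w by (simp add: field_simps power2_eq_square)
    finally show "(?F has_vector_derivative - ?g t) (at t)"
      by (simp add: has_real_derivative_iff_has_vector_derivative)
  qed simp
  then have "((\<lambda>t. - ?g t) has_integral 0) {0..1}" by simp
  from has_integral_neg[OF this] have 0: "(?g has_integral 0) {0..1}" by simp
  have "(?f p m has_integral euler_integral p q m z) {0..1}" for p m
    unfolding euler_integral_def using euler_integral_integrable[OF assms(1)]
    by (rule integrable_integral)
  then have "(?g has_integral z * (1 - z) * (a + 1) * euler_integral (p + 2) q (m + 2) z
      + (b + d - (a + b + 1) * z) * euler_integral (p + 1) q (m + 1) z - b * euler_integral p q m z) {0..1}"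
    by (intro has_integral_diff has_integral_add has_integral_mult_right)
  from has_integral_unique[OF this 0] show ?thesis .
qed

subsection \<open>The radial equation\<close>

text \<open>Here \<open>c\<close> is \<open>h'\<close> and \<open>\<kappa>\<close> is the curvature.\<close>

locale warping =
  fixes h c :: "real \<Rightarrow> real" and \<kappa> L :: real and n :: nat
  assumes h_deriv: "(h has_real_derivative c r) (at r)"
    and c_deriv: "(c has_real_derivative - \<kappa> * h r) (at r)"
    and h_0: "h 0 = 0" and c_0: "c 0 = 1"
    and h_pos: "0 < r \<Longrightarrow> r < L \<Longrightarrow> h r > 0"
    and c_gt: "0 \<le> r \<Longrightarrow> r < L \<Longrightarrow> c r > -1"
    and n3: "n \<ge> 3"
begin

text \<open>The eigenvalue of minus the Laplacian of the unit (n-1)-sphere on spherical harmonics of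
  degree k.\<close>

definition lam :: "nat \<Rightarrow> real"
  where "lam k = real k * (real k + real n - 2)"

text \<open>For \<open>k = 0\<close> Euler's integral diverges; the regular solution is constant.\<close>

definition profile :: "nat \<Rightarrow> real \<Rightarrow> real"
  where "profile k z = (if k = 0 then 1 else euler_integral (k - 1) (n - 2) (k + n - 1) z)"

definition profile1 :: "nat \<Rightarrow> real \<Rightarrow> real"
  where "profile1 k z = (if k = 0 then 0 else real (k + n - 1) * euler_integral k (n - 2) (k + n) z)"

definition profile2 :: "nat \<Rightarrow> real \<Rightarrow> real"
  where "profile2 k z = (if k = 0 then 0
    else real (k + n - 1) * (real (k + n) * euler_integral (k + 1) (n - 2) (k + n + 1) z))"

definition radial :: "nat \<Rightarrow> real \<Rightarrow> real"
  where "radial k r = h r ^ k * profile k ((1 - c r) / 2)"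

definition radial1 :: "nat \<Rightarrow> real \<Rightarrow> real"
  where "radial1 k r = real k * h r ^ (k - 1) * c r * profile k ((1 - c r) / 2)
    + \<kappa> / 2 * h r ^ (k + 1) * profile1 k ((1 - c r) / 2)"

text \<open>The truncated exponents are harmless: the power \<open>k - 2\<close> comes with the
  coefficient k (k - 1), which is 0 for k <= 1.\<close>

definition radial2 :: "nat \<Rightarrow> real \<Rightarrow> real"
  where "radial2 k r = (real k * (real (k - 1) * h r ^ (k - 2) * (c r)\<^sup>2 - \<kappa> * h r ^ k)) * profile k ((1 - c r) / 2)
    + \<kappa> * c r * h r ^ k * (real k + 1 / 2) * profile1 k ((1 - c r) / 2)
    + \<kappa>\<^sup>2 / 4 * h r ^ (k + 2) * profile2 k ((1 - c r) / 2)"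

text \<open>A first integral of the linear system h' = c, c' = - \<kappa> h, evaluated at 0.\<close>

lemma pythagoras: "(c r)\<^sup>2 + \<kappa> * (h r)\<^sup>2 = 1"
proof -
  have "((\<lambda>r. (c r)\<^sup>2 + \<kappa> * (h r)\<^sup>2) has_real_derivative 0) (at r)" for r
    by (auto intro!: derivative_eq_intros h_deriv c_deriv)
  then have "(c r)\<^sup>2 + \<kappa> * (h r)\<^sup>2 = (c 0)\<^sup>2 + \<kappa> * (h 0)\<^sup>2"
    by (intro DERIV_const_ratio_const[of r 0] DERIV_isconst_all[of _ r 0]) blast
  then show ?thesis by (simp add: h_0 c_0)
qed

lemma profile_deriv:
  assumes "z < 1"
  shows "(profile k has_real_derivative profile1 k z) (at z)"
    and "(profile1 k has_real_derivative profile2 k z) (at z)"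
proof -
  show "(profile k has_real_derivative profile1 k z) (at z)"
  proof (cases k)
    case (Suc j)
    then show ?thesis
      using euler_integral_deriv[OF assms, of j "n - 2" "j + n"]
      by (simp add: profile_def[abs_def] profile1_def)
  qed (simp add: profile_def[abs_def] profile1_def)
  show "(profile1 k has_real_derivative profile2 k z) (at z)"
  proof (cases "k = 0")
    case False
    then show ?thesis
      using DERIV_cmult[OF euler_integral_deriv[OF assms, of k "n - 2" "k + n"], of "real (k + n - 1)"]
      by (simp add: profile1_def[abs_def] profile2_def)
  qed (simp add: profile1_def[abs_def] profile2_def)
qed

lemma profile_pos: "z < 1 \<Longrightarrow> profile k z > 0"
  by (simp add: profile_def euler_integral_pos)

text \<open>The hypergeometric equation with parameters k + n - 1, k and k + n/2. The first two plus
  1 make twice the third, so the first-order coefficient is a multiple of 1 - 2 z, which becomes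
  h'.\<close>

lemma profile_ode:
  assumes "z < 1"
  shows "z * (1 - z) * profile2 k z + (real k + real n / 2) * (1 - 2 * z) * profile1 k z
    = real k * (real k + real n - 1) * profile k z"
proof (cases k)
  case (Suc j)
  obtain i where i: "n = i + 3" using n3 by (metis le_add_diff_inverse2)
  define X0 X1 X2 where "X0 = euler_integral j (i + 1) (j + i + 3) z"
    and "X1 = euler_integral (j + 1) (i + 1) (j + i + 4) z"
    and "X2 = euler_integral (j + 2) (i + 1) (j + i + 5) z"
  define A where "A = real j + real i + 3"
  have P: "profile k z = X0" "profile1 k z = A * X1" "profile2 k z = A * ((A + 1) * X2)"
    unfolding profile_def profile1_def profile2_def
    by (simp_all add: Suc i X0_def X1_def X2_def A_def add_ac)
  have "z * (1 - z) * (A + 1) * X2 + (real j + 1 + (real (i + 1) / 2 + 1) - (A + (real j + 1) + 1) * z) * X1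
      - (real j + 1) * X0 = 0"
    using euler_integral_hypergeometric[OF assms, where p = j and q = "i + 1" and m = "j + i + 3"]
    by (simp add: X0_def X1_def X2_def A_def add_ac)
  \<comment> \<open>The integral identity is the differential equation divided by \<open>A\<close>,
    the factor that the first differentiation brings out.\<close>
  then have "A * (z * (1 - z) * (A + 1) * X2 + (real j + 1 + (real (i + 1) / 2 + 1) - (A + (real j + 1) + 1) * z) * X1)
      = A * ((real j + 1) * X0)" by simp
  then show ?thesis
    unfolding P by (simp add: Suc i A_def field_simps)
qed (simp add: profile_def profile1_def profile2_def)

text \<open>The argument is sin(r/2)^2 on the sphere and - sinh(r/2)^2 in hyperbolic space; below 1
  the Euler kernel has no pole.\<close>

lemma half_less_1: "0 \<le> r \<Longrightarrow> r < L \<Longrightarrow> (1 - c r) / 2 < 1"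
  using c_gt[of r] by simp

lemma radial_deriv:
  assumes "0 \<le> r" "r < L"
  shows "(radial k has_real_derivative radial1 k r) (at r)"
    and "(radial1 k has_real_derivative radial2 k r) (at r)"
proof -
  have z: "((\<lambda>r. (1 - c r) / 2) has_real_derivative \<kappa> * h r / 2) (at r)"
    by (auto intro!: derivative_eq_intros c_deriv)
  note d = DERIV_chain2[OF profile_deriv(1)[OF half_less_1[OF assms]] z]
    DERIV_chain2[OF profile_deriv(2)[OF half_less_1[OF assms]] z]
  show "(radial k has_real_derivative radial1 k r) (at r)"
    unfolding radial_def[abs_def]
    by (rule DERIV_cong[OF DERIV_mult[OF DERIV_power[OF h_deriv] d(1)]])
      (simp add: radial1_def field_simps)
  have p: "((\<lambda>r. real k * h r ^ (k - 1)) has_real_derivative real k * (real (k - 1) * h r ^ (k - 2) * c r)) (at r)"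
    by (rule DERIV_cong[OF DERIV_cmult[OF DERIV_power[OF h_deriv]]]) (simp add: mult_ac numeral_2_eq_2)
  have q: "((\<lambda>r. \<kappa> / 2 * h r ^ (k + 1)) has_real_derivative \<kappa> / 2 * (real k + 1) * h r ^ k * c r) (at r)"
    by (rule DERIV_cong[OF DERIV_cmult[OF DERIV_power[OF h_deriv]]]) (simp add: mult_ac)
  have k: "real k * h r ^ (k - 1) * h r = real k * h r ^ k" by (cases k) auto
  show "(radial1 k has_real_derivative radial2 k r) (at r)"
    unfolding radial1_def[abs_def]
  proof (rule DERIV_cong[OF DERIV_add[OF DERIV_mult[OF DERIV_mult[OF p c_deriv] d(1)] DERIV_mult[OF q d(2)]]])
    define P P1 P2 where "P = profile k ((1 - c r) / 2)" and "P1 = profile1 k ((1 - c r) / 2)"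
      and "P2 = profile2 k ((1 - c r) / 2)"
    define H where "H = real k * h r ^ (k - 1)"
    have "(real k * (real (k - 1) * h r ^ (k - 2) * c r) * c r + - \<kappa> * h r * H) * P +
      P1 * (\<kappa> * h r / 2) * (H * c r) +
      (\<kappa> / 2 * (real k + 1) * h r ^ k * c r * P1 + P2 * (\<kappa> * h r / 2) * (\<kappa> / 2 * h r ^ (k + 1)))
      = (real k * (real (k - 1) * h r ^ (k - 2) * (c r)\<^sup>2)  - \<kappa> * (H * h r)) * P
      + \<kappa> / 2 * c r * P1 * (H * h r + (real k + 1) * h r ^ k) + \<kappa>\<^sup>2 / 4 * h r ^ (k + 2) * P2"
      by (simp add: algebra_simps power2_eq_square)
    also have "H * h r = real k * h r ^ k" using k by (simp add: H_def)
    finally show "(real k * (real (k - 1) * h r ^ (k - 2) * c r) * c r + - \<kappa> * h r * (real k * h r ^ (k - 1))) * profile k ((1 - c r) / 2) +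
      profile1 k ((1 - c r) / 2) * (\<kappa> * h r / 2) * (real k * h r ^ (k - 1) * c r) +
      (\<kappa> / 2 * (real k + 1) * h r ^ k * c r * profile1 k ((1 - c r) / 2) +
       profile2 k ((1 - c r) / 2) * (\<kappa> * h r / 2) * (\<kappa> / 2 * h r ^ (k + 1))) = radial2 k r"
      unfolding radial2_def P_def[symmetric] P1_def[symmetric] P2_def[symmetric] H_def[symmetric]
      by (simp add: algebra_simps)
  qed
qed

text \<open>The factor h^k alone leaves the error - k (k + n - 1) \<kappa> h^2 a, because c^2 = 1 -
  \<kappa> h^2. With z (1 - z) = \<kappa> h^2 / 4 and 1 - 2 z = c, the hypergeometric equation
  cancels exactly this.\<close>

lemma radial_ode:
  assumes "0 \<le> r" "r < L"
  shows "(h r)\<^sup>2 * radial2 k r + (real n - 1) * h r * c r * radial1 k r = lam k * radial k r"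
proof -
  define P P1 P2 where "P = profile k ((1 - c r) / 2)" and "P1 = profile1 k ((1 - c r) / 2)"
    and "P2 = profile2 k ((1 - c r) / 2)"
  define H where "H = h r ^ k"
  have k1: "real k * h r ^ (k - 1) * h r = real k * H" by (cases k) (auto simp: H_def)
  have k2: "real k * (real (k - 1) * h r ^ (k - 2) * (h r)\<^sup>2) = real k * (real k - 1) * H"
  proof (cases "k \<ge> 2")
    case True
    then have "k = (k - 2) + 2" by simp
    then have "h r ^ (k - 2) * (h r)\<^sup>2 = H" unfolding H_def by (metis power_add)
    then show ?thesis using True by (simp add: of_nat_diff mult.assoc)
  next
    case False
    then have "k = 0 \<or> k = 1" by linarith
    then show ?thesis by auto
  qed
  have c2: "(c r)\<^sup>2 = 1 - \<kappa> * (h r)\<^sup>2" using pythagoras[of r] by simp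
  have "(1 - c r) / 2 * (1 - (1 - c r) / 2) = \<kappa> * (h r)\<^sup>2 / 4" "1 - 2 * ((1 - c r) / 2) = c r"
    using c2 by (simp_all add: field_simps power2_eq_square)
  note z = this
  have ode: "\<kappa> * (h r)\<^sup>2 / 4 * P2 + (real k + real n / 2) * c r * P1 = real k * (real k + real n - 1) * P"
    using profile_ode[OF half_less_1[OF assms], of k]
    unfolding P_def[symmetric] P1_def[symmetric] P2_def[symmetric] z .
  have "(h r)\<^sup>2 * radial2 k r + (real n - 1) * h r * c r * radial1 k r =
    (real k * (real (k - 1) * h r ^ (k - 2) * (h r)\<^sup>2) * (c r)\<^sup>2 - real k * \<kappa> * (h r)\<^sup>2 * H) * P
    + \<kappa> * c r * H * (h r)\<^sup>2 * (real k + 1 / 2) * P1 + \<kappa>\<^sup>2 / 4 * H * (h r)\<^sup>2 * (h r)\<^sup>2 * P2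
    + (real n - 1) * (c r)\<^sup>2 * (real k * h r ^ (k - 1) * h r) * P
    + (real n - 1) * c r * \<kappa> / 2 * H * (h r)\<^sup>2 * P1"
    unfolding radial1_def radial2_def P_def[symmetric] P1_def[symmetric] P2_def[symmetric]
    by (simp add: H_def algebra_simps power2_eq_square)
  also have "\<dots> = (real k * (real k - 1) * H * (c r)\<^sup>2 - real k * \<kappa> * (h r)\<^sup>2 * H) * P
    + (real n - 1) * (c r)\<^sup>2 * (real k * H) * P
    + \<kappa> * (h r)\<^sup>2 * H * (\<kappa> * (h r)\<^sup>2 / 4 * P2 + (real k + real n / 2) * c r * P1)"
    unfolding k1 k2 by (simp add: field_simps power2_eq_square)
  also have "\<dots> = lam k * (H * P)"
    unfolding ode c2 lam_def by (simp add: algebra_simps power2_eq_square)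
  finally show ?thesis by (simp add: radial_def P_def H_def)
qed

lemma radial_pos: "0 < r \<Longrightarrow> r < L \<Longrightarrow> radial k r > 0"
  unfolding radial_def using h_pos[of r] profile_pos[OF half_less_1, of r k]
  by (intro mult_pos_pos zero_less_power) auto

lemma radial_0: "radial 0 r = 1" "radial1 0 r = 0"
  by (simp_all add: radial_def radial1_def profile_def profile1_def)

lemma lam_mono: "j < k \<Longrightarrow> lam j < lam k"
  unfolding lam_def using n3 by (intro mult_strict_mono') auto

section \<open>Comparison of Wronskians and monotonicity in the degree\<close>

lemma continuous_h: "continuous_on A h" and continuous_c: "continuous_on A c"
  using h_deriv c_deriv by (meson DERIV_isCont continuous_at_imp_continuous_on)+

lemma continuous_radial:
  assumes "R < L"
  shows "continuous_on {0..R} (radial k)" "continuous_on {0..R} (radial1 k)"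
  using assms
  by (auto intro!: continuous_at_imp_continuous_on DERIV_isCont[OF radial_deriv(1)] DERIV_isCont[OF radial_deriv(2)])

text \<open>The sign arguments below all start at the centre, where the weighted quantities vanish
  but their derivative has no sign yet; so a positive derivative is asked for on the open interval
  only.\<close>

lemma pos_if_deriv_pos:
  fixes f f' :: "real \<Rightarrow> real"
  assumes "0 < r" "continuous_on {0..r} f" "f 0 = 0"
    and "\<And>x. 0 < x \<Longrightarrow> x < r \<Longrightarrow> (f has_real_derivative f' x) (at x)"
    and "\<And>x. 0 < x \<Longrightarrow> x < r \<Longrightarrow> f' x > 0"
  shows "f r > 0"
  using DERIV_pos_imp_increasing_open[of 0 r f] assms by (metis less_eq_real_def)

text \<open>Lagrange's identity for the self-adjoint form (h^(n-1) a')' = \<open>lam k\<close>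
  h^(n-3) a of the radial equation. \<open>f\<close> stands for another radial solution or for a
  spherical average; if \<mu> = \<open>lam k\<close>, the weighted Wronskian is constant.\<close>

lemma wronskian_deriv:
  assumes r: "0 < r" "r < L"
    and f: "(f has_real_derivative f1 r) (at r)" "(f1 has_real_derivative f2) (at r)"
    and ode: "(h r)\<^sup>2 * f2 + (real n - 1) * h r * c r * f1 r = \<mu> * f r"
  shows "((\<lambda>r. h r ^ (n - 1) * (f1 r * radial k r - f r * radial1 k r)) has_real_derivative
    (\<mu> - lam k) * h r ^ (n - 3) * f r * radial k r) (at r)"
proof -
  obtain i where "n = i + 3" using n3 by (metis le_add_diff_inverse2)
  then have i: "n - 1 = i + 2" "n - 3 = i" "real n = real i + 3" by simp_all
  note d = radial_deriv[OF less_imp_le[OF r(1)] r(2), of k]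
  have "((\<lambda>r. h r ^ (n - 1) * (f1 r * radial k r - f r * radial1 k r)) has_real_derivative
    (real i + 2) * h r ^ (i + 1) * c r * (f1 r * radial k r - f r * radial1 k r) +
    h r ^ (i + 2) * (f2 * radial k r - f r * radial2 k r)) (at r)"
    unfolding i
    by (rule DERIV_cong[OF DERIV_mult[OF DERIV_power[OF h_deriv] DERIV_diff[OF DERIV_mult[OF f(2) d(1)] DERIV_mult[OF f(1) d(2)]]]])
      (simp add: algebra_simps)
  also have "(real i + 2) * h r ^ (i + 1) * c r * (f1 r * radial k r - f r * radial1 k r) +
    h r ^ (i + 2) * (f2 * radial k r - f r * radial2 k r)
    = h r ^ i * (((h r)\<^sup>2 * f2 + (real n - 1) * h r * c r * f1 r) * radial k r
      - f r * ((h r)\<^sup>2 * radial2 k r + (real n - 1) * h r * c r * radial1 k r))"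
    by (simp add: i algebra_simps power2_eq_square)
  also have "\<dots> = (\<mu> - lam k) * h r ^ (n - 3) * f r * radial k r"
    unfolding ode radial_ode[OF less_imp_le[OF r(1)] r(2)] by (simp add: i algebra_simps)
  finally show ?thesis .
qed

text \<open>\<open>radial 0\<close> is the constant 1, so the weighted Wronskian with it is h^(n-1)
  times \<open>radial1 k\<close>.\<close>

lemma radial1_pos:
  assumes r: "0 < r" "r < L" and k: "k > 0"
  shows "radial1 k r > 0"
proof -
  let ?W = "\<lambda>r. h r ^ (n - 1) * (radial1 k r * radial 0 r - radial k r * radial1 0 r)"
  have "?W r > 0"
  proof (rule pos_if_deriv_pos[OF r(1)])
    show "continuous_on {0..r} ?W"
      using r by (intro continuous_intros continuous_h continuous_radial) auto
    show "?W 0 = 0" using n3 by (simp add: h_0)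
    fix x assume "0 < x" "x < r"
    then have x: "0 < x" "0 \<le> x" "x < L" using r by auto
    show "(?W has_real_derivative (lam k - lam 0) * h x ^ (n - 3) * radial k x * radial 0 x) (at x)"
      using x by (intro wronskian_deriv[OF _ _ radial_deriv radial_ode]) auto
    show "(lam k - lam 0) * h x ^ (n - 3) * radial k x * radial 0 x > 0"
      using lam_mono[OF k] x by (simp add: h_pos radial_pos)
  qed
  then show ?thesis
    using h_pos[OF r] by (simp add: radial_0 zero_less_mult_iff)
qed

definition steklov :: "nat \<Rightarrow> real \<Rightarrow> real"
  where "steklov k r = radial1 k r / radial k r"

lemma steklov_strict_mono:
  assumes r: "0 < r" "r < L" and jk: "j < k"
  shows "steklov j r < steklov k r"
proof -
  let ?W = "\<lambda>r. h r ^ (n - 1) * (radial1 k r * radial j r - radial k r * radial1 j r)"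
  have "?W r > 0"
  proof (rule pos_if_deriv_pos[OF r(1)])
    show "continuous_on {0..r} ?W"
      using r by (intro continuous_intros continuous_h continuous_radial) auto
    show "?W 0 = 0" using n3 by (simp add: h_0)
    fix x assume "0 < x" "x < r"
    then have x: "0 < x" "0 \<le> x" "x < L" using r by auto
    show "(?W has_real_derivative (lam k - lam j) * h x ^ (n - 3) * radial k x * radial j x) (at x)"
      using x by (intro wronskian_deriv[OF _ _ radial_deriv radial_ode]) auto
    show "(lam k - lam j) * h x ^ (n - 3) * radial k x * radial j x > 0"
      using lam_mono[OF jk] x by (simp add: h_pos radial_pos)
  qed
  then have "radial1 k r * radial j r - radial k r * radial1 j r > 0"
    using h_pos[OF r] by (simp add: zero_less_mult_iff)
  then show ?thesis
    using radial_pos[OF r] by (simp add: steklov_def divide_simps mult.commute)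
qed

text \<open>With \<open>y = h a' / a\<close> the equation becomes \<open>h y' = lam k - (n - 2) c y - y\<^sup>2\<close>. Multiplied by
  \<open>h\<^sup>n\<^sup>-\<^sup>2 a\<^sup>2\<close>, the right-hand side has derivative \<open>(n - 2) \<kappa> h\<^sup>n a a'\<close>, so it has the sign of \<open>\<kappa>\<close>.\<close>
definition riccati :: "nat \<Rightarrow> real \<Rightarrow> real"
  where "riccati k r = h r ^ (n - 2) * (lam k * (radial k r)\<^sup>2
    - (real n - 2) * c r * h r * radial k r * radial1 k r - (h r)\<^sup>2 * (radial1 k r)\<^sup>2)"

text \<open>The factor \<kappa> treats both geometries at once: the derivative becomes \<kappa>^2
  times a product of positive quantities, with \<open>radial1_pos\<close> for the factor a'.\<close>

lemma riccati_sign: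
  assumes r: "0 < r" "r < L" and k: "k > 0" and \<kappa>: "\<kappa> \<noteq> 0"
  shows "\<kappa> * riccati k r > 0"
proof (rule pos_if_deriv_pos[OF r(1)])
  show "continuous_on {0..r} (\<lambda>r. \<kappa> * riccati k r)"
    using r unfolding riccati_def by (intro continuous_intros continuous_h continuous_c continuous_radial) auto
  show "\<kappa> * riccati k 0 = 0" using n3 by (simp add: h_0 riccati_def)
  fix x assume "0 < x" "x < r"
  then have x: "0 < x" "0 \<le> x" "x < L" using r by auto
  obtain i where n: "n = i + 3" using n3 by (metis le_add_diff_inverse2)
  then have i: "n - 2 = i + 1" "real n = real i + 3" by simp_all
  note d = radial_deriv[OF x(2,3), of k]
  define a a1 a2 where "a = radial k x" and "a1 = radial1 k x" and "a2 = radial2 k x"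
  have ode: "h x * h x * a2 = lam k * a - (real i + 2) * h x * c x * a1"
    using radial_ode[OF x(2,3), of k] by (simp add: a_def a1_def a2_def i power2_eq_square algebra_simps)
  have "(riccati k has_real_derivative
    (real i + 1) * h x ^ i * c x * (lam k * a\<^sup>2 - (real i + 1) * c x * h x * a * a1 - (h x)\<^sup>2 * a1\<^sup>2)
    + h x ^ (i + 1) * (2 * lam k * a * a1 + (real i + 1) * \<kappa> * h x * h x * a * a1
       - (real i + 1) * c x * (c x * a * a1 + h x * a1 * a1 + h x * a * a2)
       - 2 * h x * c x * a1\<^sup>2 - 2 * (h x)\<^sup>2 * a1 * a2)) (at x)"
    unfolding riccati_def[abs_def] i a_def a1_def a2_def power2_eq_square
    by (rule DERIV_cong[OF DERIV_mult[OF DERIV_power[OF h_deriv] DERIV_diff[OF DERIV_diff[OF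
          DERIV_cmult[OF DERIV_mult[OF d(1) d(1)]]
          DERIV_mult[OF DERIV_mult[OF DERIV_mult[OF DERIV_cmult[OF c_deriv] h_deriv] d(1)] d(2)]]
          DERIV_mult[OF DERIV_mult[OF h_deriv h_deriv] DERIV_mult[OF d(2) d(2)]]]]])
      (simp add: algebra_simps)
  \<comment> \<open>Regrouped so that \<open>a2\<close> occurs only in the combination h h a2, which
    \<open>ode\<close> replaces.\<close>
  also have "(real i + 1) * h x ^ i * c x * (lam k * a\<^sup>2 - (real i + 1) * c x * h x * a * a1 - (h x)\<^sup>2 * a1\<^sup>2)
    + h x ^ (i + 1) * (2 * lam k * a * a1 + (real i + 1) * \<kappa> * h x * h x * a * a1
       - (real i + 1) * c x * (c x * a * a1 + h x * a1 * a1 + h x * a * a2)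
       - 2 * h x * c x * a1\<^sup>2 - 2 * (h x)\<^sup>2 * a1 * a2)
    = h x ^ i * ((real i + 1) * c x * (lam k * a * a - (real i + 1) * c x * h x * a * a1 - h x * h x * a1 * a1)
    + h x * (2 * lam k * a * a1 + (real i + 1) * \<kappa> * h x * h x * a * a1
       - (real i + 1) * c x * (c x * a * a1 + h x * a1 * a1)
       - 2 * h x * c x * a1 * a1)
       - ((real i + 1) * c x * a + 2 * h x * a1) * (h x * h x * a2))"
    by (simp add: algebra_simps power2_eq_square)
  \<comment> \<open>Everything cancels except the term that comes from c' = - \<kappa> h.\<close>
  also have "\<dots> = (real n - 2) * \<kappa> * h x ^ n * a * a1"
    unfolding ode by (simp add: n algebra_simps power3_eq_cube power_add)
  finally show "((\<lambda>r. \<kappa> * riccati k r) has_real_derivative \<kappa> * ((real n - 2) * \<kappa> * h x ^ n * a * a1)) (at x)"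
    by (rule DERIV_cmult)
  have \<kappa>\<kappa>: "\<kappa> * \<kappa> > 0" using \<kappa> not_real_square_gt_zero by blast
  then have "(\<kappa> * \<kappa>) * ((real n - 2) * h x ^ n * a * a1) > 0"
    using x k n3 by (intro mult_pos_pos[OF \<kappa>\<kappa>] mult_pos_pos[of "_ * _ * _"] mult_pos_pos[of "_ * _"] mult_pos_pos[of "real n - 2"]) (auto simp: a_def a1_def h_pos radial_pos radial1_pos)
  then show "\<kappa> * ((real n - 2) * \<kappa> * h x ^ n * a * a1) > 0" by (simp add: mult_ac)
qed

lemma scaled_steklov_deriv:
  assumes r: "0 < r" "r < L"
  shows "((\<lambda>r. steklov k r * h r) has_real_derivative riccati k r / (h r ^ (n - 1) * (radial k r)\<^sup>2)) (at r)"
proof -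
  obtain i where i: "n = i + 3" using n3 by (metis le_add_diff_inverse2)
  have r0: "0 \<le> r" using r by simp
  note d = radial_deriv[OF r0 r(2), of k]
  define a a1 a2 where "a = radial k r" and "a1 = radial1 k r" and "a2 = radial2 k r"
  have pos: "h r > 0" "a > 0" using r by (simp_all add: h_pos a_def radial_pos)
  have ode: "h r * h r * a2 = lam k * a - (real i + 2) * h r * c r * a1"
    using radial_ode[OF r0 r(2), of k] by (simp add: a_def a1_def a2_def i power2_eq_square algebra_simps)
  have "((\<lambda>r. steklov k r * h r) has_real_derivative (a2 * a - a1 * a1) / (a * a) * h r + c r * (a1 / a)) (at r)"
    unfolding steklov_def
    by (rule DERIV_cong[OF DERIV_mult[OF DERIV_divide[OF d(2) d(1)] h_deriv]])
      (use pos in \<open>auto simp: a_def a1_def a2_def\<close>)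
  also have "(a2 * a - a1 * a1) / (a * a) * h r + c r * (a1 / a) =
     ((h r * h r * a2) * a - h r * h r * a1 * a1 + c r * h r * a * a1) / (h r * (a * a))"
    using pos by (simp add: field_simps)
  also have "\<dots> = riccati k r / (h r ^ (n - 1) * (radial k r)\<^sup>2)"
    unfolding ode riccati_def a_def[symmetric] a1_def[symmetric]
    using pos by (simp add: i divide_simps power2_eq_square) (simp add: algebra_simps)?
  finally show ?thesis .
qed

lemma scaled_steklov_mono:
  assumes "0 < r" "r < s" "s < L" "k > 0" "\<kappa> \<noteq> 0"
  shows "\<kappa> * (steklov k r * h r) < \<kappa> * (steklov k s * h s)"
proof (rule DERIV_pos_imp_increasing[OF assms(2)])
  fix x assume "r \<le> x" "x \<le> s"
  then have x: "0 < x" "x < L" using assms by auto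
  have "\<kappa> * riccati k x / (h x ^ (n - 1) * (radial k x)\<^sup>2) > 0"
    using riccati_sign[OF x assms(4,5)] h_pos[OF x] radial_pos[OF x, of k] by simp
  then show "\<exists>y. ((\<lambda>r. \<kappa> * (steklov k r * h r)) has_real_derivative y) (at x) \<and> 0 < y"
    using DERIV_cmult[OF scaled_steklov_deriv[OF x], of \<kappa>] by fastforce
qed

end

subsection \<open>Partial derivatives and smooth functions\<close>

abbreviation pd :: "'n \<Rightarrow> (real^'n \<Rightarrow> real) \<Rightarrow> real^'n \<Rightarrow> real"
  where "pd \<equiv> partial_deriv"

lemma pd_eq: "(f has_derivative f') (at x) \<Longrightarrow> pd i f x = f' (axis i 1)"
  unfolding partial_deriv_def by (metis frechet_derivative_at)

lemma frechet_derivative_pd: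
  fixes f :: "real^'n \<Rightarrow> real"
  assumes "f differentiable at x"
  shows "frechet_derivative f (at x) v = (\<Sum>i\<in>UNIV. v $ i * pd i f x)"
proof -
  interpret linear "frechet_derivative f (at x)"
    using assms by (rule linear_frechet_derivative)
  have "v = (\<Sum>i\<in>UNIV. v $ i *\<^sub>R axis i 1)"
    by (simp add: basis_expansion flip: scalar_mult_eq_scaleR)
  then have "frechet_derivative f (at x) v = frechet_derivative f (at x) (\<Sum>i\<in>UNIV. v $ i *\<^sub>R axis i 1)"
    by simp
  then show ?thesis by (simp add: sum scale partial_deriv_def)
qed

lemma has_derivative_pd:
  fixes f :: "real^'n \<Rightarrow> real"
  assumes "f differentiable at x"
  shows "(f has_derivative (\<lambda>v. \<Sum>i\<in>UNIV. v $ i * pd i f x)) (at x)"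
  using assms frechet_derivative_pd[OF assms]
  by (metis (no_types, lifting) ext frechet_derivative_works)

lemma pd_cong:
  assumes "open U" "x \<in> U" "\<And>y. y \<in> U \<Longrightarrow> f y = g y"
  shows "pd i f x = pd i g x"
proof -
  have "(f has_derivative d) (at x) \<longleftrightarrow> (g has_derivative d) (at x)" for d
    using assms by (metis has_derivative_transform_within_open)
  then show ?thesis by (simp add: partial_deriv_def frechet_derivative_def)
qed

lemma pd_add:
  assumes "f differentiable at x" "g differentiable at x"
  shows "pd i (\<lambda>x. f x + g x) x = pd i f x + pd i g x"
  using assms by (subst pd_eq[OF has_derivative_add[OF has_derivative_pd has_derivative_pd]])
    (simp_all add: axis_def if_distrib[of "\<lambda>x. x * _"] cong: if_cong)

lemma pd_diff:
  assumes "f differentiable at x" "g differentiable at x"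
  shows "pd i (\<lambda>x. f x - g x) x = pd i f x - pd i g x"
  using assms by (subst pd_eq[OF has_derivative_diff[OF has_derivative_pd has_derivative_pd]])
    (simp_all add: axis_def if_distrib[of "\<lambda>x. x * _"] cong: if_cong)

lemma pd_mult:
  assumes "f differentiable at x" "g differentiable at x"
  shows "pd i (\<lambda>x. f x * g x) x = f x * pd i g x + pd i f x * g x"
  using assms by (subst pd_eq[OF has_derivative_mult[OF has_derivative_pd has_derivative_pd]])
    (simp_all add: axis_def if_distrib[of "\<lambda>x. x * _"] cong: if_cong)

lemma pd_const: "pd i (\<lambda>x. c) x = 0"
  by (simp add: partial_deriv_def frechet_derivative_const)

lemma pd_sum:
  assumes "\<And>j. j \<in> A \<Longrightarrow> f j differentiable at x"
  shows "pd i (\<lambda>x. \<Sum>j\<in>A. f j x) x = (\<Sum>j\<in>A. pd i (f j) x)"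
proof -
  have "((\<lambda>x. \<Sum>j\<in>A. f j x) has_derivative (\<lambda>v. \<Sum>j\<in>A. frechet_derivative (f j) (at x) v)) (at x)"
    using assms by (intro has_derivative_sum) (simp add: frechet_derivative_works)
  from pd_eq[OF this] show ?thesis by (simp add: partial_deriv_def)
qed

lemma nth_differentiable: "(\<lambda>x::real^'n. x $ i) differentiable at x"
  by (rule bounded_linear_imp_differentiable[OF bounded_linear_vec_nth])

lemma pd_nth: "pd i (\<lambda>x. x $ j) x = (if i = j then 1 else 0)"
  using pd_eq[OF bounded_linear.has_derivative[OF bounded_linear_vec_nth has_derivative_ident], of i j x]
  by (simp add: axis_def)

lemma pd_chain:
  assumes "(g has_real_derivative d) (at (q x))" "q differentiable at x"
  shows "pd i (\<lambda>x. g (q x)) x = d * pd i q x"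
    and "(\<lambda>x. g (q x)) differentiable at x"
proof -
  have "((\<lambda>x. g (q x)) has_derivative (\<lambda>v. frechet_derivative q (at x) v * d)) (at x)"
    using assms by (intro DERIV_compose_FDERIV) (auto simp: frechet_derivative_works)
  note e = this
  show "pd i (\<lambda>x. g (q x)) x = d * pd i q x"
    unfolding pd_eq[OF e] by (simp add: partial_deriv_def)
  show "(\<lambda>x. g (q x)) differentiable at x"
    using e unfolding differentiable_def by blast
qed

lemma norm_square_differentiable: "(\<lambda>x::real^'n. (norm x)\<^sup>2) differentiable at x"
  and pd_norm_square: "pd i (\<lambda>x::real^'n. (norm x)\<^sup>2) x = 2 * x $ i"
proof -
  have "((\<lambda>x::real^'n. (norm x)\<^sup>2) has_derivative (\<lambda>v. 2 * (x \<bullet> v))) (at x)"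
    unfolding power2_norm_eq_inner by (auto intro!: derivative_eq_intros simp: inner_commute)
  note d = this
  show "(\<lambda>x::real^'n. (norm x)\<^sup>2) differentiable at x"
    using d unfolding differentiable_def by blast
  show "pd i (\<lambda>x::real^'n. (norm x)\<^sup>2) x = 2 * x $ i"
    unfolding pd_eq[OF d] by (simp add: inner_axis)
qed

lemma norm_square_sum: "(norm x)\<^sup>2 = (\<Sum>i\<in>UNIV. x $ i * x $ i)" for x :: "real^'n"
  by (simp add: power2_norm_eq_inner inner_vec_def)

lemma C_k_on_differentiable:
  "open U \<Longrightarrow> C_k_on (Suc k) U f \<Longrightarrow> x \<in> U \<Longrightarrow> f differentiable at x"
  unfolding C_k_on.simps differentiable_on_def by (metis at_within_open)

lemma C_k_on_SucI:
  assumes "open U" "\<And>x. x \<in> U \<Longrightarrow> f differentiable at x" "\<And>i. C_k_on k U (pd i f)"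
  shows "C_k_on (Suc k) U f"
  using assms by (auto simp: differentiable_on_def intro: differentiable_at_withinI)

lemma C_k_on_pd: "C_k_on (Suc k) U f \<Longrightarrow> C_k_on k U (pd i f)"
  by simp

lemma C_k_on_cong:
  assumes "open U" "\<And>x. x \<in> U \<Longrightarrow> f x = g x"
  shows "C_k_on k U f \<longleftrightarrow> C_k_on k U g"
  using assms(2)
proof (induction k arbitrary: f g)
  case 0
  then show ?case by (simp cong: continuous_on_cong)
next
  case (Suc k)
  have "pd i f x = pd i g x" if "x \<in> U" for i x
    using assms(1) that Suc.prems by (rule pd_cong)
  then have "C_k_on k U (pd i f) \<longleftrightarrow> C_k_on k U (pd i g)" for i
    by (rule Suc.IH)
  moreover have "f differentiable_on U \<longleftrightarrow> g differentiable_on U"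
    using Suc.prems unfolding differentiable_on_def by (metis differentiable_transform_within zero_less_one)
  ultimately show ?case by simp
qed

lemma C_k_on_subset: "C_k_on k U f \<Longrightarrow> V \<subseteq> U \<Longrightarrow> C_k_on k V f"
  by (induction k arbitrary: f) (auto intro: continuous_on_subset differentiable_on_subset)

lemma C_k_on_Suc_imp: "C_k_on (Suc k) U f \<Longrightarrow> C_k_on k U f"
  by (induction k arbitrary: f) (auto intro: differentiable_imp_continuous_on)

lemma C_k_on_const: "C_k_on k (U :: (real^'n) set) (\<lambda>x. c)"
proof (induction k arbitrary: c)
  case (Suc k)
  have "pd i (\<lambda>x. c) = (\<lambda>x. 0)" for i :: 'n by (auto simp: pd_const)
  then show ?case using Suc[of 0] by simp
qed simp

lemma C_k_on_nth: "C_k_on k U (\<lambda>x. x $ i)"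
proof (cases k)
  case (Suc j)
  have "pd l (\<lambda>x. x $ i) = (\<lambda>x. if l = i then 1 else 0)" for l by (auto simp: pd_nth)
  then show ?thesis
    unfolding Suc by (auto simp: C_k_on_const differentiable_on_def nth_differentiable intro: differentiable_at_withinI)
qed (simp add: continuous_on_component)

lemma C_k_on_add:
  assumes "open U" "C_k_on k U f" "C_k_on k U g"
  shows "C_k_on k U (\<lambda>x. f x + g x)"
  using assms(2,3)
proof (induction k arbitrary: f g)
  case (Suc k)
  note d = C_k_on_differentiable[OF assms(1) Suc.prems(1)] C_k_on_differentiable[OF assms(1) Suc.prems(2)]
  show ?case
  proof (rule C_k_on_SucI[OF assms(1)])
    fix i
    have "C_k_on k U (\<lambda>x. pd i f x + pd i g x)"
      using Suc.prems by (intro Suc.IH) auto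
    then show "C_k_on k U (pd i (\<lambda>x. f x + g x))"
      by (subst C_k_on_cong[OF assms(1), where g = "\<lambda>x. pd i f x + pd i g x"]) (auto simp: pd_add d)
  qed (auto intro: d differentiable_add)
qed (auto intro: continuous_on_add)

lemma C_k_on_mult:
  assumes "open U" "C_k_on k U f" "C_k_on k U g"
  shows "C_k_on k U (\<lambda>x. f x * g x)"
  using assms(2,3)
proof (induction k arbitrary: f g)
  case (Suc k)
  note d = C_k_on_differentiable[OF assms(1) Suc.prems(1)] C_k_on_differentiable[OF assms(1) Suc.prems(2)]
  show ?case
  proof (rule C_k_on_SucI[OF assms(1)])
    fix i
    have "C_k_on k U (\<lambda>x. f x * pd i g x + pd i f x * g x)"
      using Suc.prems by (intro C_k_on_add[OF assms(1)] Suc.IH) (blast intro: C_k_on_pd C_k_on_Suc_imp)+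
    then show "C_k_on k U (pd i (\<lambda>x. f x * g x))"
      by (subst C_k_on_cong[OF assms(1), where g = "\<lambda>x. f x * pd i g x + pd i f x * g x"]) (auto simp: pd_mult d)
  qed (auto intro: d differentiable_mult)
qed (auto intro: continuous_on_mult)

lemma C_k_on_diff:
  assumes "open U" "C_k_on k U f" "C_k_on k U g"
  shows "C_k_on k U (\<lambda>x. f x - g x)"
  using C_k_on_add[OF assms(1,2) C_k_on_mult[OF assms(1) C_k_on_const assms(3)], of "-1"] by simp

lemma C_k_on_power:
  assumes "open U" "C_k_on k U f"
  shows "C_k_on k U (\<lambda>x. f x ^ j)"
  by (induction j) (auto simp: C_k_on_const intro!: C_k_on_mult assms)

lemma C_k_on_sum:
  assumes "open U" "\<And>j. j \<in> A \<Longrightarrow> C_k_on k U (f j)"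
  shows "C_k_on k U (\<lambda>x. \<Sum>j\<in>A. f j x)"
  using assms(2)
  by (induction A rule: infinite_finite_induct) (auto simp: C_k_on_const intro!: C_k_on_add assms(1))

lemma C_k_on_norm_square: "open U \<Longrightarrow> C_k_on k U (\<lambda>x::real^'n. (norm x)\<^sup>2)"
  unfolding norm_square_sum by (intro C_k_on_sum C_k_on_mult C_k_on_nth)

text \<open>A smooth function of one variable is given by the sequence of all its derivatives.\<close>
lemma C_k_on_compose:
  fixes F :: "nat \<Rightarrow> real \<Rightarrow> real"
  assumes "open U" "\<And>j x. x \<in> U \<Longrightarrow> (F j has_real_derivative F (Suc j) (q x)) (at (q x))"
    and "C_k_on k U q"
  shows "C_k_on k U (\<lambda>x. F j (q x))"
  using assms(3)
proof (induction k arbitrary: j)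
  case 0
  have "continuous_on U (\<lambda>x. F j (q x))"
  proof (rule continuous_at_imp_continuous_on, rule ballI)
    fix x assume x: "x \<in> U"
    have "isCont q x" using 0 assms(1) x by (simp add: continuous_on_eq_continuous_at)
    then show "isCont (\<lambda>x. F j (q x)) x"
      using DERIV_isCont[OF assms(2)[OF x]] by (rule isCont_o2)
  qed
  then show ?case by simp
next
  case (Suc k)
  note d = C_k_on_differentiable[OF assms(1)]
  show ?case
  proof (rule C_k_on_SucI[OF assms(1)])
    fix x assume x: "x \<in> U"
    show "(\<lambda>x. F j (q x)) differentiable at x"
      by (rule pd_chain(2)[OF assms(2)[OF x] d[OF Suc.prems x]])
  next
    fix i
    have "C_k_on k U (\<lambda>x. F (Suc j) (q x) * pd i q x)"
      using Suc.prems by (intro C_k_on_mult[OF assms(1)] Suc.IH) (blast intro: C_k_on_pd C_k_on_Suc_imp)+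
    then show "C_k_on k U (pd i (\<lambda>x. F j (q x)))"
      by (subst C_k_on_cong[OF assms(1), where g = "\<lambda>x. F (Suc j) (q x) * pd i q x"])
        (auto simp: pd_chain(1)[OF assms(2) d[OF Suc.prems]])
  qed
qed

lemma pd_dilate:
  fixes f :: "real^'n \<Rightarrow> real"
  assumes "f differentiable at (r *\<^sub>R x)"
  shows "pd i (\<lambda>x. f (r *\<^sub>R x)) x = r * pd i f (r *\<^sub>R x)"
    and "(\<lambda>x. f (r *\<^sub>R x)) differentiable at x"
proof -
  have "((\<lambda>x. f (r *\<^sub>R x)) has_derivative (\<lambda>v. frechet_derivative f (at (r *\<^sub>R x)) (r *\<^sub>R v))) (at x)"
    by (rule has_derivative_compose[where g = f])
      (use assms in \<open>auto intro!: derivative_eq_intros simp: frechet_derivative_works\<close>)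
  note e = this
  show "pd i (\<lambda>x. f (r *\<^sub>R x)) x = r * pd i f (r *\<^sub>R x)"
    unfolding pd_eq[OF e] using linear_frechet_derivative[OF assms]
    by (simp add: partial_deriv_def linear_cmul)
  show "(\<lambda>x. f (r *\<^sub>R x)) differentiable at x"
    using e unfolding differentiable_def by blast
qed

lemma C_k_on_dilate:
  fixes f :: "real^'n \<Rightarrow> real"
  assumes "open U" "C_k_on k U f"
  shows "C_k_on k ((*\<^sub>R) r -` U) (\<lambda>x. f (r *\<^sub>R x))"
  using assms(2)
proof (induction k arbitrary: f)
  case 0
  then show ?case
    by (auto intro!: continuous_on_compose2[of U f _ "(*\<^sub>R) r"] continuous_intros)
next
  case (Suc k)
  have o: "open ((*\<^sub>R) r -` U)"
    by (intro continuous_open_vimage assms(1)) (auto intro!: continuous_intros)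
  note d = C_k_on_differentiable[OF assms(1) Suc.prems]
  show ?case
  proof (rule C_k_on_SucI[OF o])
    show "(\<lambda>x. f (r *\<^sub>R x)) differentiable at x" if "x \<in> (*\<^sub>R) r -` U" for x
      using that by (intro pd_dilate d) auto
    fix i
    have "C_k_on k ((*\<^sub>R) r -` U) (\<lambda>x. r * pd i f (r *\<^sub>R x))"
      using Suc.prems by (intro C_k_on_mult[OF o] C_k_on_const Suc.IH) auto
    then show "C_k_on k ((*\<^sub>R) r -` U) (pd i (\<lambda>x. f (r *\<^sub>R x)))"
      by (subst C_k_on_cong[OF o, where g = "\<lambda>x. r * pd i f (r *\<^sub>R x)"]) (auto simp: pd_dilate(1) d)
  qed
qed

subsection \<open>The Laplace-Beltrami operator of a warped metric\<close>

text \<open>The generator of rotations in the plane of the coordinates i and j: tangent to all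
  spheres about the origin and zero on radial functions.\<close>

definition rot :: "'n \<Rightarrow> 'n \<Rightarrow> (real^'n \<Rightarrow> real) \<Rightarrow> real^'n \<Rightarrow> real"
  where "rot i j f x = x $ i * pd j f x - x $ j * pd i f x"

definition euler :: "(real^'n \<Rightarrow> real) \<Rightarrow> real^'n \<Rightarrow> real"
  where "euler f x = (\<Sum>i\<in>UNIV. x $ i * pd i f x)"

text \<open>In polar coordinates this is r^2 times the second radial derivative, as
  \<open>euler\<close> is r times the first. It differs from applying \<open>euler\<close> twice by
  \<open>euler f\<close>.\<close>

definition radial_hess :: "(real^'n \<Rightarrow> real) \<Rightarrow> real^'n \<Rightarrow> real"
  where "radial_hess f x = (\<Sum>i\<in>UNIV. \<Sum>j\<in>UNIV. x $ i * x $ j * pd i (pd j f) x)"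

definition laplacian :: "(real^'n \<Rightarrow> real) \<Rightarrow> real^'n \<Rightarrow> real"
  where "laplacian f x = (\<Sum>i\<in>UNIV. pd i (pd i f) x)"

lemma C_2D:
  assumes "open U" "C_k_on 2 U f" "x \<in> U"
  shows "f differentiable at x" "pd i f differentiable at x"
  using assms by (auto simp: numeral_2_eq_2 differentiable_on_def) (metis at_within_open)+

lemma pd_rot:
  assumes "open U" "C_k_on 2 U f" "x \<in> U"
  shows "pd l (rot i j f) x = (if l = i then pd j f x else 0) + x $ i * pd l (pd j f) x
    - ((if l = j then pd i f x else 0) + x $ j * pd l (pd i f) x)"
  unfolding rot_def[abs_def] using C_2D[OF assms]
  by (simp add: pd_diff pd_mult pd_nth nth_differentiable differentiable_mult)

text \<open>The left side is twice the spherical Laplacian, since every coordinate plane is counted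
  twice; the right side is the polar splitting r^2 Laplacian = r^2 f'' + (n - 1) r f' + spherical
  part.\<close>

lemma rot_rot_sum:
  fixes f :: "real^'n \<Rightarrow> real"
  assumes "open U" "C_k_on 2 U f" "x \<in> U"
  shows "(\<Sum>i\<in>UNIV. \<Sum>j\<in>UNIV. rot i j (rot i j f) x) =
    2 * ((norm x)\<^sup>2 * laplacian f x - radial_hess f x - (real CARD('n) - 1) * euler f x)"
proof -
  have e: "rot i j (rot i j f) x =
     (if j = i then x $ i * pd i f x + x $ j * pd j f x else 0)
     + x $ i * x $ i * pd j (pd j f) x + x $ j * x $ j * pd i (pd i f) x
     - x $ i * x $ j * pd j (pd i f) x - x $ i * x $ j * pd i (pd j f) x
     - x $ i * pd i f x - x $ j * pd j f x" for i j
    unfolding rot_def[of i j "rot i j f"] pd_rot[OF assms]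
    by (auto simp: algebra_simps)
  have s1: "(\<Sum>i\<in>UNIV. \<Sum>j\<in>UNIV. if j = i then x $ i * pd i f x + x $ j * pd j f x else 0) = 2 * euler f x"
    by (simp add: euler_def sum_distrib_left)
  have s2: "(\<Sum>i\<in>UNIV. \<Sum>j\<in>UNIV. x $ i * x $ i * pd j (pd j f) x) = (norm x)\<^sup>2 * laplacian f x"
    by (simp add: laplacian_def norm_square_sum sum_product)
  have s3: "(\<Sum>i\<in>UNIV. \<Sum>j\<in>UNIV. x $ j * x $ j * pd i (pd i f) x) = (norm x)\<^sup>2 * laplacian f x"
    by (subst sum.swap) (rule s2)
  \<comment> \<open>The two orders of a mixed derivative are kept apart; exchanging the summation
    indices takes the place of their symmetry.\<close>
  have s4: "(\<Sum>i\<in>UNIV. \<Sum>j\<in>UNIV. x $ i * x $ j * pd j (pd i f) x) = radial_hess f x"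
    unfolding radial_hess_def by (subst sum.swap) (simp add: mult_ac)
  have s5: "(\<Sum>i\<in>(UNIV::'n set). \<Sum>j\<in>(UNIV::'n set). x $ i * pd i f x) = real CARD('n) * euler f x"
    by (simp add: euler_def sum_distrib_left)
  have s6: "(\<Sum>i\<in>(UNIV::'n set). \<Sum>j\<in>(UNIV::'n set). x $ j * pd j f x) = real CARD('n) * euler f x"
    by (simp add: euler_def)
  show ?thesis
    unfolding e sum.distrib sum_subtractf s1 s2 s3 s4 s5 s6 radial_hess_def[symmetric]
    by (simp add: algebra_simps)
qed

lemma rot_mult:
  assumes "f differentiable at x" "g differentiable at x"
  shows "rot i j (\<lambda>x. f x * g x) x = f x * rot i j g x + rot i j f x * g x"
  using assms by (simp add: rot_def pd_mult algebra_simps)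

lemma rot_radial:
  assumes "(g has_real_derivative d) (at ((norm x)\<^sup>2))"
  shows "rot i j (\<lambda>x. g ((norm x)\<^sup>2)) x = 0"
  by (simp add: rot_def pd_chain(1)[OF assms norm_square_differentiable] pd_norm_square)

lemma C_k_on_rot:
  assumes "open U" "C_k_on (Suc k) U f"
  shows "C_k_on k U (rot i j f)"
  unfolding rot_def[abs_def] using assms
  by (intro C_k_on_diff C_k_on_mult C_k_on_nth C_k_on_pd)

lemma pd_euler:
  assumes "open U" "C_k_on 2 U f" "x \<in> U"
  shows "pd l (euler f) x = pd l f x + (\<Sum>i\<in>UNIV. x $ i * pd l (pd i f) x)"
    and "euler f differentiable at x"
proof -
  note d = C_2D[OF assms]
  have "pd l (euler f) x = (\<Sum>i\<in>UNIV. pd l (\<lambda>x. x $ i * pd i f x) x)"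
    unfolding euler_def[abs_def] by (intro pd_sum differentiable_mult nth_differentiable d)
  also have "\<dots> = (\<Sum>i\<in>UNIV. (if i = l then pd i f x else 0) + x $ i * pd l (pd i f) x)"
    by (intro sum.cong refl) (simp add: pd_mult nth_differentiable d pd_nth)
  also have "\<dots> = pd l f x + (\<Sum>i\<in>UNIV. x $ i * pd l (pd i f) x)"
    by (simp add: sum.distrib)
  finally show "pd l (euler f) x = pd l f x + (\<Sum>i\<in>UNIV. x $ i * pd l (pd i f) x)" .
  show "euler f differentiable at x"
    unfolding euler_def[abs_def] by (auto intro!: differentiable_sum differentiable_mult nth_differentiable d)
qed

lemma ray_deriv:
  fixes f :: "real^'n \<Rightarrow> real"
  assumes "f differentiable at (r *\<^sub>R w)"
  shows "((\<lambda>r. f (r *\<^sub>R w)) has_real_derivative (\<Sum>i\<in>UNIV. w $ i * pd i f (r *\<^sub>R w))) (at r)"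
proof -
  have "((\<lambda>r. f (r *\<^sub>R w)) has_derivative (\<lambda>s. \<Sum>i\<in>UNIV. (s *\<^sub>R w) $ i * pd i f (r *\<^sub>R w))) (at r)"
    by (rule has_derivative_compose[where g = f and f = "\<lambda>r. r *\<^sub>R w", OF _ has_derivative_pd[OF assms]]) (auto intro!: derivative_eq_intros)
  moreover have "(*) (\<Sum>i\<in>UNIV. w $ i * pd i f (r *\<^sub>R w)) = (\<lambda>s. \<Sum>i\<in>UNIV. (s *\<^sub>R w) $ i * pd i f (r *\<^sub>R w))"
    by (rule ext, subst sum_distrib_right) (simp add: mult_ac)
  ultimately show ?thesis by (simp only: has_field_derivative_def)
qed

lemma ray_deriv2:
  fixes f :: "real^'n \<Rightarrow> real"
  assumes "open U" "C_k_on 2 U f" "r *\<^sub>R w \<in> U"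
  shows "((\<lambda>r. \<Sum>i\<in>UNIV. w $ i * pd i f (r *\<^sub>R w)) has_real_derivative
    (\<Sum>i\<in>UNIV. \<Sum>j\<in>UNIV. w $ i * w $ j * pd i (pd j f) (r *\<^sub>R w))) (at r)"
proof -
  have "((\<lambda>r. \<Sum>j\<in>UNIV. w $ j * pd j f (r *\<^sub>R w)) has_real_derivative
    (\<Sum>j\<in>UNIV. w $ j * (\<Sum>i\<in>UNIV. w $ i * pd i (pd j f) (r *\<^sub>R w)))) (at r)"
    by (intro DERIV_sum DERIV_cmult ray_deriv C_2D[OF assms])
  also have "(\<Sum>j\<in>UNIV. w $ j * (\<Sum>i\<in>UNIV. w $ i * pd i (pd j f) (r *\<^sub>R w))) =
    (\<Sum>i\<in>UNIV. \<Sum>j\<in>UNIV. w $ i * w $ j * pd i (pd j f) (r *\<^sub>R w))"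
    unfolding sum_distrib_left by (subst sum.swap) (simp add: mult_ac)
  finally show ?thesis .
qed

section \<open>Determinant and inverse of the warped metric\<close>

lemma det_rank_one_update:
  fixes w :: "real^'n"
  assumes "norm w = 1"
  shows "det (\<chi> i j. w $ i * w $ j + b * ((if i = j then 1 else 0) - w $ i * w $ j)) = b ^ (CARD('n) - 1)"
proof -
  fix k :: 'n
  \<comment> \<open>The matrix has eigenvalue 1 along \<open>w\<close> and \<open>b\<close> on the
    orthogonal complement. An orthogonal matrix with k-th column \<open>w\<close> diagonalises
    it.\<close>
  obtain A :: "real^'n^'n" where A: "orthogonal_matrix A" "A *v (axis k 1) = w"
    using orthogonal_matrix_exists_basis[OF assms] by blast
  define d where "d j = (if j = k then 1 else b)" for j
  define M :: "real^'n^'n" where "M = (\<chi> i j. if i = j then d i else 0)"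
  have Ak: "A $ i $ k = w $ i" for i
    using A(2) by (auto simp: matrix_vector_mult_def vec_eq_iff axis_def if_distrib cong: if_cong)
  have orth: "(\<Sum>j\<in>UNIV. A $ i $ j * A $ l $ j) = (if i = l then 1 else 0)" for i l
  proof -
    have "A ** transpose A = mat 1" using A(1) by (simp add: orthogonal_matrix_def)
    then have "(A ** transpose A) $ i $ l = mat 1 $ i $ l" by simp
    then show ?thesis by (simp add: matrix_matrix_mult_def transpose_def mat_def)
  qed
  have AM: "(A ** M) $ i $ j = A $ i $ j * d j" for i j
    by (simp add: matrix_matrix_mult_def M_def if_distrib[of "\<lambda>x. _ * x"] cong: if_cong)
  have "(A ** M ** transpose A) $ i $ l = w $ i * w $ l + b * ((if i = l then 1 else 0) - w $ i * w $ l)" for i l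
  proof -
    have "(A ** M ** transpose A) $ i $ l = (\<Sum>j\<in>UNIV. (A ** M) $ i $ j * A $ l $ j)"
      by (simp add: matrix_matrix_mult_def[of "A ** M"] transpose_def)
    also have "\<dots> = (\<Sum>j\<in>UNIV. b * (A $ i $ j * A $ l $ j) + (if j = k then (1 - b) * (A $ i $ j * A $ l $ j) else 0))"
      unfolding AM by (intro sum.cong refl) (auto simp: d_def algebra_simps)
    also have "\<dots> = b * (if i = l then 1 else 0) + (1 - b) * (w $ i * w $ l)"
      by (simp add: sum.distrib sum_distrib_left[symmetric] orth Ak)
    finally show ?thesis by (simp add: algebra_simps)
  qed
  then have "(\<chi> i j. w $ i * w $ j + b * ((if i = j then 1 else 0) - w $ i * w $ j)) = A ** M ** transpose A"
    by (simp add: vec_eq_iff)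
  then have "det (\<chi> i j. w $ i * w $ j + b * ((if i = j then 1 else 0) - w $ i * w $ j)) = (det A)\<^sup>2 * det M"
    by (simp add: det_mul power2_eq_square)
  also have "(det A)\<^sup>2 = 1" using det_orthogonal_matrix[OF A(1)] by auto
  also have "det M = (\<Prod>i\<in>UNIV. d i)"
    by (subst det_diagonal) (auto simp: M_def)
  also have "\<dots> = d k * (\<Prod>i\<in>UNIV - {k}. b)"
    by (subst prod.remove[of _ k]) (auto simp: d_def intro!: prod.cong)
  also have "\<dots> = b ^ (CARD('n) - 1)" by (simp add: d_def)
  finally show ?thesis by simp
qed

lemma matrix_inv_eq:
  fixes A :: "real^'n^'n"
  assumes "A ** B = mat 1"
  shows "matrix_inv A = B"
proof -
  have "B ** A = mat 1" using assms by (simp add: matrix_left_right_inverse)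
  then have "\<exists>C. A ** C = mat 1 \<and> C ** A = mat 1" using assms by blast
  then have "A ** matrix_inv A = mat 1 \<and> matrix_inv A ** A = mat 1"
    unfolding matrix_inv_def by (rule someI_ex)
  then have "matrix_inv A = matrix_inv A ** (A ** B)" "matrix_inv A ** A = mat 1"
    by (simp_all add: assms)
  then show ?thesis by (simp add: matrix_mul_assoc)
qed

lemma warped_metric_alt:
  fixes x :: "real^'n"
  assumes "x \<noteq> 0"
  defines "w \<equiv> x /\<^sub>R norm x"
  shows "warped_metric h x = (\<chi> i j. w $ i * w $ j + (h (norm x) / norm x)\<^sup>2 * ((if i = j then 1 else 0) - w $ i * w $ j))"
proof -
  have "w $ i * w $ j = x $ i * x $ j / (norm x)\<^sup>2" for i j
    by (simp add: w_def power2_eq_square divide_inverse)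
  then show ?thesis using assms(1) by (simp add: warped_metric_def)
qed

lemma det_warped_metric:
  fixes x :: "real^'n"
  assumes "x \<noteq> 0" "h (norm x) > 0"
  shows "sqrt (det (warped_metric h x)) = (h (norm x) / norm x) ^ (CARD('n) - 1)"
  unfolding warped_metric_alt[OF assms(1)] using assms
  by (subst det_rank_one_update) (simp_all add: real_sqrt_power)

text \<open>The metric is P + b (1 - P) with P the projection onto the radial direction, so its
  inverse is P + (1 / b) (1 - P).\<close>

lemma matrix_inv_warped_metric:
  fixes x :: "real^'n"
  assumes "x \<noteq> 0" "h (norm x) > 0"
  shows "matrix_inv (warped_metric h x) $ i $ j = x $ i * x $ j / (norm x)\<^sup>2 +
    (norm x / h (norm x))\<^sup>2 * ((if i = j then 1 else 0) - x $ i * x $ j / (norm x)\<^sup>2)"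
proof -
  define w where "w = x /\<^sub>R norm x"
  define b where "b = (h (norm x) / norm x)\<^sup>2"
  have ww: "(\<Sum>j\<in>UNIV. w $ j * w $ j) = 1"
    using assms(1) norm_square_sum[of w] by (simp add: w_def)
  have b: "b \<noteq> 0" using assms by (simp add: b_def)
  define B :: "real^'n^'n" where "B = (\<chi> i j. w $ i * w $ j + 1 / b * ((if i = j then 1 else 0) - w $ i * w $ j))"
  have "(warped_metric h x ** B) $ i $ l = mat 1 $ i $ l" for i l
  proof -
    have "(warped_metric h x ** B) $ i $ l =
      (\<Sum>j\<in>UNIV. (w $ i * w $ j + b * ((if i = j then 1 else 0) - w $ i * w $ j)) * (w $ j * w $ l + 1 / b * ((if j = l then 1 else 0) - w $ j * w $ l)))"
      by (simp add: warped_metric_alt[OF assms(1)] B_def matrix_matrix_mult_def b_def w_def)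
    also have "\<dots> = (\<Sum>j\<in>UNIV. (1 - b) * (1 - 1 / b) * w $ i * w $ l * (w $ j * w $ j)
        + (if j = i then b * (1 - 1/b) * w $ j * w $ l else 0) + (if j = l then (1 - b) * (1 / b) * w $ i * w $ j else 0)
        + (if j = i then if j = l then 1 else 0 else 0))"
      using b by (intro sum.cong refl) (auto simp: field_simps)
    also have "\<dots> = mat 1 $ i $ l"
      using b by (simp add: sum.distrib sum_distrib_left[symmetric] ww mat_def) (auto simp: field_simps)
    finally show ?thesis .
  qed
  then have "matrix_inv (warped_metric h x) = B"
    by (intro matrix_inv_eq) (simp add: vec_eq_iff)
  then show ?thesis
    using assms by (simp add: B_def b_def w_def power2_eq_square field_simps)
qed

section \<open>The Laplace-Beltrami operator in polar form and at the centre\<close>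

lemma norm_pd:
  fixes x :: "real^'n"
  assumes "x \<noteq> 0"
  shows "norm differentiable at x" "pd i norm x = x $ i / norm x"
proof -
  have d: "(norm has_derivative (\<lambda>v. v \<bullet> sgn x)) (at x)"
    using has_derivative_norm[OF assms] .
  then show "norm differentiable at x" unfolding differentiable_def by blast
  show "pd i norm x = x $ i / norm x"
    unfolding pd_eq[OF d] by (simp add: inner_axis' sgn_div_norm divide_inverse)
qed

lemma has_derivative_0I:
  fixes f :: "real^'n \<Rightarrow> real"
  assumes "f 0 = 0" "((\<lambda>y. f y / norm y) \<longlongrightarrow> 0) (at 0)"
  shows "(f has_derivative (\<lambda>v. 0)) (at 0)"
  unfolding has_derivative_iff_norm
  using assms tendsto_norm_zero[OF assms(2)] by simp

context warping
begin

text \<open>With q = h(t) / t, the root of the determinant is q^(n-1) and the inverse metric is 1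
  radially and q^(-2) tangentially. Extracting q^(n-3) leaves the plain gradient plus (q^2 - 1) /
  t^2 times a radial term; the latter coefficient is \<open>warp_defect\<close>. Both measure the
  deviation from the flat values 1 and 0.\<close>

definition warp_weight :: "real \<Rightarrow> real"
  where "warp_weight t = (h t / t) ^ (n - 3)"

definition warp_defect :: "real \<Rightarrow> real"
  where "warp_defect t = ((h t)\<^sup>2 - t\<^sup>2) / t ^ 4"

lemma flux_eq:
  fixes u :: "real^'n \<Rightarrow> real"
  assumes n: "CARD('n) = n" and y: "y \<noteq> 0" "norm y < L"
  shows "sqrt (det (warped_metric h y)) * (\<Sum>j\<in>UNIV. matrix_inv (warped_metric h y) $ i $ j * pd j u y)
    = warp_weight (norm y) * (warp_defect (norm y) * (y $ i * euler u y) + pd i u y)"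
proof -
  obtain k where k: "n = k + 3" using n3 by (metis le_add_diff_inverse2)
  define t where "t = norm y"
  have t: "t > 0" "h t > 0" using y h_pos[of t] by (simp_all add: t_def)
  define q where "q = h t / t"
  have q: "q > 0" using t by (simp add: q_def)
  have "(\<Sum>j\<in>UNIV. matrix_inv (warped_metric h y) $ i $ j * pd j u y) =
    (\<Sum>j\<in>UNIV. (1 - 1 / q\<^sup>2) / t\<^sup>2 * y $ i * (y $ j * pd j u y) + (if j = i then 1 / q\<^sup>2 * pd j u y else 0))"
  proof (rule sum.cong[OF refl])
    fix j
    have "(t / h t)\<^sup>2 = 1 / q\<^sup>2" by (simp add: q_def power_divide)
    then show "matrix_inv (warped_metric h y) $ i $ j * pd j u y =
      (1 - 1 / q\<^sup>2) / t\<^sup>2 * y $ i * (y $ j * pd j u y) + (if j = i then 1 / q\<^sup>2 * pd j u y else 0)"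
      using matrix_inv_warped_metric[OF y(1), of h i j] t
      by (simp add: t_def[symmetric]) (auto simp: algebra_simps diff_divide_distrib add_divide_distrib)
  qed
  also have "\<dots> = (1 - 1 / q\<^sup>2) / t\<^sup>2 * y $ i * euler u y + 1 / q\<^sup>2 * pd i u y"
    unfolding sum.distrib euler_def by (simp only: sum_distrib_left[symmetric]) simp
  finally have s: "(\<Sum>j\<in>UNIV. matrix_inv (warped_metric h y) $ i $ j * pd j u y) =
    (1 - 1 / q\<^sup>2) / t\<^sup>2 * y $ i * euler u y + 1 / q\<^sup>2 * pd i u y" .
  have d: "sqrt (det (warped_metric h y)) = q ^ k * q\<^sup>2"
    using det_warped_metric[OF y(1), of h] t
    by (simp add: t_def[symmetric] n k q_def[symmetric] power_add power2_eq_square)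
  have wk: "warp_weight t = q ^ k"
    unfolding warp_weight_def q_def by (simp add: k)
  have a: "q\<^sup>2 * ((1 - 1 / q\<^sup>2) / t\<^sup>2) = warp_defect t"
  proof -
    have "q\<^sup>2 * ((1 - 1 / q\<^sup>2) / t\<^sup>2) = (q\<^sup>2 - 1) / t\<^sup>2" using q by (simp add: right_diff_distrib)
    also have "\<dots> = warp_defect t" using t by (simp add: q_def warp_defect_def field_simps power2_eq_square eval_nat_numeral)
    finally show ?thesis .
  qed
  have "q ^ k * q\<^sup>2 * ((1 - 1 / q\<^sup>2) / t\<^sup>2 * y $ i * euler u y + 1 / q\<^sup>2 * pd i u y)
    = q ^ k * ((q\<^sup>2 * ((1 - 1 / q\<^sup>2) / t\<^sup>2)) * y $ i * euler u y + (q\<^sup>2 * (1 / q\<^sup>2)) * pd i u y)"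
    by (simp only: distrib_left mult_ac)
  also have "\<dots> = q ^ k * (warp_defect t * (y $ i * euler u y) + pd i u y)"
    unfolding a using q by simp
  finally show ?thesis
    unfolding s d t_def[symmetric] wk .
qed

text \<open>The polar form u'' + (n - 1) (h' / h) u' + (spherical Laplacian of u) / h^2, multiplied
  by h^2. By \<open>rot_rot_sum\<close> the last bracket is the spherical Laplacian.\<close>

lemma laplace_beltrami_away:
  fixes u :: "real^'n \<Rightarrow> real"
  assumes n: "CARD('n) = n" and U: "open U" "C_k_on 2 U u" and x: "x \<in> U" "x \<noteq> 0" "norm x < L"
  defines "r \<equiv> norm x"
  shows "(h r)\<^sup>2 * laplace_beltrami (warped_metric h) u x =
    (h r)\<^sup>2 * (radial_hess u x / r\<^sup>2) + (real n - 1) * h r * c r * (euler u x / r)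
    + (r\<^sup>2 * laplacian u x - radial_hess u x - (real n - 1) * euler u x)"
proof -
  obtain k where k: "n = k + 3" using n3 by (metis le_add_diff_inverse2)
  have r: "r > 0" "r < L" "h r > 0" using x h_pos[of r] by (simp_all add: r_def)
  define B a E where "B = warp_weight r" and "a = warp_defect r" and "E = euler u x"
  have Bk: "B = (h r / r) ^ k" unfolding B_def warp_weight_def by (simp add: k)
  \<comment> \<open>The derivatives of weight and defect at r; \<open>B1\<close> is written as
    \<open>B\<close> times a logarithmic derivative so that \<open>B\<close> cancels against the
    determinant.\<close>
  define B1 where "B1 = B * real k * (c r / h r - 1 / r)"
  define a1 where "a1 = 2 * h r * c r / r ^ 4 - 4 * (h r)\<^sup>2 / r ^ 5 + 2 / r ^ 3"
  have dB: "(warp_weight has_real_derivative B1) (at r)"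
  proof -
    have "(warp_weight has_real_derivative real k * ((c r * r - h r) / (r * r) * (h r / r) ^ (k - 1))) (at r)"
      unfolding warp_weight_def[abs_def]
      by (rule DERIV_cong[OF DERIV_power[OF DERIV_divide[OF h_deriv DERIV_ident]]]) (use r in \<open>auto simp: k\<close>)
    also have "real k * ((c r * r - h r) / (r * r) * (h r / r) ^ (k - 1)) = B1"
    proof (cases k)
      case (Suc j)
      then show ?thesis
        using r by (simp add: B1_def Bk field_simps)
    qed (simp add: B1_def)
    finally show ?thesis .
  qed
  have da: "(warp_defect has_real_derivative a1) (at r)"
    unfolding warp_defect_def[abs_def] a1_def using r
    by (auto intro!: derivative_eq_intros h_deriv simp: field_simps eval_nat_numeral)
  note d = C_2D[OF U x(1)] pd_euler(2)[OF U x(1)] norm_pd(1)[OF x(2)] nth_differentiable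
    pd_chain(2)[OF dB[unfolded r_def] norm_pd(1)[OF x(2)]] pd_chain(2)[OF da[unfolded r_def] norm_pd(1)[OF x(2)]]
  have pB: "pd i (\<lambda>y. warp_weight (norm y)) x = B1 * (x $ i / r)" for i
    using pd_chain(1)[OF dB[unfolded r_def] norm_pd(1)[OF x(2)], of i] by (simp add: norm_pd(2)[OF x(2)] r_def)
  have pa: "pd i (\<lambda>y. warp_defect (norm y)) x = a1 * (x $ i / r)" for i
    using pd_chain(1)[OF da[unfolded r_def] norm_pd(1)[OF x(2)], of i] by (simp add: norm_pd(2)[OF x(2)] r_def)
  have "pd i (\<lambda>y. sqrt (det (warped_metric h y)) * (\<Sum>j\<in>UNIV. matrix_inv (warped_metric h y) $ i $ j * pd j u y)) x
    = B * (a * (x $ i * pd i (euler u) x + E) + a1 / r * E * (x $ i * x $ i) + pd i (pd i u) x)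
    + B1 / r * (a * E * (x $ i * x $ i) + x $ i * pd i u x)" for i
  proof -
    have "pd i (\<lambda>y. sqrt (det (warped_metric h y)) * (\<Sum>j\<in>UNIV. matrix_inv (warped_metric h y) $ i $ j * pd j u y)) x
      = pd i (\<lambda>y. warp_weight (norm y) * (warp_defect (norm y) * (y $ i * euler u y) + pd i u y)) x"
      using x by (intro pd_cong[of "ball 0 L - {0}"]) (auto simp: flux_eq[OF n])
    also have "\<dots> = B * (a * (x $ i * pd i (euler u) x + E) + a1 * (x $ i / r) * (x $ i * E) + pd i (pd i u) x)
      + B1 * (x $ i / r) * (a * (x $ i * E) + pd i u x)"
      by (simp add: pd_mult pd_add d differentiable_mult differentiable_add pB pa pd_nth B_def a_def E_def r_def)
    finally show ?thesis by (simp add: algebra_simps)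
  qed
  moreover have "(\<Sum>i\<in>UNIV. B * (a * (x $ i * pd i (euler u) x + E) + p * (x $ i * x $ i) + pd i (pd i u) x)
      + q * (s * (x $ i * x $ i) + x $ i * pd i u x))
    = B * (a * ((\<Sum>i\<in>UNIV. x $ i * pd i (euler u) x) + real n * E) + p * r\<^sup>2 + laplacian u x)
    + q * (s * r\<^sup>2 + E)" for p q s
    unfolding sum.distrib sum_distrib_left[symmetric]
    by (simp add: laplacian_def r_def norm_square_sum n E_def euler_def)
  ultimately have "(\<Sum>i\<in>UNIV. pd i (\<lambda>y. sqrt (det (warped_metric h y)) * (\<Sum>j\<in>UNIV. matrix_inv (warped_metric h y) $ i $ j * pd j u y)) x)
    = B * (a * ((\<Sum>i\<in>UNIV. x $ i * pd i (euler u) x) + real n * E) + a1 / r * E * r\<^sup>2 + laplacian u x)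
    + B1 / r * (a * E * r\<^sup>2 + E)"
    by (simp only:)
  moreover have "(\<Sum>i\<in>UNIV. x $ i * pd i (euler u) x) = E + radial_hess u x"
    unfolding pd_euler(1)[OF U x(1)]
    by (simp add: distrib_left sum.distrib E_def euler_def radial_hess_def sum_distrib_left mult_ac)
  moreover have det: "sqrt (det (warped_metric h x)) = B * ((h r)\<^sup>2 / r\<^sup>2)"
    using det_warped_metric[OF x(2), of h] r
    by (simp add: r_def[symmetric] n k Bk power_add power2_eq_square)
  ultimately have LB: "laplace_beltrami (warped_metric h) u x =
    (B * (a * (E + radial_hess u x + real n * E) + a1 / r * E * r\<^sup>2 + laplacian u x)
    + B1 / r * (a * E * r\<^sup>2 + E)) / (B * ((h r)\<^sup>2 / r\<^sup>2))"
    unfolding laplace_beltrami_def det by (simp only:)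
  have B0: "B > 0" using r by (simp add: B_def warp_weight_def)
  have "(h r)\<^sup>2 * laplace_beltrami (warped_metric h) u x =
    r\<^sup>2 * (a * (E + radial_hess u x + real n * E) + a1 / r * E * r\<^sup>2 + laplacian u x
    + real k * (c r / h r - 1 / r) / r * (a * E * r\<^sup>2 + E))"
    unfolding LB B1_def using B0 r by (simp add: field_simps)
  also have "\<dots> = (r\<^sup>2 * a) * (E + radial_hess u x + real n * E) + r ^ 3 * a1 * E + r\<^sup>2 * laplacian u x
    + real k * (c r / h r - 1 / r) * r * (r\<^sup>2 * a + 1) * E"
    using r by (simp add: field_simps power2_eq_square power3_eq_cube)
  also have "r\<^sup>2 * a = (h r)\<^sup>2 / r\<^sup>2 - 1"
    using r by (simp add: a_def warp_defect_def field_simps eval_nat_numeral)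
  also have "r ^ 3 * a1 = 2 * h r * c r / r - 4 * (h r)\<^sup>2 / r\<^sup>2 + 2"
    using r by (simp add: a1_def field_simps eval_nat_numeral)
  also have "real k * (c r / h r - 1 / r) * r * ((h r)\<^sup>2 / r\<^sup>2 - 1 + 1) = real k * (h r * c r / r - (h r)\<^sup>2 / r\<^sup>2)"
    using r by (simp add: field_simps power2_eq_square)
  finally show ?thesis
    unfolding E_def[symmetric]
    by (rule trans) (use r in \<open>simp add: k field_simps power2_eq_square\<close>)
qed

text \<open>h has no quadratic term at 0, because h'' = c' = - \<kappa> h vanishes there.\<close>

lemma warp_defect_limit: "((\<lambda>t. (h t - t) / t\<^sup>2) \<longlongrightarrow> 0) (at_right 0)"
proof (rule lhopital_right_0)
  show "((\<lambda>t. (c t - 1) / (2 * t)) \<longlongrightarrow> 0) (at_right 0)"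
  proof -
    have "((\<lambda>t. (c t - c 0) / (t - 0)) \<longlongrightarrow> 0) (at 0)"
      using c_deriv[of 0] by (simp add: has_field_derivative_iff h_0)
    then have "((\<lambda>t. (c t - 1) / t / 2) \<longlongrightarrow> 0 / 2) (at_right 0)"
      by (intro tendsto_divide tendsto_const) (auto simp: c_0 intro: tendsto_within_subset)
    then show ?thesis by (simp add: mult.commute)
  qed
  show "((\<lambda>t. h t - t) \<longlongrightarrow> 0) (at_right 0)"
    using continuous_h[of UNIV] by (auto intro!: tendsto_eq_intros continuous_on_tendsto_compose[of UNIV h] simp: h_0)
  show "((\<lambda>t. t\<^sup>2) \<longlongrightarrow> 0) (at_right (0::real))"
    by (auto intro!: tendsto_eq_intros)
qed (auto intro!: eventually_at_right_less derivative_eq_intros h_deriv eventually_at_rightI[of 0 1])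

text \<open>Everything is expressed through D = (h - t) / t^2, which tends to 0: h / t = 1 + t D,
  the weight minus 1 is t D times a geometric sum, and the defect times t is D (h / t + 1).\<close>

lemma warp_weight_limits:
  shows "((\<lambda>t. warp_weight t) \<longlongrightarrow> 1) (at_right 0)"
    and "((\<lambda>t. (warp_weight t - 1) / t) \<longlongrightarrow> 0) (at_right 0)"
    and "((\<lambda>t. warp_defect t * t) \<longlongrightarrow> 0) (at_right 0)"
proof -
  let ?D = "\<lambda>t. (h t - t) / t\<^sup>2"
  have pos: "\<forall>\<^sub>F t in at_right (0::real). t > 0" by (simp add: eventually_at_right_less)
  have q: "((\<lambda>t. h t / t) \<longlongrightarrow> 1) (at_right 0)"
  proof -
    have "((\<lambda>t. 1 + t * ?D t) \<longlongrightarrow> 1 + 0 * 0) (at_right 0)"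
      by (intro tendsto_intros warp_defect_limit)
    then show ?thesis
      by (rule filterlim_cong[THEN iffD1, rotated -1])
        (use pos in \<open>auto elim!: eventually_mono simp: field_simps power2_eq_square\<close>)
  qed
  show "((\<lambda>t. warp_weight t) \<longlongrightarrow> 1) (at_right 0)"
    unfolding warp_weight_def using tendsto_power[OF q, of "n - 3"] by simp
  have "((\<lambda>t. ?D t * (\<Sum>j<n - 3. (h t / t) ^ j)) \<longlongrightarrow> 0 * (\<Sum>j<n - 3. 1 ^ j)) (at_right 0)"
    by (intro tendsto_intros warp_defect_limit q)
  then show "((\<lambda>t. (warp_weight t - 1) / t) \<longlongrightarrow> 0) (at_right 0)"
  proof (rule filterlim_cong[THEN iffD1, rotated -1])
    show "\<forall>\<^sub>F t in at_right 0. ?D t * (\<Sum>j<n - 3. (h t / t) ^ j) = (warp_weight t - 1) / t"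
      using pos
    proof eventually_elim
      case (elim t)
      have "warp_weight t - 1 = (h t / t - 1) * (\<Sum>j<n - 3. (h t / t) ^ j)"
        unfolding warp_weight_def by (rule power_diff_1_eq)
      then have "(warp_weight t - 1) / t = (h t / t - 1) / t * (\<Sum>j<n - 3. (h t / t) ^ j)" by simp
      also have "(h t / t - 1) / t = ?D t" using elim by (simp add: field_simps power2_eq_square)
      finally show ?case by simp
    qed
  qed auto
  have "((\<lambda>t. ?D t * (h t / t + 1)) \<longlongrightarrow> 0 * (1 + 1)) (at_right 0)"
    by (intro tendsto_intros warp_defect_limit q)
  then show "((\<lambda>t. warp_defect t * t) \<longlongrightarrow> 0) (at_right 0)"
    by (rule filterlim_cong[THEN iffD1, rotated -1])
      (use pos in \<open>auto elim!: eventually_mono simp: warp_defect_def field_simps eval_nat_numeral\<close>)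
qed

text \<open>Here the metric differs from the Euclidean one only by \<open>O(norm x ^ 2)\<close>, so that its first
  derivatives do not contribute at the centre.\<close>
lemma laplace_beltrami_0:
  fixes u :: "real^'n \<Rightarrow> real"
  assumes n: "CARD('n) = n" and L: "L > 0" and U: "open U" "C_k_on 2 U u" "0 \<in> U"
  shows "laplace_beltrami (warped_metric h) u 0 = laplacian u 0"
proof -
  have lim: "filterlim (norm :: real^'n \<Rightarrow> real) (at_right 0) (at 0)"
    by (auto simp: filterlim_at eventually_at_filter intro!: tendsto_norm_zero)
  have 0: "matrix_inv (warped_metric h (0::real^'n)) = mat 1"
    by (intro matrix_inv_eq) (simp add: warped_metric_def)
  have i: "pd i (\<lambda>y. sqrt (det (warped_metric h y)) * (\<Sum>j\<in>UNIV. matrix_inv (warped_metric h y) $ i $ j * pd j u y)) 0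
      = pd i (pd i u) 0" for i
  proof -
    \<comment> \<open>The flux is (1 + f) times the partial derivative plus g, where f and g have
      derivative 0 at the origin. Their value there is set by hand, since h(0) / 0 takes the default
      value 0.\<close>
    define f where "f y = (if y = 0 then 0 else warp_weight (norm y) - 1)" for y :: "real^'n"
    define g where "g y = (if y = 0 then 0 else warp_weight (norm y) * (warp_defect (norm y) * (y $ i * euler u y)))" for y :: "real^'n"
    have f: "(f has_derivative (\<lambda>v. 0)) (at 0)"
    proof (rule has_derivative_0I)
      show "((\<lambda>y. f y / norm y) \<longlongrightarrow> 0) (at 0)"
        using filterlim_compose[OF warp_weight_limits(2) lim]
        by (rule filterlim_cong[THEN iffD1, rotated -1]) (auto simp: f_def eventually_at_filter)
    qed (simp add: f_def)
    have g: "(g has_derivative (\<lambda>v. 0)) (at 0)"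
    proof (rule has_derivative_0I)
      let ?b = "\<lambda>y. warp_weight (norm y) * (warp_defect (norm y) * norm y)"
      show "((\<lambda>y. g y / norm y) \<longlongrightarrow> 0) (at 0)"
      proof (rule Lim_null_comparison)
        show "((\<lambda>y. \<bar>?b y\<bar> * (\<Sum>j\<in>UNIV. \<bar>pd j u y\<bar>)) \<longlongrightarrow> 0) (at 0)"
        proof -
          have "(pd j u \<longlongrightarrow> pd j u 0) (at 0)" for j
            using differentiable_imp_continuous_within[OF C_2D(2)[OF U]] by (simp add: continuous_at)
          then have "((\<lambda>y. \<bar>?b y\<bar> * (\<Sum>j\<in>UNIV. \<bar>pd j u y\<bar>)) \<longlongrightarrow> \<bar>1 * 0\<bar> * (\<Sum>j\<in>UNIV. \<bar>pd j u 0\<bar>)) (at 0)"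
            by (intro tendsto_intros filterlim_compose[OF warp_weight_limits(1) lim] filterlim_compose[OF warp_weight_limits(3) lim])
          then show ?thesis by simp
        qed
        \<comment> \<open>Both y_i and \<open>euler u y\<close> contribute a factor
          \<open>norm y\<close>; after the division one of them is left for the defect.\<close>
        have "norm (g y / norm y) \<le> \<bar>?b y\<bar> * (\<Sum>j\<in>UNIV. \<bar>pd j u y\<bar>)" if "y \<noteq> 0" for y
        proof -
          have "\<bar>euler u y\<bar> \<le> (\<Sum>j\<in>UNIV. norm y * \<bar>pd j u y\<bar>)"
            unfolding euler_def
            by (rule order_trans[OF sum_abs]) (auto intro!: sum_mono mult_right_mono simp: abs_mult component_le_norm_cart)
          then have "\<bar>y $ i\<bar> * \<bar>euler u y\<bar> \<le> norm y * (norm y * (\<Sum>j\<in>UNIV. \<bar>pd j u y\<bar>))"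
            by (intro mult_mono) (auto simp: component_le_norm_cart sum_distrib_left)
          then have "\<bar>warp_weight (norm y) * warp_defect (norm y)\<bar> * (\<bar>y $ i\<bar> * \<bar>euler u y\<bar>)
            \<le> \<bar>warp_weight (norm y) * warp_defect (norm y)\<bar> * (norm y * (norm y * (\<Sum>j\<in>UNIV. \<bar>pd j u y\<bar>)))"
            by (intro mult_left_mono) auto
          then show ?thesis
            using that by (simp add: g_def abs_mult field_simps)
        qed
        then show "\<forall>\<^sub>F y in at 0. norm (g y / norm y) \<le> \<bar>?b y\<bar> * (\<Sum>j\<in>UNIV. \<bar>pd j u y\<bar>)"
          by (auto simp: eventually_at_filter)
      qed
    qed (simp add: g_def)
    have "((\<lambda>y. (1 + f y) * pd i u y + g y) has_derivative (\<lambda>v. \<Sum>j\<in>UNIV. v $ j * pd j (pd i u) 0)) (at 0)"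
      using has_derivative_add[OF has_derivative_mult[OF has_derivative_add[OF has_derivative_const[of 1] f]
          has_derivative_pd[OF C_2D(2)[OF U]]] g, of i]
      by (simp add: f_def)
    then have "((\<lambda>y. sqrt (det (warped_metric h y)) * (\<Sum>j\<in>UNIV. matrix_inv (warped_metric h y) $ i $ j * pd j u y))
        has_derivative (\<lambda>v. \<Sum>j\<in>UNIV. v $ j * pd j (pd i u) 0)) (at 0)"
    proof (rule has_derivative_transform_within_open[of _ _ _ _ "ball 0 L"])
      fix y :: "real^'n" assume "y \<in> ball 0 L"
      then show "(1 + f y) * pd i u y + g y =
        sqrt (det (warped_metric h y)) * (\<Sum>j\<in>UNIV. matrix_inv (warped_metric h y) $ i $ j * pd j u y)"
      proof (cases "y = 0")
        case True
        have "(\<Sum>j\<in>UNIV. mat 1 $ i $ j * pd j u 0) = pd i u 0"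
          by (simp add: mat_def if_distrib[of "\<lambda>x. x * _"] cong: if_cong)
        then show ?thesis
          unfolding True 0 by (simp add: f_def g_def warped_metric_def)
      next
        case False
        with \<open>y \<in> ball 0 L\<close> show ?thesis
          by (subst flux_eq[OF n]) (auto simp: f_def g_def algebra_simps)
      qed
    qed (use L in auto)
    from pd_eq[OF this] show ?thesis
      by (simp add: axis_def if_distrib[of "\<lambda>x. x * _"] cong: if_cong)
  qed
  have "sqrt (det (warped_metric h (0::real^'n))) = 1" by (simp add: warped_metric_def)
  then show ?thesis unfolding laplace_beltrami_def i laplacian_def by simp
qed

end

subsection \<open>Integration over the unit sphere\<close>

text \<open>A cutoff applied to s = |x|^2, supported in the annulus 1 <= |x| <= 2 and so away from
  the singularity of x / |x|. The square makes it continuously differentiable.\<close>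

definition bump :: "real \<Rightarrow> real"
  where "bump s = (max 0 ((s - 1) * (4 - s)))\<^sup>2"

definition bump1 :: "real \<Rightarrow> real"
  where "bump1 s = 2 * max 0 ((s - 1) * (4 - s)) * (5 - 2 * s)"

lemma square_max_deriv: "((\<lambda>x::real. (max 0 x)\<^sup>2) has_real_derivative 2 * max 0 x) (at x)"
proof (cases x "0::real" rule: linorder_cases)
  case less
  have "((\<lambda>x::real. 0) has_real_derivative 0) (at x)" by simp
  then have "((\<lambda>x::real. (max 0 x)\<^sup>2) has_real_derivative 0) (at x)"
    by (rule has_field_derivative_transform_within_open[of _ _ _ "{..<0}"]) (use less in auto)
  then show ?thesis using less by simp
next
  case equal
  have "((\<lambda>y. ((max 0 y)\<^sup>2 - (max 0 0)\<^sup>2) / (y - 0)) \<longlongrightarrow> 0) (at (0::real))"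
  proof (rule Lim_null_comparison)
    show "\<forall>\<^sub>F y in at 0. norm (((max 0 y)\<^sup>2 - (max 0 0)\<^sup>2) / (y - 0)) \<le> \<bar>y\<bar>"
      by (auto simp: eventually_at_filter max_def power2_eq_square)
  qed (auto intro!: tendsto_eq_intros)
  then show ?thesis unfolding equal has_field_derivative_iff by simp
next
  case greater
  have "((\<lambda>x::real. x\<^sup>2) has_real_derivative 2 * x) (at x)" by (auto intro!: derivative_eq_intros)
  then have "((\<lambda>x::real. (max 0 x)\<^sup>2) has_real_derivative 2 * x) (at x)"
    by (rule has_field_derivative_transform_within_open[of _ _ _ "{0<..}"]) (use greater in auto)
  then show ?thesis using greater by simp
qed


lemma bump_deriv: "(bump has_real_derivative bump1 s) (at s)"
proof -
  have "((\<lambda>s. (s - 1) * (4 - s)) has_real_derivative 5 - 2 * s) (at s)"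
    by (auto intro!: derivative_eq_intros simp: algebra_simps)
  from DERIV_chain2[OF square_max_deriv this] show ?thesis
    by (simp add: bump_def[abs_def] bump1_def)
qed

lemma bump_zero: "s \<le> 1 \<or> s \<ge> 4 \<Longrightarrow> bump s = 0" "s \<le> 1 \<or> s \<ge> 4 \<Longrightarrow> bump1 s = 0"
proof -
  assume "s \<le> 1 \<or> s \<ge> 4"
  then have "(s - 1) * (4 - s) \<le> 0" by (auto intro: mult_nonpos_nonneg mult_nonneg_nonpos)
  then show "bump s = 0" "bump1 s = 0" by (simp_all add: bump_def bump1_def)
qed

lemma bump_pos: "1 < s \<Longrightarrow> s < 4 \<Longrightarrow> bump s > 0"
  by (simp add: bump_def)

lemma continuous_bump: "continuous_on A bump" "continuous_on A bump1"
  unfolding bump_def[abs_def] bump1_def[abs_def] by (intro continuous_intros)+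

text \<open>Half-side 3 holds the annulus of outer radius 2 with room for translations of length at
  most 1.\<close>

definition the_box :: "(real^'n) set"
  where "the_box = cbox (\<chi> i. - 3) (\<chi> i. 3)"

lemma norm_lt_3_in_box: "norm x < 3 \<Longrightarrow> x \<in> the_box"
  unfolding the_box_def mem_box_cart using component_le_norm_cart[of x]
  by (auto simp: abs_le_iff) (smt (verit))+

text \<open>Up to a factor, the integral over the unit sphere: the angular average over an annulus.\<close>
definition spint :: "(real^'n \<Rightarrow> real) \<Rightarrow> real"
  where "spint f = integral the_box (\<lambda>x. bump ((norm x)\<^sup>2) * f (x /\<^sub>R norm x))"

lemma normalized_in_sphere: "x \<noteq> 0 \<Longrightarrow> x /\<^sub>R norm x \<in> sphere 0 1"
  by simp

text \<open>x / |x| has no limit at 0, so continuity is glued from two closed pieces: the unit ball,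
  where the cutoff is 0, and its exterior. The parameter in \<open>U\<close> serves the
  differentiation of sphere integrals.\<close>

lemma continuous_cutoff:
  fixes H :: "'a::topological_space \<times> (real^'n) \<Rightarrow> real" and b :: "real \<Rightarrow> real"
  assumes "closed U" "continuous_on (U \<times> sphere 0 1) H"
    and "continuous_on UNIV b" "\<And>s. s \<le> 1 \<Longrightarrow> b s = 0"
  shows "continuous_on (U \<times> UNIV) (\<lambda>p. b ((norm (snd p))\<^sup>2) * H (fst p, snd p /\<^sub>R norm (snd p)))"
proof -
  let ?f = "\<lambda>p. b ((norm (snd p))\<^sup>2) * H (fst p, snd p /\<^sub>R norm (snd p))"
  let ?A = "U \<times> cball (0::real^'n) 1" and ?B = "U \<times> {x::real^'n. 1 \<le> norm x}"
  have nz[simp]: "1 \<le> norm y \<Longrightarrow> y \<noteq> 0" for y :: "real^'n" by auto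
  have "continuous_on ?A ?f"
  proof (subst continuous_on_cong[OF refl, where g = "\<lambda>p. 0"])
    fix p assume "p \<in> ?A"
    then have "(norm (snd p))\<^sup>2 \<le> 1" by (auto simp: power_le_one)
    then show "?f p = 0" by (simp add: assms(4))
  qed simp
  moreover have "continuous_on ?B ?f"
    by (intro continuous_on_mult continuous_on_compose2[OF assms(3)] continuous_on_compose2[OF assms(2)])
      (auto intro!: continuous_intros simp: left_inverse)
  moreover have "closed ?A" "closed ?B"
    using assms(1) by (auto intro!: closed_Times closed_Collect_le continuous_intros)
  ultimately have "continuous_on (?A \<union> ?B) ?f"
    by (intro continuous_on_closed_Un)
  moreover have "?A \<union> ?B = U \<times> UNIV" by auto
  ultimately show ?thesis by simp
qed

lemma continuous_cutoff':
  fixes f :: "real^'n \<Rightarrow> real" and b :: "real \<Rightarrow> real"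
  assumes "continuous_on (sphere 0 1) f"
    and "continuous_on UNIV b" "\<And>s. s \<le> 1 \<Longrightarrow> b s = 0"
  shows "continuous_on A (\<lambda>x. b ((norm x)\<^sup>2) * f (x /\<^sub>R norm x))"
proof -
  \<comment> \<open>The parameter set is a dummy singleton.\<close>
  have "continuous_on ({0} \<times> UNIV) (\<lambda>p::real \<times> (real^'n). b ((norm (snd p))\<^sup>2) * f (snd (fst p, snd p /\<^sub>R norm (snd p))))"
    by (rule continuous_cutoff[of "{0}" "\<lambda>p. f (snd p)" b])
      (use assms in \<open>auto intro!: continuous_on_compose2[OF assms(1)] continuous_intros\<close>)
  moreover have "continuous_on A (\<lambda>x. (0::real, x))" by (intro continuous_intros)
  ultimately have "continuous_on A (\<lambda>x. b ((norm (snd (0::real, x)))\<^sup>2) * f (snd (fst (0::real, x), snd (0::real, x) /\<^sub>R norm (snd (0::real, x)))))"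
    by (rule continuous_on_compose2) auto
  then show ?thesis by simp
qed

lemma spint_integrable:
  fixes f :: "real^'n \<Rightarrow> real"
  assumes "continuous_on (sphere 0 1) f"
  shows "(\<lambda>x. bump ((norm x)\<^sup>2) * f (x /\<^sub>R norm x)) integrable_on the_box"
  unfolding the_box_def
  by (intro integrable_continuous continuous_cutoff' assms continuous_bump) (simp add: bump_zero)

lemma spint_cong: "(\<And>x. x \<in> sphere 0 1 \<Longrightarrow> f x = g x) \<Longrightarrow> spint f = spint g"
  unfolding spint_def
  by (intro integral_cong) (metis bump_zero(1) mult_eq_0_iff norm_zero normalized_in_sphere power_zero_numeral zero_le_one)

lemma spint_add:
  assumes "continuous_on (sphere 0 1) f" "continuous_on (sphere 0 1) g"
  shows "spint (\<lambda>x. f x + g x) = spint f + spint g"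
  unfolding spint_def distrib_left by (intro integral_add spint_integrable assms)

lemma spint_cmult: "spint (\<lambda>x. a * f x) = a * spint f"
  unfolding spint_def by (subst integral_mult_right[symmetric]) (simp add: mult_ac)

lemma spint_diff:
  assumes "continuous_on (sphere 0 1) f" "continuous_on (sphere 0 1) g"
  shows "spint (\<lambda>x. f x - g x) = spint f - spint g"
  unfolding spint_def right_diff_distrib by (intro integral_diff spint_integrable assms)

lemma spint_0: "spint (\<lambda>x. 0) = 0"
  by (simp add: spint_def)

lemma spint_sum:
  assumes "\<And>i. i \<in> A \<Longrightarrow> continuous_on (sphere 0 1) (f i)"
  shows "spint (\<lambda>x. \<Sum>i\<in>A. f i x) = (\<Sum>i\<in>A. spint (f i))"
  using assms
  by (induction A rule: infinite_finite_induct) (auto simp: spint_0 spint_add continuous_on_sum)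

lemma spint_mono:
  assumes "continuous_on (sphere 0 1) f" "continuous_on (sphere 0 1) g"
    and "\<And>x. x \<in> sphere 0 1 \<Longrightarrow> f x \<le> g x"
  shows "spint f \<le> spint g"
  unfolding spint_def
proof (rule integral_le[OF spint_integrable[OF assms(1)] spint_integrable[OF assms(2)]])
  fix x :: "real^'a"
  have "bump ((norm x)\<^sup>2) \<ge> 0" by (simp add: bump_def)
  then show "bump ((norm x)\<^sup>2) * f (x /\<^sub>R norm x) \<le> bump ((norm x)\<^sup>2) * g (x /\<^sub>R norm x)"
    using assms(3)[of "x /\<^sub>R norm x"] by (cases "x = 0") (auto simp: bump_zero intro: mult_left_mono)
qed

lemma spint_abs_le:
  fixes f :: "real^'n \<Rightarrow> real"
  assumes "continuous_on (sphere 0 1) f" "\<And>x. x \<in> sphere 0 1 \<Longrightarrow> \<bar>f x\<bar> \<le> e"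
  shows "\<bar>spint f\<bar> \<le> e * spint (\<lambda>x::real^'n. 1)"
proof -
  have "spint f \<le> spint (\<lambda>x::real^'n. e * 1)"
    by (rule spint_mono) (use assms in \<open>force simp: abs_le_iff\<close>)+
  moreover have "spint (\<lambda>x::real^'n. - e * 1) \<le> spint f"
    by (rule spint_mono) (use assms in \<open>force simp: abs_le_iff\<close>)+
  ultimately show ?thesis unfolding spint_cmult by auto
qed

lemma spint_eq_0D:
  fixes f :: "real^'n \<Rightarrow> real"
  assumes f: "continuous_on (sphere 0 1) f" "\<And>x. x \<in> sphere 0 1 \<Longrightarrow> f x \<ge> 0" "spint f = 0"
    and x: "x \<in> sphere 0 1"
  shows "f x = 0"
proof -
  let ?g = "\<lambda>x. bump ((norm x)\<^sup>2) * f (x /\<^sub>R norm x)"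
  have "\<forall>x\<in>the_box. ?g x = 0"
    unfolding the_box_def
  proof (subst integral_cbox_eq_0_iff[symmetric])
    show "continuous_on (cbox (\<chi> i. - 3) (\<chi> i. 3)) ?g"
      by (intro continuous_cutoff' f continuous_bump) (simp add: bump_zero)
    show "box (\<chi> i. - 3) (\<chi> i. 3) \<noteq> ({} :: (real^'n) set)"
      using mem_box_cart[of "0::real^'n"] by fastforce
    show "integral (cbox (\<chi> i. - 3) (\<chi> i. 3)) ?g = 0"
      using f(3) by (simp add: spint_def the_box_def)
    fix y :: "real^'n"
    show "?g y \<ge> 0"
      using f(2)[of "y /\<^sub>R norm y"] by (cases "y = 0") (auto simp: bump_zero bump_def)
  qed
  \<comment> \<open>The radius 3/2 lies inside the annulus, where the cutoff is positive.\<close>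
  moreover have n: "norm ((3 / 2) *\<^sub>R x) = 3 / 2" using x by simp
  then have "(3 / 2) *\<^sub>R x \<in> the_box" by (intro norm_lt_3_in_box) simp
  ultimately have "bump ((3 / 2)\<^sup>2) * f x = 0"
    using n by force
  moreover have "bump ((3 / 2)\<^sup>2) > 0" by (rule bump_pos) (simp_all add: power2_eq_square)
  ultimately show ?thesis by simp
qed

lemma spint_has_derivative:
  fixes F :: "real \<Rightarrow> real^'n \<Rightarrow> real"
  assumes F: "\<And>s w. s \<in> {a..b} \<Longrightarrow> w \<in> sphere 0 1 \<Longrightarrow> ((\<lambda>s. F s w) has_real_derivative F' s w) (at s)"
    and cF: "\<And>s. s \<in> {a..b} \<Longrightarrow> continuous_on (sphere 0 1) (F s)"
    and cF': "continuous_on ({a..b} \<times> sphere 0 1) (\<lambda>(s, w). F' s w)"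
    and t: "a < t" "t < b"
  shows "((\<lambda>s. spint (F s)) has_real_derivative spint (F' t)) (at t)"
proof -
  have "((\<lambda>s. spint (F s)) has_real_derivative spint (F' t)) (at t within {a..b})"
    unfolding spint_def the_box_def
  proof (rule leibniz_rule_field_derivative)
    fix s :: real and x :: "real^'n" assume s: "s \<in> {a..b}"
    show "((\<lambda>s. bump ((norm x)\<^sup>2) * F s (x /\<^sub>R norm x)) has_real_derivative bump ((norm x)\<^sup>2) * F' s (x /\<^sub>R norm x))
      (at s within {a..b})"
      using F[OF s, of "x /\<^sub>R norm x"]
      by (cases "x = 0") (auto simp: bump_zero intro!: DERIV_cmult intro: has_field_derivative_at_within)
  next
    fix s :: real assume "s \<in> {a..b}"
    then show "(\<lambda>x. bump ((norm x)\<^sup>2) * F s (x /\<^sub>R norm x)) integrable_on cbox (\<chi> i. - 3) (\<chi> i. 3)"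
      using spint_integrable[OF cF] by (simp add: the_box_def)
  next
    show "continuous_on ({a..b} \<times> cbox (\<chi> i. - 3) (\<chi> i. 3)) (\<lambda>(s, x). bump ((norm x)\<^sup>2) * F' s (x /\<^sub>R norm x))"
      using continuous_cutoff[OF _ cF' continuous_bump(1)]
      by (auto simp: split_beta bump_zero elim: continuous_on_subset)
  qed (use t in auto)
  then show ?thesis
    using at_within_Icc_at[OF t] by simp
qed

lemma spint_continuous:
  fixes F :: "real \<Rightarrow> real^'n \<Rightarrow> real"
  assumes "continuous_on ({a..b} \<times> sphere 0 1) (\<lambda>(s, w). F s w)"
  shows "continuous_on {a..b} (\<lambda>s. spint (F s))"
  unfolding spint_def the_box_def
  by (rule integral_continuous_on_param)
    (use continuous_cutoff[OF _ assms continuous_bump(1)] in \<open>auto simp: split_beta bump_zero elim: continuous_on_subset\<close>)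

section \<open>Integration by parts for rotation fields\<close>

lemma integral_pd_0:
  fixes G :: "real^'n \<Rightarrow> real"
  assumes supp: "\<And>x. 2 \<le> norm x \<Longrightarrow> G x = 0"
    and d: "\<And>x. G differentiable at x" and c: "continuous_on UNIV (pd j G)"
  shows "integral the_box (pd j G) = 0"
proof -
  define e :: "real^'n" where "e = axis j 1"
  define a b :: "real^'n" where "a = (\<chi> i. - 3)" and "b = (\<chi> i. 3)"
  have ne: "norm e = 1" by (simp add: e_def)
  \<comment> \<open>A translation of length at most 1 keeps the support inside the box, so the
    integral is constant in t; its derivative at t = 0 is the integral in question.\<close>
  have inv: "integral the_box (\<lambda>x. G (t *\<^sub>R e + x)) = integral UNIV G" if t: "\<bar>t\<bar> \<le> 1" for t
  proof -
    have "integral (cbox a b) (G \<circ> ((+) (t *\<^sub>R e))) = integral (cbox (a + t *\<^sub>R e) (b + t *\<^sub>R e)) G"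
      by (rule integral_shift_cbox_plus)
    also have "\<dots> = integral UNIV (\<lambda>x. if x \<in> cbox (a + t *\<^sub>R e) (b + t *\<^sub>R e) then G x else 0)"
      by (rule integral_restrict_UNIV[symmetric])
    also have "(\<lambda>x. if x \<in> cbox (a + t *\<^sub>R e) (b + t *\<^sub>R e) then G x else 0) = G"
    proof
      fix x
      have "x \<in> cbox (a + t *\<^sub>R e) (b + t *\<^sub>R e)" if "norm x < 2"
      proof -
        have "norm (x - t *\<^sub>R e) < 3"
          using norm_triangle_ineq4[of x "t *\<^sub>R e"] that t ne by simp
        then have "x - t *\<^sub>R e \<in> cbox a b" using norm_lt_3_in_box by (auto simp: the_box_def a_def b_def)
        then show ?thesis by (auto simp: mem_box_cart algebra_simps)
      qed
      then show "(if x \<in> cbox (a + t *\<^sub>R e) (b + t *\<^sub>R e) then G x else 0) = G x"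
        using supp[of x] by (cases "norm x < 2") auto
    qed
    finally show ?thesis by (simp add: o_def the_box_def a_def b_def)
  qed
  have "((\<lambda>t. integral the_box (\<lambda>x. G (t *\<^sub>R e + x))) has_real_derivative integral the_box (\<lambda>x. pd j G (0 *\<^sub>R e + x))) (at 0 within {-1..1})"
    unfolding the_box_def
  proof (rule leibniz_rule_field_derivative)
    fix t :: real and x :: "real^'n"
    have "((\<lambda>t. G (t *\<^sub>R e + x)) has_derivative (\<lambda>s. frechet_derivative G (at (t *\<^sub>R e + x)) (s *\<^sub>R e))) (at t)"
      by (rule has_derivative_compose[where g = G])
        (use d in \<open>auto intro!: derivative_eq_intros simp: frechet_derivative_works\<close>)
    moreover have "(\<lambda>s. frechet_derivative G (at (t *\<^sub>R e + x)) (s *\<^sub>R e)) = (*) (pd j G (t *\<^sub>R e + x))"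
      using linear_frechet_derivative[OF d] by (auto simp: linear_cmul partial_deriv_def e_def)
    ultimately show "((\<lambda>t. G (t *\<^sub>R e + x)) has_real_derivative pd j G (t *\<^sub>R e + x)) (at t within {-1..1})"
      by (simp add: has_field_derivative_def has_derivative_at_withinI)
  next
    fix t :: real
    have "continuous_on UNIV G"
      using d by (simp add: continuous_at_imp_continuous_on differentiable_imp_continuous_within)
    then have "continuous_on A (\<lambda>x. G (t *\<^sub>R e + x))" for A
      by (rule continuous_on_compose2) (auto intro!: continuous_intros)
    then show "(\<lambda>x. G (t *\<^sub>R e + x)) integrable_on cbox (\<chi> i. - 3) (\<chi> i. 3)"
      by (rule integrable_continuous)
  next
    show "continuous_on ({-1..1} \<times> cbox (\<chi> i. - 3) (\<chi> i. 3)) (\<lambda>(t, x). pd j G (t *\<^sub>R e + x))"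
      unfolding split_beta by (rule continuous_on_compose2[OF c]) (auto intro!: continuous_intros)
  qed auto
  then have "((\<lambda>t. integral the_box (\<lambda>x. G (t *\<^sub>R e + x))) has_real_derivative integral the_box (pd j G)) (at 0)"
    by (simp add: at_within_Icc_at)
  moreover have "((\<lambda>t. integral the_box (\<lambda>x. G (t *\<^sub>R e + x))) has_real_derivative 0) (at 0)"
  proof (rule has_field_derivative_transform_within_open)
    show "((\<lambda>t. integral UNIV G) has_real_derivative 0) (at (0::real))" by simp
    show "integral UNIV G = integral the_box (\<lambda>x. G (t *\<^sub>R e + x))" if "t \<in> {-1<..<1}" for t
      using that by (intro inv[symmetric]) auto
  qed auto
  ultimately show ?thesis by (rule DERIV_unique)
qed

text \<open>The derivative of x / |x| is the projection orthogonal to x, divided by |x|; hence the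
  tangential part of the gradient.\<close>

lemma pd_normalized:
  fixes f :: "real^'n \<Rightarrow> real"
  assumes x: "x \<noteq> 0" and f: "f differentiable at (x /\<^sub>R norm x)"
  shows "(\<lambda>x. f (x /\<^sub>R norm x)) differentiable at x"
    and "pd j (\<lambda>x. f (x /\<^sub>R norm x)) x =
      (pd j f (x /\<^sub>R norm x) - (x $ j / norm x) * (\<Sum>l\<in>UNIV. (x $ l / norm x) * pd l f (x /\<^sub>R norm x))) / norm x"
proof -
  define w where "w = x /\<^sub>R norm x"
  have d: "((\<lambda>x::real^'n. x /\<^sub>R norm x) has_derivative (\<lambda>v. v /\<^sub>R norm x - ((v \<bullet> sgn x) / (norm x)\<^sup>2) *\<^sub>R x)) (at x)"
    using x by (auto intro!: derivative_eq_intros simp: has_derivative_norm power2_eq_square divide_inverse)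
  have e: "((\<lambda>x. f (x /\<^sub>R norm x)) has_derivative (\<lambda>v. \<Sum>l\<in>UNIV. (v /\<^sub>R norm x - ((v \<bullet> sgn x) / (norm x)\<^sup>2) *\<^sub>R x) $ l * pd l f w)) (at x)"
    using has_derivative_compose[where g = f, OF d has_derivative_pd[OF f]] by (simp add: w_def)
  then show "(\<lambda>x. f (x /\<^sub>R norm x)) differentiable at x"
    unfolding differentiable_def by blast
  have "pd j (\<lambda>x. f (x /\<^sub>R norm x)) x = (\<Sum>l\<in>UNIV. (if l = j then pd l f w / norm x else 0) - (x $ j / norm x) / norm x * ((x $ l / norm x) * pd l f w))"
    unfolding pd_eq[OF e]
  proof (intro sum.cong refl)
    fix l
    have i: "axis j 1 \<bullet> sgn x = x $ j / norm x"
      by (simp add: inner_axis' sgn_div_norm divide_inverse mult.commute)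
    show "(axis j 1 /\<^sub>R norm x - (axis j 1 \<bullet> sgn x / (norm x)\<^sup>2) *\<^sub>R x) $ l * pd l f w =
      (if l = j then pd l f w / norm x else 0) - (x $ j / norm x) / norm x * ((x $ l / norm x) * pd l f w)"
      unfolding i using x by (cases "l = j") (simp_all add: axis_def field_simps power2_eq_square)
  qed
  also have "\<dots> = (pd j f w - (x $ j / norm x) * (\<Sum>l\<in>UNIV. (x $ l / norm x) * pd l f w)) / norm x"
    unfolding sum_subtractf sum_distrib_left[symmetric] by (simp add: diff_divide_distrib)
  finally show "pd j (\<lambda>x. f (x /\<^sub>R norm x)) x =
      (pd j f (x /\<^sub>R norm x) - (x $ j / norm x) * (\<Sum>l\<in>UNIV. (x $ l / norm x) * pd l f (x /\<^sub>R norm x))) / norm x"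
    by (simp add: w_def)
qed

text \<open>The integrand is a difference of partial derivatives of compactly supported functions,
  so its integral vanishes by translation invariance.\<close>
lemma spint_rot:
  fixes f :: "real^'n \<Rightarrow> real"
  assumes U: "open U" "sphere 0 1 \<subseteq> U" and f: "C_k_on 1 U f"
  shows "spint (rot i j f) = 0"
proof -
  define F where "F x = bump ((norm x)\<^sup>2) * f (x /\<^sub>R norm x)" for x
  define P where "P k x = bump1 ((norm x)\<^sup>2) * f (x /\<^sub>R norm x) * (2 * x $ k)
    + bump ((norm x)\<^sup>2) * ((pd k f (x /\<^sub>R norm x) - ((x /\<^sub>R norm x) $ k) * euler f (x /\<^sub>R norm x))) * norm x / (norm x)\<^sup>2" for k x
  have df: "f differentiable at w" if "w \<in> sphere 0 1" for w
    using that U f by (intro C_k_on_differentiable[of U 0]) auto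
  have cf: "continuous_on (sphere 0 1) f" "continuous_on (sphere 0 1) (pd k f)" for k
    using f U(2) by (auto intro: continuous_on_subset differentiable_imp_continuous_on)
  have F: "F differentiable at x" "pd k F x = P k x" for x k
  proof -
    have "F differentiable at x \<and> pd k F x = P k x"
    proof (cases "norm x < 1")
      case True
      have z: "F y = 0" if "y \<in> ball 0 1" for y
        using that by (simp add: F_def bump_zero power_le_one)
      have "pd k F x = pd k (\<lambda>x. 0) x"
        by (rule pd_cong[of "ball 0 1"]) (use True z in auto)
      moreover have "P k x = 0" using True by (simp add: P_def bump_zero power_le_one)
      moreover have "(F has_derivative (\<lambda>v. 0)) (at x)"
        by (rule has_derivative_transform_within_open[of "\<lambda>x. 0" _ x UNIV "ball 0 1"])
          (use True z in auto)
      ultimately show ?thesis unfolding differentiable_def by (auto simp: pd_const)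
    next
      case False
      then have x: "x \<noteq> 0" by auto
      note n = pd_normalized[OF x df[OF normalized_in_sphere[OF x]]]
      note b = pd_chain[OF bump_deriv norm_square_differentiable]
      have "pd k F x = bump ((norm x)\<^sup>2) * pd k (\<lambda>x. f (x /\<^sub>R norm x)) x + pd k (\<lambda>x. bump ((norm x)\<^sup>2)) x * f (x /\<^sub>R norm x)"
        unfolding F_def[abs_def] by (rule pd_mult[OF b(2) n(1)])
      also have "\<dots> = P k x"
      proof -
        have "euler f (x /\<^sub>R norm x) = (\<Sum>l\<in>UNIV. (x $ l / norm x) * pd l f (x /\<^sub>R norm x))"
          by (simp add: euler_def divide_inverse mult_ac)
        then show ?thesis
          unfolding b(1) n(2) pd_norm_square P_def using x
          by (simp add: power2_eq_square divide_inverse mult_ac)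
      qed
      finally show ?thesis
        unfolding F_def[abs_def] by (intro conjI differentiable_mult b(2) n(1))
    qed
    then show "F differentiable at x" "pd k F x = P k x" by auto
  qed
  have cP: "continuous_on UNIV (P k)" for k
  proof -
    \<comment> \<open>On the support of the cutoff 1 / |x| equals 1 / sqrt (max 1 |x|^2), which is
      continuous everywhere and can be absorbed into the cutoff.\<close>
    have "continuous_on UNIV (\<lambda>x. bump1 ((norm x)\<^sup>2) * f (x /\<^sub>R norm x) * (2 * x $ k)
      + (bump ((norm x)\<^sup>2) / sqrt (max 1 ((norm x)\<^sup>2))) * (\<lambda>w. pd k f w - w $ k * euler f w) (x /\<^sub>R norm x))"
    proof (intro continuous_on_add continuous_on_mult[of _ "\<lambda>x. bump1 ((norm x)\<^sup>2) * f (x /\<^sub>R norm x)"] continuous_cutoff'[where b = bump1]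
        continuous_cutoff'[where b = "\<lambda>s. bump s / sqrt (max 1 s)"])
      show "continuous_on (sphere 0 1) (\<lambda>w. pd k f w - w $ k * euler f w)"
        unfolding euler_def by (intro continuous_intros cf)
      have "sqrt (max 1 s) \<noteq> 0" for s :: real by auto
      then show "continuous_on UNIV (\<lambda>s. bump s / sqrt (max 1 s))"
        by (intro continuous_intros continuous_bump) auto
    qed (auto simp: bump_zero intro!: cf continuous_bump continuous_intros)
    moreover have "P k x = bump1 ((norm x)\<^sup>2) * f (x /\<^sub>R norm x) * (2 * x $ k)
      + (bump ((norm x)\<^sup>2) / sqrt (max 1 ((norm x)\<^sup>2))) * (\<lambda>w. pd k f w - w $ k * euler f w) (x /\<^sub>R norm x)" for x
    proof (cases "norm x \<le> 1")
      case True
      then show ?thesis by (simp add: P_def bump_zero power_le_one)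
    next
      case False
      then have "max 1 ((norm x)\<^sup>2) = (norm x)\<^sup>2" by (simp add: max_def)
      then show ?thesis using False by (simp add: P_def power2_eq_square)
    qed
    then have e: "P k = (\<lambda>x. bump1 ((norm x)\<^sup>2) * f (x /\<^sub>R norm x) * (2 * x $ k)
      + (bump ((norm x)\<^sup>2) / sqrt (max 1 ((norm x)\<^sup>2))) * (\<lambda>w. pd k f w - w $ k * euler f w) (x /\<^sub>R norm x))"
      by (rule ext)
    ultimately show ?thesis unfolding e by iprover
  qed
  have cF: "continuous_on UNIV F"
    unfolding F_def by (intro continuous_cutoff' cf continuous_bump) (simp add: bump_zero)
  have G: "(\<lambda>x. x $ k * F x) differentiable at x" "pd l (\<lambda>x. x $ k * F x) x = x $ k * P l x + (if l = k then 1 else 0) * F x" for k l x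
    by (simp_all add: differentiable_mult nth_differentiable F pd_mult pd_nth)
  have cG: "continuous_on UNIV (pd l (\<lambda>x. x $ k * F x))" for k l
    unfolding G(2)[abs_def] using cP cF by (intro continuous_intros)
  have 0: "integral the_box (pd l (\<lambda>x. x $ k * F x)) = 0" for k l
  proof (rule integral_pd_0[OF _ G(1) cG])
    fix x :: "real^'n" assume "2 \<le> norm x"
    then have "(norm x)\<^sup>2 \<ge> 2\<^sup>2" by (intro power_mono) auto
    then show "x $ k * F x = 0" by (simp add: F_def bump_zero)
  qed
  \<comment> \<open>The parts of the gradient of \<open>F\<close> proportional to x cancel by
    antisymmetry, among them the derivative of the cutoff; so do the terms from differentiating the
    coordinates.\<close>
  have "pd j (\<lambda>x. x $ i * F x) x - pd i (\<lambda>x. x $ j * F x) x = bump ((norm x)\<^sup>2) * rot i j f (x /\<^sub>R norm x)" for x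
  proof (cases "x = 0")
    case False
    define w r B where "w = x /\<^sub>R norm x" and "r = norm x" and "B = bump ((norm x)\<^sup>2)"
    have r: "r \<noteq> 0" using False by (simp add: r_def)
    have xw: "x $ k = r * w $ k" for k using False by (simp add: w_def r_def)
    have P: "P k x = bump1 ((norm x)\<^sup>2) * f w * (2 * (r * w $ k)) + B * (pd k f w - w $ k * euler f w) / r" for k
      unfolding P_def xw[symmetric] using r by (simp add: w_def B_def r_def power2_eq_square)
    have "r * w $ i * P j x - r * w $ j * P i x = B * (w $ i * pd j f w - w $ j * pd i f w)"
      unfolding P using r by (simp add: field_simps)
    then show ?thesis
      unfolding G(2) rot_def w_def[symmetric] B_def[symmetric] unfolding xw by auto
  qed (auto simp: G P_def bump_zero)
  then have "spint (rot i j f) = integral the_box (\<lambda>x. pd j (\<lambda>x. x $ i * F x) x - pd i (\<lambda>x. x $ j * F x) x)"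
    by (simp add: spint_def)
  also have "\<dots> = integral the_box (pd j (\<lambda>x. x $ i * F x)) - integral the_box (pd i (\<lambda>x. x $ j * F x))"
    unfolding the_box_def by (intro integral_diff integrable_continuous continuous_on_subset[OF cG]) auto
  finally show ?thesis by (simp add: 0)
qed

lemma spint_rot_by_parts:
  fixes f g :: "real^'n \<Rightarrow> real"
  assumes U: "open U" "sphere 0 1 \<subseteq> U" and f: "C_k_on 1 U f" and g: "C_k_on 1 U g"
  shows "spint (\<lambda>x. rot i j f x * g x) = - spint (\<lambda>x. f x * rot i j g x)"
proof -
  have c: "continuous_on (sphere 0 1) h" if "C_k_on 0 U h" for h
    using that U(2) by (auto intro: continuous_on_subset)
  have "spint (\<lambda>x. f x * rot i j g x + rot i j f x * g x) = spint (rot i j (\<lambda>x. f x * g x))"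
    using U f g by (intro spint_cong) (subst rot_mult; auto intro!: C_k_on_differentiable[of U 0])
  also have "\<dots> = 0"
    by (rule spint_rot[OF U C_k_on_mult[OF U(1) f g]])
  also have "spint (\<lambda>x. f x * rot i j g x + rot i j f x * g x) = spint (\<lambda>x. f x * rot i j g x) + spint (\<lambda>x. rot i j f x * g x)"
    using f g U(1) by (intro spint_add c C_k_on_mult C_k_on_rot C_k_on_Suc_imp[of 0]) auto
  finally show ?thesis by simp
qed

text \<open>Two integrations by parts; summed over i and j this is the symmetry of the spherical
  Laplacian.\<close>

lemma spint_rot_rot:
  fixes f g :: "real^'n \<Rightarrow> real"
  assumes U: "open U" "sphere 0 1 \<subseteq> U" and f: "C_k_on 2 U f" and g: "C_k_on 2 U g"
  shows "spint (\<lambda>x. rot i j (rot i j f) x * g x) = spint (\<lambda>x. f x * rot i j (rot i j g) x)"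
proof -
  have 2: "C_k_on 1 U (rot i j f)" "C_k_on 1 U (rot i j g)" "C_k_on 1 U f" "C_k_on 1 U g"
    using f g U(1) C_k_on_Suc_imp[of 1 U] C_k_on_rot[of U 1] by (simp_all only: Suc_1)
  show ?thesis
    using spint_rot_by_parts[OF U 2(1,4), of i j] spint_rot_by_parts[OF U 2(3,2), of i j]
    by (simp only:)
qed

subsection \<open>Every eigenvalue comes from a radial solution\<close>

lemma spint_uniform_limit:
  fixes f :: "real^'n \<Rightarrow> real" and g :: "nat \<Rightarrow> real^'n \<Rightarrow> real"
  assumes f: "continuous_on (sphere 0 1) f" and g: "\<And>k. continuous_on (sphere 0 1) (g k)"
    and G: "continuous_on (sphere 0 1) G" and lim: "uniform_limit (sphere 0 1) g G sequentially"
    and 0: "\<And>k. spint (\<lambda>w. f w * g k w) = 0"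
  shows "spint (\<lambda>w. f w * G w) = 0"
proof -
  have "bounded (f ` sphere 0 1)"
    by (intro compact_imp_bounded compact_continuous_image f) simp
  then obtain K where K: "K > 0" "\<And>w. w \<in> sphere 0 1 \<Longrightarrow> \<bar>f w\<bar> \<le> K"
    unfolding bounded_pos by auto
  define C where "C = spint (\<lambda>w::real^'n. 1)"
  have *: "\<bar>spint (\<lambda>w. f w * G w)\<bar> \<le> e * (K * C)" if "e > 0" for e
  proof -
    from lim that have "\<forall>\<^sub>F k in sequentially. \<forall>w\<in>sphere 0 1. dist (g k w) (G w) < e"
      by (rule uniform_limitD)
    then obtain k where "\<forall>w\<in>sphere 0 1. dist (g k w) (G w) < e"
      unfolding eventually_sequentially by blast
    then have k: "\<bar>G w - g k w\<bar> < e" if "w \<in> sphere 0 1" for w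
      using that by (simp add: dist_real_def abs_minus_commute)
    have "spint (\<lambda>w. f w * G w) = spint (\<lambda>w. f w * G w - f w * g k w)"
      by (subst spint_diff) (auto simp: 0 intro!: continuous_intros f g G)
    also have "\<dots> = spint (\<lambda>w. f w * (G w - g k w))"
      by (simp only: right_diff_distrib)
    also have "\<bar>\<dots>\<bar> \<le> (K * e) * C"
      unfolding C_def
    proof (rule spint_abs_le)
      fix w :: "real^'n" assume w: "w \<in> sphere 0 1"
      show "\<bar>f w * (G w - g k w)\<bar> \<le> K * e"
        unfolding abs_mult using K(1) by (intro mult_mono K(2)[OF w] less_imp_le[OF k[OF w]]) auto
    qed (intro continuous_intros f g G)
    finally show ?thesis by (simp add: mult_ac)
  qed
  have "\<bar>spint (\<lambda>w. f w * G w)\<bar> \<le> 0"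
  proof (rule field_le_epsilon)
    fix e :: real assume e: "e > 0"
    \<comment> \<open>The summand 1 in the denominator avoids a division by a possibly vanishing K
      C.\<close>
    have "\<bar>spint (\<lambda>w. f w * G w)\<bar> \<le> e / (\<bar>K * C\<bar> + 1) * (K * C)"
      by (rule *) (use e in \<open>auto intro!: divide_pos_pos\<close>)
    also have "\<dots> \<le> e / (\<bar>K * C\<bar> + 1) * (\<bar>K * C\<bar> + 1)"
      using e by (intro mult_left_mono) auto
    also have "\<dots> = e" by (simp add: add_nonneg_eq_0_iff)
    finally show "\<bar>spint (\<lambda>w. f w * G w)\<bar> \<le> 0 + e" by simp
  qed
  then show ?thesis by simp
qed

text \<open>Exponentials of linear forms are uniform limits of power sums, and a product of two is
  again one, so their span is an algebra. It approximates \<open>f\<close> itself by functions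
  orthogonal to \<open>f\<close>; thus the integral of f^2 vanishes.\<close>

lemma spint_power_sums_imp_0:
  fixes f :: "real^'n \<Rightarrow> real"
  assumes f: "continuous_on (sphere 0 1) f" and 0: "\<And>k \<xi>. spint (\<lambda>w. f w * (w \<bullet> \<xi>) ^ k) = 0"
    and w: "w \<in> sphere 0 1"
  shows "f w = 0"
proof -
  define E :: "(real^'n \<Rightarrow> real) \<Rightarrow> bool"
    where "E g \<longleftrightarrow> (\<exists>I c \<xi>. finite (I :: nat set) \<and> g = (\<lambda>w. \<Sum>i\<in>I. c i * exp (w \<bullet> \<xi> i)))" for g
  have E_cont: "continuous_on (sphere 0 1) g" if "E g" for g
    using that unfolding E_def by (auto intro!: continuous_intros)
  have exp0: "spint (\<lambda>w. f w * exp (w \<bullet> \<xi>)) = 0" for \<xi>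
  proof (rule spint_uniform_limit[OF f])
    show "uniform_limit (sphere 0 1) (\<lambda>k w. \<Sum>i<k. (w \<bullet> \<xi>) ^ i /\<^sub>R fact i) (\<lambda>w. exp (w \<bullet> \<xi>)) sequentially"
      unfolding exp_def
    proof (rule Weierstrass_m_test)
      fix i and w :: "real^'n" assume "w \<in> sphere 0 1"
      then have "\<bar>w \<bullet> \<xi>\<bar> \<le> norm \<xi>" using Cauchy_Schwarz_ineq2[of w \<xi>] by simp
      then show "norm ((w \<bullet> \<xi>) ^ i /\<^sub>R fact i) \<le> norm \<xi> ^ i /\<^sub>R fact i"
        by (auto simp: abs_mult power_abs intro!: mult_left_mono power_mono)
    qed (rule summable_exp_generic)
    fix k
    show "continuous_on (sphere 0 1) (\<lambda>w. \<Sum>i<k. (w \<bullet> \<xi>) ^ i /\<^sub>R fact i)"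
      by (intro continuous_intros)
    have "spint (\<lambda>w. f w * (\<Sum>i<k. (w \<bullet> \<xi>) ^ i /\<^sub>R fact i)) = spint (\<lambda>w. \<Sum>i<k. inverse (fact i) * (f w * (w \<bullet> \<xi>) ^ i))"
      by (simp add: sum_distrib_left mult_ac)
    also have "\<dots> = (\<Sum>i<k. spint (\<lambda>w. inverse (fact i) * (f w * (w \<bullet> \<xi>) ^ i)))"
      by (intro spint_sum continuous_intros f)
    also have "\<dots> = 0" by (simp add: spint_cmult 0)
    finally show "spint (\<lambda>w. f w * (\<Sum>i<k. (w \<bullet> \<xi>) ^ i /\<^sub>R fact i)) = 0" .
  qed (intro continuous_intros)
  have E0: "spint (\<lambda>w. f w * g w) = 0" if "E g" for g
  proof -
    from that obtain I c \<xi> where g: "finite (I :: nat set)" "g = (\<lambda>w. \<Sum>i\<in>I. c i * exp (w \<bullet> \<xi> i))"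
      unfolding E_def by auto
    have "spint (\<lambda>w. f w * g w) = spint (\<lambda>w. \<Sum>i\<in>I. c i * (f w * exp (w \<bullet> \<xi> i)))"
      by (simp add: g(2) sum_distrib_left mult_ac)
    also have "\<dots> = (\<Sum>i\<in>I. spint (\<lambda>w. c i * (f w * exp (w \<bullet> \<xi> i))))"
      by (intro spint_sum continuous_intros f)
    also have "\<dots> = 0" by (simp add: spint_cmult exp0)
    finally show ?thesis .
  qed
  have E_term: "E (\<lambda>w. c * exp (w \<bullet> \<xi>))" for c \<xi>
    unfolding E_def by (rule exI[of _ "{0}"]) (auto intro!: exI[of _ "\<lambda>_. c"] exI[of _ "\<lambda>_. \<xi>"])
  \<comment> \<open>Sums and products of two members are indexed by pairs;
    \<open>prod_encode\<close> returns to the natural numbers used in \<open>E\<close>.\<close>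
  have E_sum: "E (\<lambda>w. \<Sum>j\<in>J. d j * exp (w \<bullet> \<eta> j))" if "finite J" for J :: "(nat \<times> nat) set" and d \<eta>
  proof -
    define I where "I = prod_encode ` J"
    have "(\<Sum>j\<in>J. d j * exp (w \<bullet> \<eta> j)) = (\<Sum>i\<in>I. d (prod_decode i) * exp (w \<bullet> \<eta> (prod_decode i)))" for w
      unfolding I_def by (subst sum.reindex) (auto simp: inj_prod_encode)
    moreover have "finite I" using that by (simp add: I_def)
    ultimately show ?thesis
      unfolding E_def by (auto intro!: exI[of _ I] exI[of _ "\<lambda>i. d (prod_decode i)"] exI[of _ "\<lambda>i. \<eta> (prod_decode i)"])
  qed
  have E_add: "E (\<lambda>w. g w + g' w)" if "E g" "E g'" for g g'
  proof -
    from that obtain I c \<xi> J d \<eta> where g: "finite (I :: nat set)" "g = (\<lambda>w. \<Sum>i\<in>I. c i * exp (w \<bullet> \<xi> i))"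
      and g': "finite (J :: nat set)" "g' = (\<lambda>w. \<Sum>i\<in>J. d i * exp (w \<bullet> \<eta> i))"
      unfolding E_def by auto
    define e where "e j = (if fst j = 0 then c (snd j) else d (snd j))" for j :: "nat \<times> nat"
    define z where "z j = (if fst j = 0 then \<xi> (snd j) else \<eta> (snd j))" for j :: "nat \<times> nat"
    have single: "(\<Sum>j\<in>{a} \<times> A. F j) = (\<Sum>i\<in>A. F (a, i))" for a :: nat and A :: "nat set" and F :: "_ \<Rightarrow> real"
      using sum.cartesian_product[of "\<lambda>a i. F (a, i)" A "{a}"] by simp
    have "g w + g' w = (\<Sum>j\<in>{0} \<times> I \<union> {1} \<times> J. e j * exp (w \<bullet> z j))" for w
      using g g' by (subst sum.union_disjoint) (auto simp: single e_def z_def)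
    then show ?thesis using E_sum[of "{0} \<times> I \<union> {1} \<times> J" e z] g(1) g'(1) by simp
  qed
  have E_mult: "E (\<lambda>w. g w * g' w)" if "E g" "E g'" for g g'
  proof -
    from that obtain I c \<xi> J d \<eta> where g: "finite (I :: nat set)" "g = (\<lambda>w. \<Sum>i\<in>I. c i * exp (w \<bullet> \<xi> i))"
      and g': "finite (J :: nat set)" "g' = (\<lambda>w. \<Sum>i\<in>J. d i * exp (w \<bullet> \<eta> i))"
      unfolding E_def by auto
    have "g w * g' w = (\<Sum>j\<in>I \<times> J. (c (fst j) * d (snd j)) * exp (w \<bullet> (\<xi> (fst j) + \<eta> (snd j))))" for w
      by (simp add: g(2) g'(2) sum_product sum.cartesian_product exp_add inner_add_right mult_ac split_beta)
    then show ?thesis using E_sum[of "I \<times> J"] g(1) g'(1) by simp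
  qed
  have approx: "\<exists>g. E g \<and> (\<forall>x\<in>sphere 0 1. \<bar>f x - g x\<bar> < e)" if "e > 0" for e
  proof (rule Stone_Weierstrass_HOL[OF _ _ E_cont])
    show "E (\<lambda>x. c)" for c using E_term[of c 0] by simp
    \<comment> \<open>The direction x - y separates x from y, because their inner products with it
      differ by |x - y|^2.\<close>
    show "\<exists>g. E g \<and> g x \<noteq> g y" if "x \<in> sphere 0 1 \<and> y \<in> sphere 0 1 \<and> x \<noteq> y" for x y
    proof (intro exI conjI)
      show "E (\<lambda>w. 1 * exp (w \<bullet> (x - y)))" by (rule E_term)
      have "(x - y) \<bullet> (x - y) \<noteq> 0" using that by simp
      then show "1 * exp (x \<bullet> (x - y)) \<noteq> 1 * exp (y \<bullet> (x - y))" by (simp add: inner_diff_left)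
    qed
  qed (use E_add E_mult f that in auto)
  have "\<forall>k. \<exists>g. E g \<and> (\<forall>x\<in>sphere 0 1. \<bar>f x - g x\<bar> < inverse (real (Suc k)))"
    using approx by simp
  then obtain g where g: "\<And>k. E (g k)" "\<And>k x. x \<in> sphere 0 1 \<Longrightarrow> \<bar>f x - g k x\<bar> < inverse (real (Suc k))"
    by metis
  have "spint (\<lambda>w. f w * f w) = 0"
  proof (rule spint_uniform_limit[where g = g, OF f _ f])
    show "continuous_on (sphere 0 1) (g k)" for k by (rule E_cont[OF g(1)])
    show "spint (\<lambda>w. f w * g k w) = 0" for k by (rule E0[OF g(1)])
    show "uniform_limit (sphere 0 1) g f sequentially"
    proof (rule uniform_limitI)
      fix e :: real assume "e > 0"
      then have "\<forall>\<^sub>F k in sequentially. inverse (real (Suc k)) < e"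
        using LIMSEQ_inverse_real_of_nat by (rule order_tendstoD(2)[rotated])
      then show "\<forall>\<^sub>F k in sequentially. \<forall>x\<in>sphere 0 1. dist (g k x) (f x) < e"
      proof eventually_elim
        case (elim k)
        then show ?case
          using less_trans[OF g(2) elim] by (simp add: dist_real_def abs_minus_commute)
      qed
    qed
  qed
  then have "f w * f w = 0"
    by (intro spint_eq_0D[of "\<lambda>w. f w * f w"] w continuous_intros f) auto
  then show ?thesis by simp
qed

section \<open>Averages against powers of linear forms\<close>

lemma spint_sum2:
  assumes "\<And>i j. continuous_on (sphere 0 1) (F i j)"
  shows "spint (\<lambda>x. \<Sum>i\<in>A. \<Sum>j\<in>B. F i j x) = (\<Sum>i\<in>A. \<Sum>j\<in>B. spint (F i j))"
  using assms by (simp add: spint_sum continuous_on_sum)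

lemma pd_inner_power:
  "pd i (\<lambda>x::real^'n. a * (x \<bullet> \<xi>) ^ k) x = (a * real k * \<xi> $ i) * (x \<bullet> \<xi>) ^ (k - 1)"
  "(\<lambda>x::real^'n. a * (x \<bullet> \<xi>) ^ k) differentiable at x"
proof -
  have d: "((\<lambda>x::real^'n. a * (x \<bullet> \<xi>) ^ k) has_derivative (\<lambda>v. a * (real k * (v \<bullet> \<xi>) * (x \<bullet> \<xi>) ^ (k - 1)))) (at x)"
    by (auto intro!: derivative_eq_intros)
  show "pd i (\<lambda>x::real^'n. a * (x \<bullet> \<xi>) ^ k) x = (a * real k * \<xi> $ i) * (x \<bullet> \<xi>) ^ (k - 1)"
    unfolding pd_eq[OF d] by (simp add: inner_axis')
  show "(\<lambda>x::real^'n. a * (x \<bullet> \<xi>) ^ k) differentiable at x"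
    using d unfolding differentiable_def by blast
qed

lemma C_k_on_inner_power: "C_k_on j UNIV (\<lambda>x::real^'n. (x \<bullet> \<xi>) ^ k)"
  unfolding inner_vec_def by (intro C_k_on_power C_k_on_sum C_k_on_mult C_k_on_const) (auto simp: C_k_on_nth C_k_on_const intro!: C_k_on_mult)

text \<open>These powers are homogeneous but not harmonic: the Laplacian leaves a power of degree k
  - 2, which forces the induction on k in \<open>steklov_complete\<close>.\<close>

lemma inner_power_operators:
  fixes x \<xi> :: "real^'n" and k :: nat
  defines "p \<equiv> \<lambda>x. (x \<bullet> \<xi>) ^ k"
  shows "euler p x = real k * p x"
    and "radial_hess p x = real k * (real k - 1) * p x"
    and "laplacian p x = real k * (real k - 1) * (norm \<xi>)\<^sup>2 * (x \<bullet> \<xi>) ^ (k - 2)"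
proof -
  have 1: "pd i p = (\<lambda>x. (real k * \<xi> $ i) * (x \<bullet> \<xi>) ^ (k - 1))" for i
    using pd_inner_power(1)[of i 1 \<xi> k] by (simp add: p_def fun_eq_iff)
  have 2: "pd i (pd j p) x = (real k * \<xi> $ j * real (k - 1) * \<xi> $ i) * (x \<bullet> \<xi>) ^ (k - 2)" for i j x
    unfolding 1 pd_inner_power by (simp add: numeral_2_eq_2)
  have s: "(\<Sum>i\<in>UNIV. x $ i * \<xi> $ i) = x \<bullet> \<xi>" by (simp add: inner_vec_def)
  show "euler p x = real k * p x"
  proof -
    have "euler p x = (\<Sum>i\<in>UNIV. x $ i * \<xi> $ i) * (real k * (x \<bullet> \<xi>) ^ (k - 1))"
      unfolding euler_def 1 by (subst sum_distrib_right) (simp add: mult_ac)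
    then show ?thesis unfolding s by (cases k) (auto simp: p_def)
  qed
  show "radial_hess p x = real k * (real k - 1) * p x"
  proof -
    have "radial_hess p x = (\<Sum>i\<in>UNIV. \<Sum>j\<in>UNIV. (x $ i * \<xi> $ i) * (x $ j * \<xi> $ j)) * (real k * real (k - 1) * (x \<bullet> \<xi>) ^ (k - 2))"
      unfolding radial_hess_def 2 by (simp only: sum_distrib_right) (simp only: mult_ac)
    also have "\<dots> = (x \<bullet> \<xi>) * (x \<bullet> \<xi>) * (real k * real (k - 1) * (x \<bullet> \<xi>) ^ (k - 2))"
      unfolding s[symmetric] sum_product ..
    also have "\<dots> = real k * (real k - 1) * p x"
    proof (cases "k \<ge> 2")
      case True
      then obtain j where "k = j + 2" by (metis le_add_diff_inverse2)
      then show ?thesis by (simp add: p_def)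
    next
      case False
      then have "k = 0 \<or> k = 1" by linarith
      then show ?thesis by auto
    qed
    finally show ?thesis .
  qed
  have "laplacian p x = (\<Sum>i\<in>UNIV. \<xi> $ i * \<xi> $ i) * (real k * real (k - 1) * (x \<bullet> \<xi>) ^ (k - 2))"
    unfolding laplacian_def 2 by (subst sum_distrib_right) (simp add: mult_ac)
  also have "\<dots> = real k * (real k - 1) * (norm \<xi>)\<^sup>2 * (x \<bullet> \<xi>) ^ (k - 2)"
    unfolding norm_square_sum by (cases k) auto
  finally show "laplacian p x = real k * (real k - 1) * (norm \<xi>)\<^sup>2 * (x \<bullet> \<xi>) ^ (k - 2)" .
qed

lemma rot_dilate:
  fixes f :: "real^'n \<Rightarrow> real"
  assumes "f differentiable at (r *\<^sub>R x)"
  shows "rot i j (\<lambda>x. f (r *\<^sub>R x)) x = rot i j f (r *\<^sub>R x)"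
  by (simp add: rot_def pd_dilate(1)[OF assms])

text \<open>Rotation fields commute with dilations, so angular derivatives of \<open>u\<close> on
  the sphere of radius r can be taken on the unit sphere.\<close>

lemma rot_rot_dilate:
  fixes f :: "real^'n \<Rightarrow> real"
  assumes "open U" "C_k_on 2 U f" "r *\<^sub>R x \<in> U"
  shows "rot i j (rot i j (\<lambda>x. f (r *\<^sub>R x))) x = rot i j (rot i j f) (r *\<^sub>R x)"
proof -
  have o: "open ((*\<^sub>R) r -` U)"
    by (intro continuous_open_vimage assms(1)) (auto intro!: continuous_intros)
  have "pd l (rot i j (\<lambda>x. f (r *\<^sub>R x))) x = pd l (\<lambda>x. rot i j f (r *\<^sub>R x)) x" for l
    by (rule pd_cong[OF o]) (use assms in \<open>auto intro!: rot_dilate C_2D\<close>)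
  then have "rot i j (rot i j (\<lambda>x. f (r *\<^sub>R x))) x = rot i j (\<lambda>x. rot i j f (r *\<^sub>R x)) x"
    by (simp only: rot_def[of i j "rot i j (\<lambda>x. f (r *\<^sub>R x))" x] rot_def[of i j "\<lambda>x. rot i j f (r *\<^sub>R x)" x])
  also have "\<dots> = rot i j (rot i j f) (r *\<^sub>R x)"
    using assms
    by (intro rot_dilate C_k_on_differentiable[OF assms(1) C_k_on_rot[of U "Suc 0"]])
      (simp_all only: numeral_2_eq_2)
  finally show ?thesis .
qed

context warping
begin

text \<open>Completeness of the radial values in contrapositive form. Harmonicity enters through the
  polar form, hence away from the centre; the centre is recovered by continuity.\<close>

lemma steklov_complete:
  fixes u :: "real^'n \<Rightarrow> real"
  assumes n: "CARD('n) = n" and R: "0 < R" "R < L"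
    and U: "open U" "cball 0 R \<subseteq> U" "C_k_on 2 U u"
    and harm: "\<And>x. x \<in> ball 0 R \<Longrightarrow> x \<noteq> 0 \<Longrightarrow> laplace_beltrami (warped_metric h) u x = 0"
    and bdry: "\<And>x. norm x = R \<Longrightarrow> euler u x = R * \<sigma> * u x"
    and \<sigma>: "\<And>k. \<sigma> \<noteq> steklov k R"
    and x: "x \<in> cball 0 R"
  shows "u x = 0"
proof -
  define u1 where "u1 r w = (\<Sum>i\<in>UNIV. w $ i * pd i u (r *\<^sub>R w))" for r w
  define u2 where "u2 r w = (\<Sum>i\<in>UNIV. \<Sum>j\<in>UNIV. w $ i * w $ j * pd i (pd j u) (r *\<^sub>R w))" for r w
  define B0 where "B0 \<xi> k r = spint (\<lambda>w. u (r *\<^sub>R w) * (w \<bullet> \<xi>) ^ k)" for \<xi> k r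
  define B1 where "B1 \<xi> k r = spint (\<lambda>w. u1 r w * (w \<bullet> \<xi>) ^ k)" for \<xi> k r
  define B2 where "B2 \<xi> k r = spint (\<lambda>w. u2 r w * (w \<bullet> \<xi>) ^ k)" for \<xi> k r
  have rw: "r *\<^sub>R w \<in> U" if "r \<in> {0..R}" "w \<in> sphere 0 1" for r and w :: "real^'n"
    using that U(2) by (auto simp: subset_iff)
  have c: "continuous_on U u" "continuous_on U (pd i u)" "continuous_on U (pd i (pd j u))" for i j
    using U(3) by (auto simp: numeral_2_eq_2 intro: differentiable_imp_continuous_on)
  have cray: "continuous_on ({0..R} \<times> sphere 0 1) (\<lambda>p. f (fst p *\<^sub>R snd p))" if "continuous_on U f" for f :: "real^'n \<Rightarrow> real"
    by (rule continuous_on_compose2[OF that]) (use rw in \<open>auto intro!: continuous_intros\<close>)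
  have cj: "continuous_on ({0..R} \<times> sphere 0 1) (\<lambda>(r, w). u (r *\<^sub>R w) * (w \<bullet> \<xi>) ^ k)"
    "continuous_on ({0..R} \<times> sphere 0 1) (\<lambda>(r, w). u1 r w * (w \<bullet> \<xi>) ^ k)"
    "continuous_on ({0..R} \<times> sphere 0 1) (\<lambda>(r, w). u2 r w * (w \<bullet> \<xi>) ^ k)" for \<xi> k
    unfolding split_beta u1_def u2_def by (intro continuous_intros cray c)+
  have slice: "continuous_on (sphere 0 1) (\<lambda>w. f r w)" if "continuous_on ({0..R} \<times> sphere 0 1) (\<lambda>(r, w). f r w)" "r \<in> {0..R}"
    for r and f :: "real \<Rightarrow> real^'n \<Rightarrow> real"
  proof -
    have "continuous_on (sphere 0 1) (\<lambda>w. (\<lambda>(r, w). f r w) (r, w))"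
      by (rule continuous_on_compose2[OF that(1)]) (use that(2) in \<open>auto intro!: continuous_intros\<close>)
    then show ?thesis by simp
  qed
  have dB0: "(B0 \<xi> k has_real_derivative B1 \<xi> k r) (at r)" if "0 < r" "r < R" for \<xi> k r
    unfolding B0_def B1_def
    by (rule spint_has_derivative[OF _ slice[OF cj(1)] cj(2) that])
      (unfold u1_def, intro DERIV_cmult_right ray_deriv C_2D[OF U(1,3)] rw)
  have dB1: "(B1 \<xi> k has_real_derivative B2 \<xi> k r) (at r)" if "0 < r" "r < R" for \<xi> k r
    unfolding B1_def B2_def
    by (rule spint_has_derivative[OF _ slice[OF cj(2)] cj(3) that])
      (unfold u1_def u2_def, intro DERIV_cmult_right ray_deriv2[OF U(1,3)] rw)
  have cB: "continuous_on {0..R} (B0 \<xi> k)" "continuous_on {0..R} (B1 \<xi> k)" for \<xi> k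
    unfolding B0_def[abs_def] B1_def[abs_def] by (intro spint_continuous cj)+
  have BR: "B1 \<xi> k R = \<sigma> * B0 \<xi> k R" for \<xi> k
  proof -
    have "u1 R w = \<sigma> * u (R *\<^sub>R w)" if "w \<in> sphere 0 1" for w
    proof -
      have "R * u1 R w = euler u (R *\<^sub>R w)" by (simp add: u1_def euler_def sum_distrib_left mult_ac)
      also have "\<dots> = R * \<sigma> * u (R *\<^sub>R w)" using that R by (intro bdry) auto
      finally show ?thesis using R by simp
    qed
    then have "B1 \<xi> k R = spint (\<lambda>w. \<sigma> * (u (R *\<^sub>R w) * (w \<bullet> \<xi>) ^ k))"
      unfolding B1_def by (intro spint_cong) (simp add: mult_ac)
    then show ?thesis by (simp add: spint_cmult B0_def)
  qed
  \<comment> \<open>The spherical Laplacian is moved from \<open>u\<close> onto the power of the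
    linear form, which it reproduces up to the term of degree k - 2.\<close>
  have ode: "(h r)\<^sup>2 * B2 \<xi> k r + (real n - 1) * h r * c r * B1 \<xi> k r =
      lam k * B0 \<xi> k r - real k * (real k - 1) * (norm \<xi>)\<^sup>2 * B0 \<xi> (k - 2) r"
    if r: "0 < r" "r < R" for \<xi> k r
  proof -
    define p where "p w = (w \<bullet> \<xi>) ^ k" for w :: "real^'n"
    define f where "f w = u (r *\<^sub>R w)" for w
    define V where "V = (*\<^sub>R) r -` U"
    have rR: "r \<in> {0..R}" using r by simp
    have V: "open V" "sphere 0 1 \<subseteq> V"
      unfolding V_def using rw[OF rR]
      by (auto intro!: continuous_open_vimage U(1) continuous_intros)
    have f: "C_k_on 2 V f" unfolding V_def f_def by (rule C_k_on_dilate[OF U(1,3)])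
    have p: "C_k_on 2 V p" unfolding p_def by (rule C_k_on_subset[OF C_k_on_inner_power]) simp
    have cp: "continuous_on (sphere 0 1) p" unfolding p_def by (intro continuous_intros)
    have c0: "continuous_on (sphere 0 1) g" if "C_k_on 0 V g" for g
      using that V(2) by (auto intro: continuous_on_subset)
    have crr: "continuous_on (sphere 0 1) (rot i j (rot i j f))" for i j
      using f by (intro c0 C_k_on_rot V(1)) (simp add: numeral_2_eq_2)
    have crp: "continuous_on (sphere 0 1) (rot i j (rot i j p))" for i j
      using p by (intro c0 C_k_on_rot V(1)) (simp add: numeral_2_eq_2)
    have cf: "continuous_on (sphere 0 1) f"
      using f by (intro c0) (auto simp: numeral_2_eq_2 intro: differentiable_imp_continuous_on)
    \<comment> \<open>By harmonicity the radial part is minus the spherical Laplacian; the factor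
      1/2 undoes the double counting of planes.\<close>
    have pt: "(h r)\<^sup>2 * u2 r w + (real n - 1) * h r * c r * u1 r w = - (1 / 2) * (\<Sum>i\<in>UNIV. \<Sum>j\<in>UNIV. rot i j (rot i j f) w)"
      if w: "w \<in> sphere 0 1" for w
    proof -
      let ?x = "r *\<^sub>R w"
      have x: "norm ?x = r" "?x \<noteq> 0" "?x \<in> U" "?x \<in> ball 0 R"
        using w r rw[OF rR w] by auto
      have e: "euler u ?x = r * u1 r w" by (simp add: u1_def euler_def sum_distrib_left mult_ac)
      have hs: "radial_hess u ?x = r\<^sup>2 * u2 r w"
        by (simp add: u2_def radial_hess_def sum_distrib_left mult_ac power2_eq_square)
      define Z where "Z = r\<^sup>2 * laplacian u ?x - radial_hess u ?x - (real n - 1) * euler u ?x"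
      have "(h r)\<^sup>2 * (radial_hess u ?x / r\<^sup>2) + (real n - 1) * h r * c r * (euler u ?x / r) + Z = 0"
        unfolding Z_def using laplace_beltrami_away[OF n U(1,3) x(3,2)] x(1) r R harm[OF x(4,2)] by simp
      moreover have "(\<Sum>i\<in>UNIV. \<Sum>j\<in>UNIV. rot i j (rot i j f) w) =
        2 * Z"
        unfolding Z_def f_def rot_rot_dilate[OF U(1,3) x(3)] rot_rot_sum[OF U(1,3) x(3)] x(1) n ..
      ultimately show ?thesis using r by (simp add: hs e)
    qed
    have pp: "(\<Sum>i\<in>UNIV. \<Sum>j\<in>UNIV. rot i j (rot i j p) w) = 2 * (real k * (real k - 1) * (norm \<xi>)\<^sup>2 * (w \<bullet> \<xi>) ^ (k - 2) - lam k * p w)"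
      if w: "w \<in> sphere 0 1" for w
    proof -
      have "w \<in> V" using w V(2) by blast
      from rot_rot_sum[OF V(1) p this] show ?thesis
        using w unfolding p_def inner_power_operators n
        by (simp add: lam_def algebra_simps)
    qed
    have "(h r)\<^sup>2 * B2 \<xi> k r + (real n - 1) * h r * c r * B1 \<xi> k r =
      spint (\<lambda>w. (h r)\<^sup>2 * (u2 r w * p w) + ((real n - 1) * h r * c r) * (u1 r w * p w))"
      unfolding B2_def B1_def p_def
      by (subst spint_add) (auto simp: spint_cmult intro!: continuous_intros slice[OF cj(2) rR] slice[OF cj(3) rR])
    also have "\<dots> = spint (\<lambda>w. - (1 / 2) * (\<Sum>i\<in>UNIV. \<Sum>j\<in>UNIV. rot i j (rot i j f) w * p w))"
    proof (rule spint_cong)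
      fix w :: "real^'n" assume "w \<in> sphere 0 1"
      have "(h r)\<^sup>2 * (u2 r w * p w) + ((real n - 1) * h r * c r) * (u1 r w * p w)
        = ((h r)\<^sup>2 * u2 r w + (real n - 1) * h r * c r * u1 r w) * p w" by (simp add: algebra_simps)
      then show "(h r)\<^sup>2 * (u2 r w * p w) + ((real n - 1) * h r * c r) * (u1 r w * p w) =
        - (1 / 2) * (\<Sum>i\<in>UNIV. \<Sum>j\<in>UNIV. rot i j (rot i j f) w * p w)"
        unfolding pt[OF \<open>w \<in> sphere 0 1\<close>] by (simp add: sum_distrib_right)
    qed
    also have "\<dots> = - (1 / 2) * (\<Sum>i\<in>UNIV. \<Sum>j\<in>UNIV. spint (\<lambda>w. rot i j (rot i j f) w * p w))"
      unfolding spint_cmult by (subst spint_sum2) (intro continuous_intros crr cp refl)+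
    also have "\<dots> = - (1 / 2) * (\<Sum>i\<in>UNIV. \<Sum>j\<in>UNIV. spint (\<lambda>w. f w * rot i j (rot i j p) w))"
      unfolding spint_rot_rot[OF V f p] ..
    also have "\<dots> = spint (\<lambda>w. - (1 / 2) * (\<Sum>i\<in>UNIV. \<Sum>j\<in>UNIV. f w * rot i j (rot i j p) w))"
      unfolding spint_cmult by (subst spint_sum2) (intro continuous_intros crp cf refl)+
    also have "\<dots> = spint (\<lambda>w. lam k * (f w * p w) - (real k * (real k - 1) * (norm \<xi>)\<^sup>2) * (f w * (w \<bullet> \<xi>) ^ (k - 2)))"
    proof (rule spint_cong)
      fix w :: "real^'n" assume w: "w \<in> sphere 0 1"
      have "(\<Sum>i\<in>UNIV. \<Sum>j\<in>UNIV. f w * rot i j (rot i j p) w) = f w * (\<Sum>i\<in>UNIV. \<Sum>j\<in>UNIV. rot i j (rot i j p) w)"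
        by (simp add: sum_distrib_left)
      then show "- (1 / 2) * (\<Sum>i\<in>UNIV. \<Sum>j\<in>UNIV. f w * rot i j (rot i j p) w) =
        lam k * (f w * p w) - (real k * (real k - 1) * (norm \<xi>)\<^sup>2) * (f w * (w \<bullet> \<xi>) ^ (k - 2))"
        unfolding pp[OF w] by (simp add: algebra_simps)
    qed
    also have "\<dots> = lam k * B0 \<xi> k r - real k * (real k - 1) * (norm \<xi>)\<^sup>2 * B0 \<xi> (k - 2) r"
      unfolding B0_def p_def f_def[symmetric]
      by (subst spint_diff) (auto simp: spint_cmult intro!: continuous_intros cf)
    finally show ?thesis .
  qed
  have zero: "B0 \<xi> k r = 0" if "0 < r" "r \<le> R" for \<xi> k r
    using that
  proof (induction k arbitrary: r rule: less_induct)
    case (less k)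
    \<comment> \<open>For k = 0 and k = 1 the index \<open>k - 2\<close> is truncated, but the
      coefficient k (k - 1) is 0.\<close>
    have z: "real k * (real k - 1) * B0 \<xi> (k - 2) s = 0" if "0 < s" "s < R" for s
    proof (cases "k \<ge> 2")
      case True
      then show ?thesis using less.IH[of "k - 2" s] that by simp
    next
      case False
      then have "k = 0 \<or> k = 1" by linarith
      then show ?thesis by auto
    qed
    have ode': "(h s)\<^sup>2 * B2 \<xi> k s + (real n - 1) * h s * c s * B1 \<xi> k s = lam k * B0 \<xi> k s" if s: "0 < s" "s < R" for s
    proof -
      have e: "real k * (real k - 1) * (norm \<xi>)\<^sup>2 * B0 \<xi> (k - 2) s = (norm \<xi>)\<^sup>2 * (real k * (real k - 1) * B0 \<xi> (k - 2) s)"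
        by (simp only: mult_ac)
      show ?thesis using ode[OF s, of \<xi> k] unfolding e z[OF s] by simp
    qed
    let ?W = "\<lambda>r. h r ^ (n - 1) * (B1 \<xi> k r * radial k r - B0 \<xi> k r * radial1 k r)"
    \<comment> \<open>Both functions solve the equation with the same \<open>lam k\<close>, so the
      weighted Wronskian keeps its value 0 at the centre.\<close>
    have W: "?W s = 0" if "0 < s" "s \<le> R" for s
    proof -
      have "?W s = ?W 0"
      proof (rule DERIV_isconst2[OF R(1)])
        show "continuous_on {0..R} ?W"
          using R by (intro continuous_intros continuous_h continuous_radial cB)
        fix t assume t: "0 < t" "t < R"
        show "(?W has_real_derivative 0) (at t)"
          using wronskian_deriv[OF _ _ dB0[OF t] dB1[OF t] ode'[OF t], of k] t R by simp
      qed (use that in auto)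
      then show ?thesis using n3 by (simp add: h_0)
    qed
    have W': "B1 \<xi> k s * radial k s - B0 \<xi> k s * radial1 k s = 0" if "0 < s" "s \<le> R" for s
      using W[OF that] h_pos[of s] that R by simp
    have aR: "radial k R > 0" using radial_pos[of R k] R by simp
    \<comment> \<open>With the boundary condition \<open>BR\<close>, the vanishing Wronskian at R
      leaves the average times the gap between \<sigma> and the radial value.\<close>
    have "B0 \<xi> k R * (\<sigma> - steklov k R) = 0"
      using W'[of R] R aR unfolding BR steklov_def by (simp add: field_simps)
    then have B0R: "B0 \<xi> k R = 0" using \<sigma>[of k] by simp
    show ?case
    proof (cases "r = R")
      case False
      then have rR: "r < R" using less.prems by simp
      have pos: "radial k s > 0" if "r \<le> s" "s \<le> R" for s
        using radial_pos[of s k] that less.prems R by simp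
      \<comment> \<open>A vanishing Wronskian means a constant quotient, which carries the zero at R
        inwards.\<close>
      have "B0 \<xi> k R / radial k R = B0 \<xi> k r / radial k r"
      proof (rule DERIV_isconst_end[OF rR])
        show "continuous_on {r..R} (\<lambda>r. B0 \<xi> k r / radial k r)"
          using less.prems R pos
          by (intro continuous_on_divide continuous_on_subset[OF cB(1)] continuous_on_subset[OF continuous_radial(1)]) force+
        fix s assume s: "r < s" "s < R"
        then have s': "0 < s" "0 \<le> s" "s < L" "s \<le> R" using less.prems R by auto
        show "((\<lambda>r. B0 \<xi> k r / radial k r) has_real_derivative 0) (at s)"
          by (rule DERIV_cong[OF DERIV_divide[OF dB0[OF s'(1) s(2)] radial_deriv(1)[OF s'(2,3)]]])
            (use W'[OF s'(1,4)] pos[of s] s in auto)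
      qed
      then show ?thesis using B0R pos[of r] rR by simp
    qed (simp add: B0R)
  qed
  have nz: "u y = 0" if y: "y \<in> cball 0 R" "y \<noteq> 0" for y
  proof -
    define r where "r = norm y"
    have r: "0 < r" "r \<le> R" using y by (auto simp: r_def)
    have "u (r *\<^sub>R (y /\<^sub>R norm y)) = 0"
    proof (rule spint_power_sums_imp_0[where f = "\<lambda>w. u (r *\<^sub>R w)"])
      show "spint (\<lambda>w. u (r *\<^sub>R w) * (w \<bullet> \<xi>) ^ k) = 0" for k \<xi>
        using zero[OF r] by (simp add: B0_def)
      show "continuous_on (sphere 0 1) (\<lambda>w. u (r *\<^sub>R w))"
        using slice[OF cj(1)[of 0 0], of r] r by simp
    qed (rule normalized_in_sphere[OF y(2)])
    then show ?thesis using y by (simp add: r_def)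
  qed
  show ?thesis
  proof (cases "x = 0")
    case True
    have "(u \<longlongrightarrow> u 0) (at 0)"
      using c(1) U R by (auto simp: continuous_on_eq_continuous_at continuous_at subset_iff)
    moreover have "\<forall>\<^sub>F y in at 0. u y = 0"
      unfolding eventually_at using nz R by (intro exI[of _ R]) auto
    then have "(u \<longlongrightarrow> 0) (at 0)" by (rule tendsto_eventually)
    ultimately show ?thesis unfolding True by (rule tendsto_unique[OF at_neq_bot])
  qed (use nz x in auto)
qed

end

subsection \<open>Eigenfunctions from radial solutions\<close>

lemma Re_of_real_mult: "Re (of_real a * z) = a * Re z"
  by simp

lemma cancel_inverse: "r \<noteq> 0 \<Longrightarrow> r * (inverse r * a * b) = a * (b::real)"
  by (simp add: mult.assoc[symmetric])

lemma pd_Re_linear_power: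
  assumes "bounded_linear f"
  shows "pd i (\<lambda>x. Re (\<alpha> * f x ^ k)) x = Re (\<alpha> * of_nat k * f (axis i 1) * f x ^ (k - 1))"
    and "(\<lambda>x. Re (\<alpha> * f x ^ k)) differentiable at x"
proof -
  have f: "(f has_derivative f) (at x)"
    using assms by (rule bounded_linear.has_derivative[OF _ has_derivative_ident])
  have d: "((\<lambda>x. Re (\<alpha> * f x ^ k)) has_derivative (\<lambda>v. Re (\<alpha> * (of_nat k * f v * f x ^ (k - 1))))) (at x)"
    by (intro has_derivative_Re has_derivative_mult_right has_derivative_power f)
  show "pd i (\<lambda>x. Re (\<alpha> * f x ^ k)) x = Re (\<alpha> * of_nat k * f (axis i 1) * f x ^ (k - 1))"
    unfolding pd_eq[OF d] by (simp only: mult.assoc)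
  show "(\<lambda>x. Re (\<alpha> * f x ^ k)) differentiable at x"
    using d unfolding differentiable_def by blast
qed

text \<open>The complex coefficient \<alpha> makes the class closed under partial derivatives, which
  the induction on the order requires.\<close>

lemma C_k_on_Re_linear_power:
  assumes "bounded_linear f"
  shows "C_k_on j (UNIV :: (real^'n) set) (\<lambda>x. Re (\<alpha> * f x ^ k))"
proof (induction j arbitrary: \<alpha> k)
  case 0
  show ?case
    using pd_Re_linear_power(2)[OF assms]
    by (auto intro!: continuous_at_imp_continuous_on differentiable_imp_continuous_within)
next
  case (Suc j)
  show ?case
  proof (rule C_k_on_SucI)
    fix i :: 'n
    have "pd i (\<lambda>x. Re (\<alpha> * f x ^ k)) = (\<lambda>x. Re (\<alpha> * of_nat k * f (axis i 1) * f x ^ (k - 1)))"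
      by (rule ext) (rule pd_Re_linear_power(1)[OF assms])
    then show "C_k_on j UNIV (pd i (\<lambda>x. Re (\<alpha> * f x ^ k)))"
      by (simp only: Suc)
  qed (rule open_UNIV pd_Re_linear_power(2)[OF assms])+
qed

text \<open>The source of a harmonic polynomial of each degree: the Laplacian of f^k is k (k - 1)
  f^(k-2) times the sum of the squares of the coefficients of f, which is 0 for an isotropic linear
  form.\<close>

lemma isotropic_power_operators:
  fixes f :: "real^'n \<Rightarrow> complex" and k :: nat
  assumes f: "bounded_linear f" and iso: "(\<Sum>i\<in>UNIV. (f (axis i 1))\<^sup>2) = 0"
  defines "p \<equiv> \<lambda>x. Re (f x ^ k)"
  shows "euler p x = real k * p x"
    and "radial_hess p x = real k * (real k - 1) * p x"
    and "laplacian p x = 0"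
    and "C_k_on j UNIV p"
proof -
  interpret bounded_linear f by (rule f)
  have 1: "pd i p = (\<lambda>x. Re ((of_nat k * f (axis i 1)) * f x ^ (k - 1)))" for i
    using pd_Re_linear_power(1)[OF f, of i 1 k] by (simp add: p_def fun_eq_iff)
  have 2: "pd i (pd j p) x = Re (f (axis i 1) * f (axis j 1) * (of_nat k * of_nat (k - 1) * f x ^ (k - 2)))" for i j x
    unfolding 1 pd_Re_linear_power(1)[OF f] by (simp add: numeral_2_eq_2 mult_ac)
  have s: "(\<Sum>i\<in>UNIV. of_real (x $ i) * f (axis i 1)) = f x"
  proof -
    have "x = (\<Sum>i\<in>UNIV. x $ i *\<^sub>R axis i 1)"
      by (simp add: basis_expansion flip: scalar_mult_eq_scaleR)
    then have "f x = f (\<Sum>i\<in>UNIV. x $ i *\<^sub>R axis i 1)" by simp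
    then have "f x = (\<Sum>i\<in>UNIV. x $ i *\<^sub>R f (axis i 1))" by (simp only: sum scaleR)
    then show ?thesis by (simp only: scaleR_conv_of_real)
  qed
  show "euler p x = real k * p x"
  proof -
    have "euler p x = Re ((\<Sum>i\<in>UNIV. of_real (x $ i) * f (axis i 1)) * (of_nat k * f x ^ (k - 1)))"
      unfolding euler_def 1 sum_distrib_right Re_sum
      by (intro sum.cong refl) (simp add: mult.assoc mult.left_commute[of _ "of_nat k"])
    also have "\<dots> = Re (of_nat k * (f x * f x ^ (k - 1)))" unfolding s by (simp only: mult_ac)
    also have "\<dots> = real k * p x" by (cases k) (auto simp: p_def)
    finally show ?thesis .
  qed
  show "radial_hess p x = real k * (real k - 1) * p x"
  proof -
    have "radial_hess p x = Re ((\<Sum>i\<in>UNIV. \<Sum>j\<in>UNIV. (of_real (x $ i) * f (axis i 1)) * (of_real (x $ j) * f (axis j 1)))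
        * (of_nat k * of_nat (k - 1) * f x ^ (k - 2)))"
      unfolding radial_hess_def 2 sum_distrib_right Re_sum
    proof (intro sum.cong refl)
      fix i j
      show "x $ i * x $ j * Re (f (axis i 1) * f (axis j 1) * (of_nat k * of_nat (k - 1) * f x ^ (k - 2))) =
        Re ((of_real (x $ i) * f (axis i 1)) * (of_real (x $ j) * f (axis j 1)) * (of_nat k * of_nat (k - 1) * f x ^ (k - 2)))"
        unfolding of_real_mult[symmetric] Re_of_real_mult[symmetric] by (simp only: of_real_mult mult_ac)
    qed
    also have "\<dots> = Re (f x * f x * (of_nat k * of_nat (k - 1) * f x ^ (k - 2)))"
      unfolding sum_product[symmetric] s ..
    also have "\<dots> = real k * (real k - 1) * p x"
    proof (cases "k \<ge> 2")
      case True
      then obtain j where j: "k = j + 2" by (metis le_add_diff_inverse2)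
      have "f x * f x * (of_nat k * of_nat (k - 1) * f x ^ (k - 2)) = of_real (real k * (real k - 1)) * f x ^ k"
        unfolding j by (simp add: mult_ac)
      then show ?thesis by (simp only: p_def Re_of_real_mult)
    next
      case False
      then have "k = 0 \<or> k = 1" by linarith
      then show ?thesis by auto
    qed
    finally show ?thesis .
  qed
  have "laplacian p x = Re ((\<Sum>i\<in>UNIV. (f (axis i 1))\<^sup>2) * (of_nat k * of_nat (k - 1) * f x ^ (k - 2)))"
    unfolding laplacian_def 2 sum_distrib_right Re_sum by (simp only: power2_eq_square)
  then show "laplacian p x = 0" by (simp add: iso)
  show "C_k_on j UNIV p" using C_k_on_Re_linear_power[OF f, of j 1 k] by (simp add: p_def)
qed

text \<open>\<open>F\<close> and \<open>G\<close> list all derivatives of \<open>h(r) / r\<close> and \<open>h'(r)\<close> as functions of \<open>r\<^sup>2\<close>.\<close>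

locale analytic_warping = warping +
  fixes F G :: "nat \<Rightarrow> real \<Rightarrow> real"
  assumes h_eq: "h r = r * F 0 (r\<^sup>2)" and c_eq: "c r = G 0 (r\<^sup>2)"
    and F_deriv: "(F j has_real_derivative F (Suc j) z) (at z)"
    and G_deriv: "(G j has_real_derivative G (Suc j) z) (at z)"
begin

text \<open>The j-th derivative of the profile, in the form that \<open>C_k_on_compose\<close>
  takes: each differentiation contributes the next factor of a rising factorial.\<close>

definition profile_derivs :: "nat \<Rightarrow> nat \<Rightarrow> real \<Rightarrow> real"
  where "profile_derivs k j z = (if k = 0 then (if j = 0 then 1 else 0)
    else pochhammer (real (k + n - 1)) j * euler_integral (k - 1 + j) (n - 2) (k + n - 1 + j) z)"

lemma profile_derivs_deriv:
  assumes "z < 1"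
  shows "(profile_derivs k j has_real_derivative profile_derivs k (Suc j) z) (at z)"
proof (cases "k = 0")
  case False
  then show ?thesis
    using DERIV_cmult[OF euler_integral_deriv[OF assms, of "k - 1 + j" "n - 2" "k + n - 1 + j"], of "pochhammer (real (k + n - 1)) j"]
    by (simp add: profile_derivs_def[abs_def] pochhammer_Suc algebra_simps)
qed (simp add: profile_derivs_def[abs_def])

lemma profile_derivs_0: "profile_derivs k 0 = profile k"
  by (auto simp: profile_derivs_def profile_def)

text \<open>\<open>radial k r\<close> divided by r^k, as a function of s = r^2. The norm is not
  smooth at the origin but its square is, and r^k goes into the harmonic polynomial.\<close>

definition radial_factor :: "nat \<Rightarrow> real \<Rightarrow> real"
  where "radial_factor k s = F 0 s ^ k * profile k ((1 - G 0 s) / 2)"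

lemma profile_arg_less_1:
  fixes x :: "real^'n"
  assumes "x \<in> ball 0 L"
  shows "(1 - G 0 ((norm x)\<^sup>2)) / 2 < 1"
  using half_less_1[of "norm x"] assms by (simp add: c_eq)

lemma C_k_on_radial_factor: "C_k_on j (ball (0::real^'n) L) (\<lambda>x. radial_factor k ((norm x)\<^sup>2))"
proof -
  have F: "C_k_on j (ball (0::real^'n) L) (\<lambda>x. F 0 ((norm x)\<^sup>2))"
    and G: "C_k_on j (ball (0::real^'n) L) (\<lambda>x. G 0 ((norm x)\<^sup>2))"
    by (rule C_k_on_compose[where F = F] C_k_on_compose[where F = G];
        intro open_ball F_deriv G_deriv C_k_on_norm_square)+
  have "C_k_on j (ball (0::real^'n) L) (\<lambda>x. (1 / 2) * (1 - G 0 ((norm x)\<^sup>2)))"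
    by (intro C_k_on_mult C_k_on_diff C_k_on_const G open_ball)
  then have "C_k_on j (ball (0::real^'n) L) (\<lambda>x. (1 - G 0 ((norm x)\<^sup>2)) / 2)"
    by simp
  then have "C_k_on j (ball (0::real^'n) L) (\<lambda>x. profile_derivs k 0 ((1 - G 0 ((norm x)\<^sup>2)) / 2))"
    by (intro C_k_on_compose[where F = "profile_derivs k"] open_ball profile_derivs_deriv profile_arg_less_1)
  then show ?thesis
    unfolding radial_factor_def profile_derivs_0
    by (intro C_k_on_mult C_k_on_power F open_ball)
qed

lemma radial_factor_deriv:
  fixes x :: "real^'n"
  assumes "x \<in> ball 0 L"
  obtains d where "(radial_factor k has_real_derivative d) (at ((norm x)\<^sup>2))"
proof -
  have "((\<lambda>s. (1 - G 0 s) / 2) has_real_derivative - G 1 ((norm x)\<^sup>2) / 2) (at ((norm x)\<^sup>2))"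
    using G_deriv[of 0] by (auto intro!: derivative_eq_intros)
  from DERIV_mult[OF DERIV_power[OF F_deriv[of 0]] DERIV_chain2[OF profile_deriv(1)[OF profile_arg_less_1[OF assms]] this], of k k]
  show ?thesis by (intro that) (simp add: radial_factor_def[abs_def])
qed

lemma radial_factor_eq: "r ^ k * radial_factor k (r\<^sup>2) = radial k r"
  by (simp add: radial_factor_def radial_def h_eq c_eq power_mult_distrib)

lemma steklov_exists:
  assumes n: "CARD('n) = n" and R: "0 < R" "R < L"
  shows "steklov_eigenvalue (warped_metric h :: real^'n \<Rightarrow> real^'n^'n) (cball 0 R) (steklov k R)"
proof -
  \<comment> \<open>The form x_a + i x_b with two different coordinates is isotropic, since 1 + i^2
    = 0.\<close>
  have "card {a} \<noteq> CARD('n)" for a :: 'n using n n3 by simp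
  then obtain a b :: 'n where ab: "a \<noteq> b" by (metis UNIV_eq_I singleton_iff)
  define f where "f x = complex_of_real (x $ a) + \<i> * complex_of_real (x $ b)" for x :: "real^'n"
  have f: "bounded_linear f"
    unfolding f_def by (intro bounded_linear_add bounded_linear_const_mult bounded_linear_compose[OF bounded_linear_of_real] bounded_linear_vec_nth)
  interpret f: bounded_linear f by (rule f)
  have iso: "(\<Sum>i\<in>UNIV. (f (axis i 1))\<^sup>2) = 0"
  proof -
    have "(f (axis i 1))\<^sup>2 = (if i = a then 1 else 0) + (if i = b then -1 else 0)" for i
      using ab by (auto simp: f_def axis_def)
    then show ?thesis by (simp add: sum.distrib)
  qed
  define p where "p x = Re (f x ^ k)" for x
  note ops = isotropic_power_operators[OF f iso, where k = k, folded p_def]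
  have p_hom: "p (r *\<^sub>R w) = r ^ k * p w" for r w
    unfolding p_def f.scaleR unfolding scaleR_conv_of_real power_mult_distrib of_real_power[symmetric] Re_of_real_mult ..
  define g where "g x = radial_factor k ((norm x)\<^sup>2)" for x :: "real^'n"
  define u where "u x = p x * g x" for x
  define U where "U = ball (0::real^'n) L"
  have U: "open U" "cball 0 R \<subseteq> U" using R by (auto simp: U_def)
  have Cp: "C_k_on j U p" for j by (rule C_k_on_subset[OF ops(4)]) simp
  have Cg: "C_k_on j U g" for j unfolding g_def U_def by (rule C_k_on_radial_factor)
  have Cu: "C_k_on j U u" for j unfolding u_def by (intro C_k_on_mult U Cp Cg)
  have ray: "u (r *\<^sub>R w) = radial k r * p w" if "w \<in> sphere 0 1" for r w
    using that by (simp add: u_def g_def p_hom mult_ac flip: radial_factor_eq)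
  have u1: "(\<Sum>i\<in>UNIV. w $ i * pd i u (r *\<^sub>R w)) = radial1 k r * p w"
    if w: "w \<in> sphere 0 1" and r: "0 < r" "r < L" for r w
  proof (rule DERIV_unique)
    have "r *\<^sub>R w \<in> U" using w r by (simp add: U_def)
    then show "((\<lambda>r. u (r *\<^sub>R w)) has_real_derivative (\<Sum>i\<in>UNIV. w $ i * pd i u (r *\<^sub>R w))) (at r)"
      by (intro ray_deriv C_2D[OF U(1) Cu])
    show "((\<lambda>r. u (r *\<^sub>R w)) has_real_derivative radial1 k r * p w) (at r)"
      unfolding ray[OF w] using r by (intro DERIV_cmult_right radial_deriv) auto
  qed
  have u2: "(\<Sum>i\<in>UNIV. \<Sum>j\<in>UNIV. w $ i * w $ j * pd i (pd j u) (r *\<^sub>R w)) = radial2 k r * p w"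
    if w: "w \<in> sphere 0 1" and r: "0 < r" "r < L" for r w
  proof (rule DERIV_unique)
    have "r *\<^sub>R w \<in> U" using w r by (simp add: U_def)
    then show "((\<lambda>r. \<Sum>i\<in>UNIV. w $ i * pd i u (r *\<^sub>R w)) has_real_derivative (\<Sum>i\<in>UNIV. \<Sum>j\<in>UNIV. w $ i * w $ j * pd i (pd j u) (r *\<^sub>R w))) (at r)"
      by (intro ray_deriv2[OF U(1) Cu])
    show "((\<lambda>r. \<Sum>i\<in>UNIV. w $ i * pd i u (r *\<^sub>R w)) has_real_derivative radial2 k r * p w) (at r)"
    proof (rule has_field_derivative_transform_within_open)
      show "((\<lambda>r. radial1 k r * p w) has_real_derivative radial2 k r * p w) (at r)"
        using r by (intro DERIV_cmult_right radial_deriv) auto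
      show "radial1 k s * p w = (\<Sum>i\<in>UNIV. w $ i * pd i u (s *\<^sub>R w))" if "s \<in> {0<..<L}" for s
        using u1[OF w, of s] that by simp
    qed (use r in auto)
  qed
  have eu: "euler u x = norm x * radial1 k (norm x) * p (x /\<^sub>R norm x)" if "x \<noteq> 0" "norm x < L" for x
  proof -
    have "norm x * (\<Sum>i\<in>UNIV. (x /\<^sub>R norm x) $ i * pd i u (norm x *\<^sub>R (x /\<^sub>R norm x))) = euler u x"
      using that by (simp add: euler_def sum_distrib_left cancel_inverse)
    then show ?thesis using u1[OF normalized_in_sphere[OF that(1)], of "norm x"] that by simp
  qed
  have hu: "radial_hess u x = (norm x)\<^sup>2 * (radial2 k (norm x) * p (x /\<^sub>R norm x))" if "x \<noteq> 0" "norm x < L" for x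
  proof -
    have "(norm x)\<^sup>2 * (\<Sum>i\<in>UNIV. \<Sum>j\<in>UNIV. (x /\<^sub>R norm x) $ i * (x /\<^sub>R norm x) $ j * pd i (pd j u) (norm x *\<^sub>R (x /\<^sub>R norm x))) = radial_hess u x"
      using that by (simp add: radial_hess_def sum_distrib_left power2_eq_square field_simps)
    then show ?thesis using u2[OF normalized_in_sphere[OF that(1)], of "norm x"] that by simp
  qed
  have rotg: "rot i j g x = 0" if "x \<in> U" for i j x
  proof -
    obtain d where "(radial_factor k has_real_derivative d) (at ((norm x)\<^sup>2))"
      using radial_factor_deriv[of x] \<open>x \<in> U\<close> unfolding U_def by blast
    then show ?thesis unfolding g_def by (rule rot_radial)
  qed
  have rrot: "rot i j (rot i j u) x = g x * rot i j (rot i j p) x" if "x \<in> U" for i j x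
  proof -
    have 1: "rot i j (\<lambda>x. q x * g x) y = rot i j q y * g y" if "y \<in> U" "C_k_on 1 U q" for y q
      using C_k_on_differentiable[OF U(1) _ that(1), of 0] that Cg[of 1] rotg[OF that(1)]
      by (subst rot_mult) auto
    have r1: "rot i j u y = rot i j p y * g y" if "y \<in> U" for y
      unfolding u_def[abs_def] by (rule 1[OF that Cp])
    have "rot i j (rot i j u) x = rot i j (\<lambda>y. rot i j p y * g y) x"
      unfolding rot_def[of i j "rot i j u"] rot_def[of i j "\<lambda>y. rot i j p y * g y"]
      using pd_cong[OF U(1) that r1] by simp
    also have "\<dots> = rot i j (rot i j p) x * g x"
      by (rule 1[OF that C_k_on_rot[OF U(1)]]) (use Cp[of 2] in \<open>simp add: numeral_2_eq_2\<close>)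
    finally show ?thesis by (simp only: mult.commute)
  qed
  \<comment> \<open>\<open>g\<close> is radial, so the rotation fields act on \<open>p\<close>
    alone, and \<open>p\<close> restricts to a spherical harmonic of degree k.\<close>
  have ang: "(norm x)\<^sup>2 * laplacian u x - radial_hess u x - (real n - 1) * euler u x = - lam k * u x" if "x \<in> U" for x
  proof -
    have "2 * ((norm x)\<^sup>2 * laplacian u x - radial_hess u x - (real n - 1) * euler u x) = (\<Sum>i\<in>UNIV. \<Sum>j\<in>UNIV. rot i j (rot i j u) x)"
      using rot_rot_sum[OF U(1) Cu that] n by simp
    also have "\<dots> = g x * (\<Sum>i\<in>UNIV. \<Sum>j\<in>UNIV. rot i j (rot i j p) x)"
      by (simp add: rrot[OF that] sum_distrib_left)
    also have "\<dots> = g x * (2 * (- lam k * p x))"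
      unfolding rot_rot_sum[OF U(1) Cp that] ops(1,2,3) n by (simp add: lam_def algebra_simps)
    also have "\<dots> = 2 * (- lam k * u x)" by (simp add: u_def)
    finally show ?thesis by (simp only: mult_cancel_left) simp
  qed
  have LB: "laplace_beltrami (warped_metric h) u x = 0" if x: "x \<in> ball 0 R" for x
  proof (cases "x = 0")
    case False
    define r where "r = norm x"
    have r: "0 < r" "0 \<le> r" "r < L" using x False R by (auto simp: r_def)
    have xU: "x \<in> U" using r by (simp add: U_def r_def)
    have ux: "u x = radial k r * p (x /\<^sub>R norm x)"
      using ray[OF normalized_in_sphere[OF False], of r] False by (simp add: r_def)
    have "(h r)\<^sup>2 * laplace_beltrami (warped_metric h) u x =
      ((h r)\<^sup>2 * radial2 k r + (real n - 1) * h r * c r * radial1 k r - lam k * radial k r) * p (x /\<^sub>R norm x)"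
      using laplace_beltrami_away[OF n U(1) Cu xU False, folded r_def] r False
      unfolding ang[OF xU, folded r_def] ux
      by (simp add: eu hu r_def[symmetric] algebra_simps)
    then show ?thesis using radial_ode[OF r(2,3), of k] h_pos[OF r(1,3)] by simp
  next
    case True
    have 0: "0 \<in> U" using R by (simp add: U_def)
    \<comment> \<open>For k > 0 the product rule leaves only the Laplacian of \<open>p\<close> times
      g(0), as p(0) = 0 and \<open>g\<close> has zero gradient at the centre. For k = 0,
      \<open>u\<close> is constant.\<close>
    have "laplacian u 0 = 0"
    proof (cases "k = 0")
      case True
      have "u = (\<lambda>x. 1)"
        by (auto simp: u_def p_def g_def True radial_factor_def profile_def)
      then show ?thesis by (simp add: laplacian_def pd_const[abs_def])
    next
      case False
      have pd0: "pd i g 0 = 0" for i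
      proof -
        obtain d where "(radial_factor k has_real_derivative d) (at ((norm (0::real^'n))\<^sup>2))"
          using radial_factor_deriv[of "0::real^'n"] 0 unfolding U_def by blast
        from pd_chain(1)[OF this norm_square_differentiable] show ?thesis
          unfolding g_def by (simp add: pd_norm_square)
      qed
      have "pd i (pd i u) 0 = pd i (pd i p) 0 * g 0" for i
      proof -
        have "pd i (pd i u) 0 = pd i (\<lambda>x. p x * pd i g x + pd i p x * g x) 0"
          by (rule pd_cong[OF U(1) 0])
            (unfold u_def[abs_def], intro pd_mult C_2D[OF U(1)] Cp Cg)
        also have "\<dots> = p 0 * pd i (pd i g) 0 + pd i p 0 * pd i g 0 + (pd i p 0 * pd i g 0 + pd i (pd i p) 0 * g 0)"
          by (simp add: pd_add pd_mult differentiable_mult C_2D[OF U(1) Cp 0] C_2D[OF U(1) Cg 0])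
        also have "p 0 = 0" using False by (simp add: p_def f.zero power_0_left)
        finally show ?thesis by (simp add: pd0)
      qed
      then have "laplacian u 0 = laplacian p 0 * g 0" by (simp add: laplacian_def sum_distrib_right)
      then show ?thesis by (simp add: ops)
    qed
    then show ?thesis
      unfolding True using R by (subst laplace_beltrami_0[OF n _ U(1) Cu 0]) auto
  qed
  have bd: "frechet_derivative u (at x) \<nu> = steklov k R * u x"
    if x: "x \<in> frontier (cball 0 R)" and \<nu>: "outward_unit_normal (warped_metric h) (cball 0 R) x \<nu>" for x \<nu>
  proof -
    have nx: "norm x = R" using x R by simp
    then have x0: "x \<noteq> 0" "x \<in> U" using R by (auto simp: U_def)
    have \<nu>': "\<nu> = x /\<^sub>R R"
      using \<nu> outward_unit_normal_cball[OF nx R(1), of h \<nu>] h_pos[OF R] by simp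
    have "euler u x = R * (\<Sum>i\<in>UNIV. (x /\<^sub>R R) $ i * pd i u x)"
      using R by (simp add: euler_def sum_distrib_left cancel_inverse)
    then have "frechet_derivative u (at x) \<nu> = euler u x / R"
      unfolding frechet_derivative_pd[OF C_2D(1)[OF U(1) Cu x0(2)]] \<nu>' using R by simp
    also have "\<dots> = radial1 k R * p (x /\<^sub>R norm x)"
      using eu[OF x0(1)] nx R by simp
    also have "\<dots> = steklov k R * (radial k R * p (x /\<^sub>R norm x))"
      using radial_pos[OF R, of k] by (simp add: steklov_def)
    also have "radial k R * p (x /\<^sub>R norm x) = u x"
      using ray[OF normalized_in_sphere[OF x0(1)], of R] nx R by simp
    finally show ?thesis .
  qed
  have "u (R *\<^sub>R axis a 1) \<noteq> 0"
  proof -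
    have "f (axis a 1) = 1" using ab by (simp add: f_def axis_def)
    then show ?thesis using ray[of "axis a 1" R] radial_pos[OF R, of k] by (simp add: p_def)
  qed
  moreover have "R *\<^sub>R axis a 1 \<in> cball (0::real^'n) R" using R by simp
  ultimately show ?thesis
    unfolding steklov_eigenvalue_def smooth_up_to_boundary_def interior_cball
    using U Cu LB bd by (intro exI[of _ u] conjI) blast+
qed

lemma steklov_eigenvalue_iff:
  assumes n: "CARD('n) = n" and R: "0 < R" "R < L"
  shows "steklov_eigenvalue (warped_metric h :: real^'n \<Rightarrow> real^'n^'n) (cball 0 R) \<sigma> \<longleftrightarrow> (\<exists>k. \<sigma> = steklov k R)"
proof
  assume "steklov_eigenvalue (warped_metric h :: real^'n \<Rightarrow> real^'n^'n) (cball 0 R) \<sigma>"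
  then obtain u where smooth: "smooth_up_to_boundary (cball 0 R) u" and nz: "\<exists>x\<in>cball 0 R. u x \<noteq> 0"
    and harm: "\<forall>x\<in>interior (cball 0 R). laplace_beltrami (warped_metric h :: real^'n \<Rightarrow> real^'n^'n) u x = 0"
    and bd: "\<forall>x\<in>frontier (cball 0 R). \<forall>\<nu>. outward_unit_normal (warped_metric h) (cball 0 R) x \<nu> \<longrightarrow>
      frechet_derivative u (at x) \<nu> = \<sigma> * u x"
    unfolding steklov_eigenvalue_def by (elim exE conjE)
  from smooth obtain U where U: "open U" "cball 0 R \<subseteq> U" "\<forall>k. C_k_on k U u"
    unfolding smooth_up_to_boundary_def by (elim exE conjE)
  then have Cu: "C_k_on k U u" for k by iprover
  from nz obtain x where x: "x \<in> cball 0 R" "u x \<noteq> 0" by (elim bexE)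
  show "\<exists>k. \<sigma> = steklov k R"
  proof (rule ccontr)
    assume *: "\<nexists>k. \<sigma> = steklov k R"
    have "u x = 0"
    proof (rule steklov_complete[OF n R U(1,2) Cu _ _ _ x(1)])
      show "laplace_beltrami (warped_metric h) u y = 0" if "y \<in> ball 0 R" for y
        using harm that by simp
      show "\<sigma> \<noteq> steklov k R" for k using * by blast
      fix y :: "real^'n" assume y: "norm y = R"
      then have yU: "y \<in> U" using U(2) by auto
      have "outward_unit_normal (warped_metric h) (cball 0 R) y (y /\<^sub>R R)"
        using outward_unit_normal_cball[OF y R(1)] h_pos[OF R] by simp
      moreover have "y \<in> frontier (cball 0 R)" using y R by simp
      ultimately have "frechet_derivative u (at y) (y /\<^sub>R R) = \<sigma> * u y" using bd by blast
      moreover have "euler u y = R * (\<Sum>i\<in>UNIV. (y /\<^sub>R R) $ i * pd i u y)"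
        using R by (simp add: euler_def sum_distrib_left cancel_inverse)
      ultimately show "euler u y = R * \<sigma> * u y"
        unfolding frechet_derivative_pd[OF C_2D(1)[OF U(1) Cu yU]] by simp
    qed
    with x(2) show False by simp
  qed
qed (use steklov_exists[OF n R] in auto)

text \<open>Strict monotonicity in the degree puts exactly the j smaller degrees below
  \<open>steklov j R\<close>; counting from 0, the index is the degree.\<close>

lemma steklov_nth_eigenvalue_eq:
  assumes n: "CARD('n) = n" and R: "0 < R" "R < L"
  shows "steklov_nth_eigenvalue (warped_metric h :: real^'n \<Rightarrow> real^'n^'n) (cball 0 R) m = steklov m R"
proof -
  have mono: "strict_mono (\<lambda>k. steklov k R)"
    using steklov_strict_mono[OF R] by (rule strict_monoI)
  have "{\<tau>. (\<exists>k. \<tau> = steklov k R) \<and> \<tau> < steklov j R} = (\<lambda>k. steklov k R) ` {..<j}" for j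
    using strict_mono_less[OF mono] by auto
  moreover have "card ((\<lambda>k. steklov k R) ` {..<j}) = j" for j
    using strict_mono_imp_inj_on[OF mono] by (simp add: card_image)
  ultimately show ?thesis
    unfolding steklov_nth_eigenvalue_def steklov_eigenvalue_iff[OF n R]
    by (intro the_equality) auto
qed

lemma scaled_eigenvalue_mono:
  assumes n: "CARD('n) = n" and R: "0 < r" "r < s" "s < L" and m: "m > 0" "\<kappa> \<noteq> 0"
  defines "\<sigma> \<equiv> \<lambda>R. steklov_nth_eigenvalue (warped_metric h :: real^'n \<Rightarrow> real^'n^'n) (cball 0 R) m"
  shows "\<kappa> * (\<sigma> r * h r) < \<kappa> * (\<sigma> s * h s)"
  using scaled_steklov_mono[OF R m] R by (simp add: \<sigma>_def steklov_nth_eigenvalue_eq[OF n])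

end

section \<open>Power series for the circular and hyperbolic functions\<close>

definition power_series_derivs :: "(nat \<Rightarrow> real) \<Rightarrow> nat \<Rightarrow> real \<Rightarrow> real"
  where "power_series_derivs a j z = (\<Sum>i. (diffs ^^ j) a i * z ^ i)"

lemma power_series_derivs_deriv:
  assumes "\<And>z. summable (\<lambda>i. a i * z ^ i)"
  shows "(power_series_derivs a j has_real_derivative power_series_derivs a (Suc j) z) (at z)"
proof -
  have "summable (\<lambda>i. (diffs ^^ j) a i * z ^ i)" for z
    by (induction j arbitrary: z) (use assms in \<open>auto intro!: termdiff_converges_all\<close>)
  then show ?thesis
    unfolding power_series_derivs_def[abs_def] by (auto intro!: termdiffs_strong_converges_everywhere)
qed

text \<open>The odd and the even part of the exponential series: \<open>k = 1\<close> gives \<open>sin (r) / r\<close> and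
  \<open>sinh (r) / r\<close>, \<open>k = 0\<close> gives \<open>cos\<close> and \<open>cosh\<close>, as functions of \<open>r\<^sup>2\<close>.\<close>
definition half_exp_coeff :: "real \<Rightarrow> nat \<Rightarrow> nat \<Rightarrow> real"
  where "half_exp_coeff \<epsilon> k i = \<epsilon> ^ i / fact (2 * i + k)"

text \<open>As (2 i + k)! >= i!, the exponential series dominates for every z, so arbitrarily large
  hyperbolic radii are covered.\<close>

lemma half_exp_summable: "summable (\<lambda>i. half_exp_coeff \<epsilon> k i * z ^ i)"
proof (rule summable_comparison_test')
  show "summable (\<lambda>i. (\<bar>\<epsilon>\<bar> * \<bar>z\<bar>) ^ i /\<^sub>R fact i)" by (rule summable_exp_generic)
  fix i :: nat
  have "(fact i :: real) \<le> fact (2 * i + k)" by (intro fact_mono) auto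
  then have "(\<bar>\<epsilon>\<bar> * \<bar>z\<bar>) ^ i / fact (2 * i + k) \<le> (\<bar>\<epsilon>\<bar> * \<bar>z\<bar>) ^ i / fact i"
    by (intro divide_left_mono) auto
  then show "norm (half_exp_coeff \<epsilon> k i * z ^ i) \<le> (\<bar>\<epsilon>\<bar> * \<bar>z\<bar>) ^ i /\<^sub>R fact i"
    by (simp add: half_exp_coeff_def abs_mult power_abs power_mult_distrib divide_inverse mult_ac)
qed

lemma half_exp_sums: "(\<lambda>i. half_exp_coeff \<epsilon> k i * z ^ i) sums power_series_derivs (half_exp_coeff \<epsilon> k) 0 z"
  unfolding power_series_derivs_def using half_exp_summable by (simp add: summable_sums)

lemma odd_even_power:
  fixes r :: real
  shows "r ^ (2 * i + 1) = r * (r\<^sup>2) ^ i" "r ^ (2 * i) = (r\<^sup>2) ^ i"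
  by (simp_all add: power_mult)

lemma half_exp_trig:
  "sin r = r * power_series_derivs (half_exp_coeff (-1) 1) 0 (r\<^sup>2)"
  "cos r = power_series_derivs (half_exp_coeff (-1) 0) 0 (r\<^sup>2)"
proof -
  have "(\<lambda>i. r * (half_exp_coeff (-1) 1 i * (r\<^sup>2) ^ i)) = (\<lambda>i. (-1) ^ i / fact (2 * i + 1) * r ^ (2 * i + 1))"
    unfolding odd_even_power half_exp_coeff_def by (simp only: mult_ac)
  then show "sin r = r * power_series_derivs (half_exp_coeff (-1) 1) 0 (r\<^sup>2)"
    using sums_mult[OF half_exp_sums[of "-1" 1 "r\<^sup>2"], of r] sin_paired[of r] sums_unique2 by metis
  have "(\<lambda>i. half_exp_coeff (-1) 0 i * (r\<^sup>2) ^ i) = (\<lambda>i. (-1) ^ i / fact (2 * i) * r ^ (2 * i))"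
    unfolding odd_even_power half_exp_coeff_def by simp
  then show "cos r = power_series_derivs (half_exp_coeff (-1) 0) 0 (r\<^sup>2)"
    using half_exp_sums[of "-1" 0 "r\<^sup>2"] cos_paired[of r] sums_unique2 by metis
qed

lemma half_exp_hyperbolic:
  fixes r :: real
  shows "sinh r = r * power_series_derivs (half_exp_coeff 1 1) 0 (r\<^sup>2)"
    and "cosh r = power_series_derivs (half_exp_coeff 1 0) 0 (r\<^sup>2)"
proof -
  \<comment> \<open>The series of sinh runs over all exponents, with zeros at the even ones;
    reindexing along 2 i + 1 discards them.\<close>
  have "(\<lambda>i. (\<lambda>n. if even n then 0 else r ^ n /\<^sub>R fact n) (2 * i + 1)) sums sinh r"
    by (subst sums_mono_reindex) (auto simp: strict_mono_def sinh_converges elim!: oddE)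
  moreover have "(\<lambda>i. r * (half_exp_coeff 1 1 i * (r\<^sup>2) ^ i)) = (\<lambda>i. (\<lambda>n. if even n then 0 else r ^ n /\<^sub>R fact n) (2 * i + 1))"
    unfolding odd_even_power half_exp_coeff_def by (simp add: divide_inverse mult.left_commute)
  ultimately show "sinh r = r * power_series_derivs (half_exp_coeff 1 1) 0 (r\<^sup>2)"
    using sums_mult[OF half_exp_sums[of 1 1 "r\<^sup>2"], of r] sums_unique2 by metis
  have "(\<lambda>i. (\<lambda>n. if even n then r ^ n /\<^sub>R fact n else 0) (2 * i)) sums cosh r"
    by (subst sums_mono_reindex) (auto simp: strict_mono_def cosh_converges elim!: evenE)
  moreover have "(\<lambda>i. half_exp_coeff 1 0 i * (r\<^sup>2) ^ i) = (\<lambda>i. (\<lambda>n. if even n then r ^ n /\<^sub>R fact n else 0) (2 * i))"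
    unfolding odd_even_power half_exp_coeff_def by (simp add: divide_inverse)
  ultimately show "cosh r = power_series_derivs (half_exp_coeff 1 0) 0 (r\<^sup>2)"
    using half_exp_sums[of 1 0 "r\<^sup>2"] sums_unique2 by metis
qed

theorem theorem15:
  fixes m :: nat
  assumes "CARD('n::finite) \<ge> 3" and "m \<ge> 1"
  shows "strict_mono_on {0<..<pi}
      (\<lambda>R. steklov_nth_eigenvalue (sphere_metric :: real^'n \<Rightarrow> real^'n^'n) (cball 0 R) m * sin R) \<and>
    strict_antimono_on {0<..}
      (\<lambda>R. steklov_nth_eigenvalue (hyperbolic_metric :: real^'n \<Rightarrow> real^'n^'n) (cball 0 R) m * sinh R)"
proof -
  let ?F = "\<lambda>\<epsilon> k. power_series_derivs (half_exp_coeff \<epsilon> k)"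
  have S: "analytic_warping sin cos 1 pi CARD('n) (?F (-1) 1) (?F (-1) 0)"
  proof unfold_locales
    show "-1 < cos r" if "0 \<le> r" "r < pi" for r
      using cos_monotone_0_pi[of r pi] that by simp
  qed (auto intro!: derivative_eq_intros power_series_derivs_deriv half_exp_summable half_exp_trig[unfolded One_nat_def] sin_gt_zero assms)
  \<comment> \<open>No radius is excluded in hyperbolic space, so \<open>L\<close> is free and can
    be chosen beyond the larger of two given radii.\<close>
  have H: "analytic_warping sinh cosh (-1) L CARD('n) (?F 1 1) (?F 1 0)" for L
  proof unfold_locales
    show "-1 < cosh r" for r :: real
      using cosh_real_ge_1[of r] by simp
  qed (auto intro!: derivative_eq_intros power_series_derivs_deriv half_exp_summable half_exp_hyperbolic[unfolded One_nat_def] assms)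
  show ?thesis
  proof (intro conjI strict_mono_onI monotone_onI)
    fix r s :: real
    assume "r \<in> {0<..<pi}" "s \<in> {0<..<pi}" "r < s"
    then show "steklov_nth_eigenvalue (sphere_metric :: real^'n \<Rightarrow> real^'n^'n) (cball 0 r) m * sin r <
        steklov_nth_eigenvalue (sphere_metric :: real^'n \<Rightarrow> real^'n^'n) (cball 0 s) m * sin s"
      using analytic_warping.scaled_eigenvalue_mono[OF S refl, of r s m] assms(2) by auto
  next
    fix r s :: real
    assume "r \<in> {0<..}" "s \<in> {0<..}" "r < s"
    \<comment> \<open>Here \<kappa> = -1, which reverses the inequality.\<close>
    then show "steklov_nth_eigenvalue (hyperbolic_metric :: real^'n \<Rightarrow> real^'n^'n) (cball 0 s) m * sinh s <
        steklov_nth_eigenvalue (hyperbolic_metric :: real^'n \<Rightarrow> real^'n^'n) (cball 0 r) m * sinh r"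
      using analytic_warping.scaled_eigenvalue_mono[OF H[of "s + 1"] refl, of r s m] assms(2) by auto
  qed
qed

end
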